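(* There is an algorithm that, given any strings $A$ and $B$ of length $n$ and a string $P$ of length $r$, solves the STR-IC-LCS problem (that is, computes an STR-IC-LCS of $A$, $B$ and $P$) in $O(nr/\log r+n(n-\ell'+1))$ time and $O((\ell'+1)(n-\ell'+1))$ space, where $\ell'$ is the length of an STR-IC-LCS of $A$, $B$ and $P$.
   Context: Strings are over an alphabet $\Sigma$. A subsequence of a string is obtained by deleting zero or more characters; a substring is a contiguous block; a common subsequence of $A$ and $B$ is a string that is a subsequence of both. A string $Z$ is an STR-IC-LCS of $A$ and $B$ including $P$ (an STR-IC-LCS of $A$, $B$ and $P$) if $Z$ is a longest string such that (1) $P$ is a substring of $Z$ and (2) $Z$ is a common subsequence of $A$ and $B$. If no such string exists, the solution is by convention $Z=\bot$ with $|\bot|=-1$. The STR-IC-LCS problem is: given $A,B$ of length $n$ and $P$, compute an STR-IC-LCS of $A$, $B$ and $P$. It is assumed that $r=|P|\le n$ (otherwise there is no solution). Time and working space are measured in the usual word RAM model (word size $\log_2 n$, space counted in words). *)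

theory Defs
  imports Complex_Main "HOL-Library.Sublist"
begin

definition str_ic_cs :: "'a list \<Rightarrow> 'a list \<Rightarrow> 'a list \<Rightarrow> 'a list \<Rightarrow> bool" where
  "str_ic_cs A B P Z \<longleftrightarrow> sublist P Z \<and> subseq Z A \<and> subseq Z B"

text \<open>Solutions are options: \<^term>\<open>None\<close> stands for the undefined solution, whose length is
  \<open>-1\<close> by convention.\<close>

fun is_str_ic_lcs :: "'a list \<Rightarrow> 'a list \<Rightarrow> 'a list \<Rightarrow> 'a list option \<Rightarrow> bool" where
  "is_str_ic_lcs A B P (Some Z) \<longleftrightarrow> is_arg_max length (str_ic_cs A B P) Z"
| "is_str_ic_lcs A B P None \<longleftrightarrow> (\<nexists>Z. str_ic_cs A B P Z)"

fun sol_length :: "'a list option \<Rightarrow> int" where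
  "sol_length (Some Z) = int (length Z)"
| "sol_length None = -1"

text \<open>
  A word RAM with \<open>w\<close>-bit words. Words are natural numbers below \<open>2 ^ w\<close>; they are not elements of
  a word type because the word size varies with the input while the program stays fixed. A machine has
  registers (a program names only finitely many of them), a zero-initialised word-addressed working
  memory, a read-only input array and a write-only output sequence. Each instruction takes one
  time step.
\<close>

datatype word_op = Add | Sub | Mul | Div | Mod | And | Or | Xor | Shl | Shr | Lt | Eq

context
  includes bit_operations_syntax
begin

fun eval_op :: "nat \<Rightarrow> word_op \<Rightarrow> nat \<Rightarrow> nat \<Rightarrow> nat" where
  "eval_op w Add x y = (x + y) mod 2 ^ w"
| "eval_op w Sub x y = nat ((int x - int y) mod 2 ^ w)"
| "eval_op w Mul x y = (x * y) mod 2 ^ w"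
| "eval_op w Div x y = x div y"
| "eval_op w Mod x y = x mod y"
| "eval_op w And x y = x AND y"
| "eval_op w Or x y = x OR y"
| "eval_op w Xor x y = x XOR y"
| "eval_op w Shl x y = push_bit y x mod 2 ^ w"
| "eval_op w Shr x y = drop_bit y x"
| "eval_op w Lt x y = of_bool (x < y)"
| "eval_op w Eq x y = of_bool (x = y)"

end

text \<open>All arguments of instructions are register numbers, except the literal in \<open>Const\<close> and the
  jump target in \<open>JumpZero\<close>. Destination registers come first.\<close>

datatype instr =
    Const nat nat
  | Op word_op nat nat nat
  | Input nat nat
  | Load nat nat
  | Store nat nat
  | Output nat
  | JumpZero nat nat

type_synonym program = "instr list"

text \<open>\<open>used\<close> is a ghost component: the least bound on all working-memory addresses read or written
  so far. Registers are not counted, their number being a constant of the program.\<close>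

record config =
  pc :: nat
  reg :: "nat \<Rightarrow> nat"
  mem :: "nat \<Rightarrow> nat"
  out :: "nat list"
  used :: nat

definition init_config :: config where
  "init_config = \<lparr>pc = 0, reg = (\<lambda>_. 0), mem = (\<lambda>_. 0), out = [], used = 0\<rparr>"

fun exec_instr :: "nat \<Rightarrow> nat list \<Rightarrow> instr \<Rightarrow> config \<Rightarrow> config" where
  "exec_instr w inp (Const d c) s =
     s\<lparr>pc := Suc (pc s), reg := (reg s)(d := c mod 2 ^ w)\<rparr>"
| "exec_instr w inp (Op f d a b) s =
     s\<lparr>pc := Suc (pc s), reg := (reg s)(d := eval_op w f (reg s a) (reg s b))\<rparr>"
| "exec_instr w inp (Input d a) s =
     s\<lparr>pc := Suc (pc s),
       reg := (reg s)(d := if reg s a < length inp then inp ! reg s a else 0)\<rparr>"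
| "exec_instr w inp (Load d a) s =
     s\<lparr>pc := Suc (pc s), reg := (reg s)(d := mem s (reg s a)),
       used := max (used s) (Suc (reg s a))\<rparr>"
| "exec_instr w inp (Store a b) s =
     s\<lparr>pc := Suc (pc s), mem := (mem s)(reg s a := reg s b),
       used := max (used s) (Suc (reg s a))\<rparr>"
| "exec_instr w inp (Output a) s =
     s\<lparr>pc := Suc (pc s), out := out s @ [reg s a]\<rparr>"
| "exec_instr w inp (JumpZero a l) s =
     s\<lparr>pc := if reg s a = 0 then l else Suc (pc s)\<rparr>"

definition halted :: "program \<Rightarrow> config \<Rightarrow> bool" where
  "halted prog s \<longleftrightarrow> length prog \<le> pc s"

definition step :: "nat \<Rightarrow> program \<Rightarrow> nat list \<Rightarrow> config \<Rightarrow> config" where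
  "step w prog inp s = (if halted prog s then s else exec_instr w inp (prog ! pc s) s)"

text \<open>On word size \<open>w\<close> and input \<open>inp\<close>, the program halts after exactly \<open>t\<close> steps with output
  \<open>res\<close>, having used \<open>m\<close> words of working memory.\<close>

definition runs_to ::
    "nat \<Rightarrow> program \<Rightarrow> nat list \<Rightarrow> nat list \<Rightarrow> nat \<Rightarrow> nat \<Rightarrow> bool" where
  "runs_to w prog inp res t m \<longleftrightarrow>
     (\<forall>i<t. \<not> halted prog ((step w prog inp ^^ i) init_config)) \<and>
     (let s = (step w prog inp ^^ t) init_config
      in halted prog s \<and> out s = res \<and> used s = m)"

definition encode_input :: "nat list \<Rightarrow> nat list \<Rightarrow> nat list \<Rightarrow> nat list" where
  "encode_input A B P = length A # length P # A @ B @ P"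

fun encode_sol :: "nat list option \<Rightarrow> nat list" where
  "encode_sol None = [0]"
| "encode_sol (Some Z) = 1 # Z"

text \<open>The two bounds whose \<open>O\<close>-classes are asserted. Taking \<open>max r 2\<close> makes the logarithm positive
  when \<open>r \<le> 1\<close>; the first summand is then at most \<open>n\<close>, hence dominated by the second one as
  \<open>l \<le> n\<close>.\<close>

definition time_bound :: "nat \<Rightarrow> nat \<Rightarrow> int \<Rightarrow> real" where
  "time_bound n r l =
     real n * real r / log 2 (real (max r 2)) + real n * (real n - real_of_int l + 1)"

definition space_bound :: "nat \<Rightarrow> int \<Rightarrow> real" where
  "space_bound n l = (real_of_int l + 1) * (real n - real_of_int l + 1)"

end

theory Submission
  imports Defs
begin

text \<open>A solution has the form \<open>X @ P @ Y\<close>. Let \<open>f k i\<close> and \<open>F k i\<close> be the lengths of the shortest prefix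
  of \<open>B\<close> which has, together with the prefix of \<open>A\<close> of length \<open>i\<close>, a common subsequence of length \<open>k\<close>,
  respectively one of length \<open>k\<close> that contains \<open>P\<close> as a substring. Both satisfy the same recurrence
  along diagonals: \<open>f k i\<close> is the minimum of \<open>f k (i - 1)\<close>, of the first match of \<open>A ! (i - 1)\<close> in \<open>B\<close>
  behind \<open>f (k - 1) (i - 1)\<close>, and of a base value. The base value of \<open>F\<close> matches \<open>P\<close> greedily in \<open>B\<close>
  behind \<open>f (k - r) s\<close>, where \<open>s\<close> is the latest start in \<open>A\<close> of an embedding of \<open>P\<close> that ends at \<open>i\<close>.

  A solution of length \<open>l\<close> leaves out \<open>n - l\<close> characters of \<open>A\<close> and of \<open>B\<close>, so only the entries with
  \<open>k \<le> i \<le> k + D\<close> and value at most \<open>k + D\<close> matter as soon as \<open>n - l \<le> D\<close>. The parameter \<open>D\<close> is doubled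
  until a solution appears. The matches searched for within one row lie in disjoint intervals of \<open>B\<close>
  because \<open>f k i\<close> increases with \<open>k\<close>; hence a row costs \<open>O(D + 1)\<close> and the search \<open>O(n (n - l + 1))\<close>. An
  entry \<open>f k i\<close> is only kept while \<open>P\<close> still fits behind it in both strings; then there is a solution
  of length at least \<open>k + r\<close>. So no table has more than \<open>l + 1\<close> columns.

  The ends of all greedy embeddings of \<open>P\<close> are found in time \<open>O(n r / log r)\<close> by simulating, for all
  starting positions at once, \<open>W = \<lfloor>log r\<rfloor>\<close> states of the greedy matching in one machine word.\<close>

section \<open>A structured language on the word RAM\<close>

text \<open>The length \<open>l\<close> is unknown to the program, so no table can be laid out in
  advance; a column is created only when a finite entry appears in it. Arrays of linear size do no
  harm, because \<open>(l + 1) * (n - l + 1)\<close> equals \<open>l * (n - l) + n + 1\<close>.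
  Without a solution the length is \<open>-1\<close> and the space bound vanishes up to the additive
  constant; hence existence is decided first, by greedy matching that works in registers alone.
  Cutting off large entries is delicate where \<open>F\<close> is started from \<open>f\<close>: if
  an entry of \<open>f\<close> in column \<open>k - r\<close> exceeds \<open>k - r + D\<close>, then
  placing \<open>P\<close> behind it adds at least \<open>r\<close>, so the base value exceeds
  \<open>k + D\<close> and would be cut off in \<open>F\<close> as well. The factor
  \<open>log r\<close> is obtained from \<open>W\<close> bits of a word, with
  \<open>2 ^ W \<le> max r 2\<close>, however large the machine word is. The factors in the time
  bounds are not optimised; they are chosen so that linear arithmetic closes the goals.\<close>

datatype ex = N nat | V nat | In ex | Ld nat ex | Bop word_op ex ex

datatype com = Set nat ex | St nat ex ex | Out ex | Seq com com | If ex com com | Wh ex com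

abbreviation Add' (infixl "+!" 65) where "a +! b \<equiv> Bop Add a b"
abbreviation Sub' (infixl "-!" 65) where "a -! b \<equiv> Bop Sub a b"
abbreviation Mul' (infixl "*!" 70) where "a *! b \<equiv> Bop Mul a b"
abbreviation Lt' (infix "<!" 55) where "a <! b \<equiv> Bop Lt a b"
abbreviation Eq' (infix "=!" 55) where "a =! b \<equiv> Bop Eq a b"
abbreviation And' (infixr "&!" 50) where "a &! b \<equiv> Bop And a b"
notation Seq (infixr ";;" 40)
notation Set (infix ":=!" 45)

text \<open>Variable \<open>x\<close> lives in register \<open>2 * x\<close>, the temporary of depth \<open>d\<close> in register \<open>2 * d + 1\<close>.
  Sixteen unbounded arrays are interleaved in the working memory: cell \<open>i\<close> of array \<open>a\<close> has
  address \<open>16 * i + a\<close>.\<close>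

definition tmp :: "nat \<Rightarrow> nat" where
  "tmp d = 2 * d + 1"

lemma tmp_simps [simp]: "tmp d \<noteq> 2 * x" "2 * x \<noteq> tmp d" "tmp d = tmp e \<longleftrightarrow> d = e"
  unfolding tmp_def by presburger+

text \<open>\<open>Or\<close> of a register with itself replaces a move instruction. Code for depth
  \<open>d\<close> writes only to temporaries from \<open>d\<close> on.\<close>

primrec cx :: "nat \<Rightarrow> ex \<Rightarrow> instr list" where
  "cx d (N c) = [Const (tmp d) c]"
| "cx d (V x) = [Op Or (tmp d) (2*x) (2*x)]"
| "cx d (In e) = cx d e @ [Input (tmp d) (tmp d)]"
| "cx d (Ld a e) = cx d e @ [Const (tmp (Suc d)) 16, Op Mul (tmp d) (tmp d) (tmp (Suc d)),
     Const (tmp (Suc d)) a, Op Add (tmp d) (tmp d) (tmp (Suc d)), Load (tmp d) (tmp d)]"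
| "cx d (Bop f a b) = cx d a @ cx (Suc d) b @ [Op f (tmp d) (tmp d) (tmp (Suc d))]"

primrec sz :: "ex \<Rightarrow> nat" where
  "sz (N c) = 1"
| "sz (V x) = 1"
| "sz (In e) = sz e + 1"
| "sz (Ld a e) = sz e + 5"
| "sz (Bop f a b) = sz a + sz b + 1"

lemma length_cx [simp]: "length (cx d e) = sz e"
  by (induction e arbitrary: d) auto

primrec csz :: "com \<Rightarrow> nat" where
  "csz (Set x e) = sz e + 1"
| "csz (St a i v) = sz i + sz v + 5"
| "csz (Out e) = sz e + 1"
| "csz (Seq c1 c2) = csz c1 + csz c2"
| "csz (If e c1 c2) = sz e + csz c1 + csz c2 + 3"
| "csz (Wh e c) = sz e + csz c + 3"

text \<open>Jump targets are absolute, hence the argument \<open>p\<close>, the address at which the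
  code will lie. The only jump is conditional; loading zero into \<open>tmp 0\<close> beforehand
  makes it unconditional.\<close>

primrec cc :: "nat \<Rightarrow> com \<Rightarrow> instr list" where
  "cc p (Set x e) = cx 0 e @ [Op Or (2*x) (tmp 0) (tmp 0)]"
| "cc p (St a i v) = cx 0 i @ [Const (tmp 1) 16, Op Mul (tmp 0) (tmp 0) (tmp 1), Const (tmp 1) a, Op Add (tmp 0) (tmp 0) (tmp 1)] @
     cx 1 v @ [Store (tmp 0) (tmp 1)]"
| "cc p (Out e) = cx 0 e @ [Output (tmp 0)]"
| "cc p (Seq c1 c2) = cc p c1 @ cc (p + csz c1) c2"
| "cc p (If e c1 c2) = cx 0 e @ [JumpZero (tmp 0) (p + sz e + csz c1 + 3)] @ cc (p + sz e + 1) c1 @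
     [Const (tmp 0) 0, JumpZero (tmp 0) (p + sz e + csz c1 + csz c2 + 3)] @ cc (p + sz e + csz c1 + 3) c2"
| "cc p (Wh e c) = cx 0 e @ [JumpZero (tmp 0) (p + sz e + csz c + 3)] @ cc (p + sz e + 1) c @
     [Const (tmp 0) 0, JumpZero (tmp 0) p]"

lemma length_cc [simp]: "length (cc p c) = csz c"
  by (induction c arbitrary: p) auto

definition code_at :: "program \<Rightarrow> nat \<Rightarrow> program \<Rightarrow> bool" where
  "code_at prog p cs \<longleftrightarrow> (\<forall>i<length cs. p + i < length prog \<and> prog ! (p + i) = cs ! i)"

lemma code_at_Nil [simp]: "code_at prog p []"
  by (simp add: code_at_def)

lemma code_at_Cons [simp]:
  "code_at prog p (x # xs) \<longleftrightarrow> p < length prog \<and> prog ! p = x \<and> code_at prog (Suc p) xs"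
  unfolding code_at_def by (auto simp: All_less_Suc2)

lemma code_at_append [simp]:
  "code_at prog p (xs @ ys) \<longleftrightarrow> code_at prog p xs \<and> code_at prog (p + length xs) ys"
  by (induction xs arbitrary: p) auto

section \<open>Exact arithmetic and weakest preconditions\<close>

context
  includes bit_operations_syntax
begin

text \<open>The operations in unbounded arithmetic. Programs are analysed with these, and the
  condition \<open>opok\<close> guarantees that the machine computes the same value.\<close>

fun xop :: "word_op \<Rightarrow> nat \<Rightarrow> nat \<Rightarrow> nat" where
  "xop Add x y = x + y"
| "xop Sub x y = x - y"
| "xop Mul x y = x * y"
| "xop Div x y = x div y"
| "xop Mod x y = x mod y"
| "xop And x y = x AND y"
| "xop Or x y = x OR y"
| "xop Xor x y = x XOR y"
| "xop Shl x y = push_bit y x"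
| "xop Shr x y = drop_bit y x"
| "xop Lt x y = of_bool (x < y)"
| "xop Eq x y = of_bool (x = y)"

end

text \<open>\<open>L\<close> bounds the indices of all sixteen arrays, so addresses stay below
  \<open>16 * L\<close>, and the second assumption makes the address arithmetic exact. The first one
  allows the stride 16 to be loaded as a constant.\<close>

locale ram =
  fixes w :: nat and inp :: "nat list" and L :: nat
  assumes w16: "16 < (2::nat) ^ w" and L16: "16 * L \<le> (2::nat) ^ w"
begin

fun opok :: "word_op \<Rightarrow> nat \<Rightarrow> nat \<Rightarrow> bool" where
  "opok Add x y = (x + y < 2 ^ w)"
| "opok Sub x y = (y \<le> x \<and> x < 2 ^ w)"
| "opok Mul x y = (x * y < 2 ^ w)"
| "opok Shl x y = (push_bit y x < 2 ^ w)"
| "opok _ x y = True"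

lemma eval_op_exact: "opok f x y \<Longrightarrow> eval_op w f x y = xop f x y"
proof (cases f)
  case Sub
  moreover assume "opok f x y"
  ultimately have "y \<le> x" "x < 2 ^ w"
    by simp_all
  then have "(int x - int y) mod 2 ^ w = int (x - y)"
    by (metis mod_pos_pos_trivial of_nat_0_le_iff of_nat_diff of_nat_less_iff of_nat_numeral
        of_nat_power less_imp_diff_less)
  then show ?thesis
    using Sub by simp
qed simp_all

primrec ev :: "(nat \<Rightarrow> nat) \<Rightarrow> (nat \<Rightarrow> nat \<Rightarrow> nat) \<Rightarrow> ex \<Rightarrow> nat" where
  "ev R M (N c) = c"
| "ev R M (V x) = R x"
| "ev R M (In e) = (if ev R M e < length inp then inp ! ev R M e else 0)"
| "ev R M (Ld a e) = M a (ev R M e)"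
| "ev R M (Bop f a b) = xop f (ev R M a) (ev R M b)"

primrec ok :: "(nat \<Rightarrow> nat) \<Rightarrow> (nat \<Rightarrow> nat \<Rightarrow> nat) \<Rightarrow> ex \<Rightarrow> bool" where
  "ok R M (N c) = (c < 2 ^ w)"
| "ok R M (V x) = True"
| "ok R M (In e) = ok R M e"
| "ok R M (Ld a e) = (ok R M e \<and> a < 16 \<and> ev R M e < L)"
| "ok R M (Bop f a b) = (ok R M a \<and> ok R M b \<and> opok f (ev R M a) (ev R M b))"

text \<open>Weakest preconditions. The last argument of a predicate is the time elapsed so far; every
  memory access has to be at an array index below \<open>L\<close>, and no operation may overflow. Specifications
  of programs are stated in continuation-passing form: \<open>Q\<close> stays a variable, and it is assumed to
  hold in every state in which the program can stop.\<close>

primrec wp :: "com \<Rightarrow> ((nat \<Rightarrow> nat) \<Rightarrow> (nat \<Rightarrow> nat \<Rightarrow> nat) \<Rightarrow> nat list \<Rightarrow> nat \<Rightarrow> bool) \<Rightarrow>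
    (nat \<Rightarrow> nat) \<Rightarrow> (nat \<Rightarrow> nat \<Rightarrow> nat) \<Rightarrow> nat list \<Rightarrow> nat \<Rightarrow> bool" where
  "wp (Set x e) = (\<lambda>Q R M U T. ok R M e \<and> Q (R(x := ev R M e)) M U (T + (sz e + 1)))"
| "wp (St a i v) = (\<lambda>Q R M U T. ok R M i \<and> ok R M v \<and> a < 16 \<and> ev R M i < L \<and>
     Q R (M(a := (M a)(ev R M i := ev R M v))) U (T + (sz i + sz v + 5)))"
| "wp (Out e) = (\<lambda>Q R M U T. ok R M e \<and> Q R M (U @ [ev R M e]) (T + (sz e + 1)))"
| "wp (Seq c1 c2) = (\<lambda>Q. wp c1 (wp c2 Q))"
| "wp (If e c1 c2) = (\<lambda>Q R M U T. ok R M e \<and>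
     (if ev R M e = 0 then wp c2 Q R M U (T + (sz e + 1))
      else wp c1 (\<lambda>R M U T. Q R M U (T + 2)) R M U (T + (sz e + 1))))"
| "wp (Wh e c) = (\<lambda>Q R M U T. \<exists>m. rec_nat (\<lambda>_ _ _ _. False)
     (\<lambda>_ X R M U T. ok R M e \<and> (if ev R M e = 0 then Q R M U (T + (sz e + 1))
        else wp c (\<lambda>R M U T. X R M U (T + 2)) R M U (T + (sz e + 1)))) m R M U T)"

lemma wp_mono:
  "wp c Q R M U T \<Longrightarrow> (\<And>R M U T. Q R M U T \<Longrightarrow> Q' R M U T) \<Longrightarrow> wp c Q' R M U T"
proof (induction c arbitrary: Q Q' R M U T)
  case (Seq c1 c2)
  show ?case
    using Seq.prems(1) Seq.IH(1)[of "wp c2 Q" _ _ _ _ "wp c2 Q'"]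
      Seq.IH(2)[of Q _ _ _ _ Q'] Seq.prems(2) by simp
next
  case (If e c1 c2)
  show ?case
    using If.prems(1) If.IH(1)[of "\<lambda>R M U T. Q R M U (T + 2)" _ _ _ _ "\<lambda>R M U T. Q' R M U (T + 2)"]
      If.IH(2)[of Q _ _ _ _ Q'] If.prems(2) by (auto split: if_splits)
next
  case (Wh e c)
  define X where "X Q m = rec_nat (\<lambda>_ _ _ _. False)
     (\<lambda>_ X R M U T. ok R M e \<and> (if ev R M e = 0 then Q R M U (T + (sz e + 1))
        else wp c (\<lambda>R M U T. X R M U (T + 2)) R M U (T + (sz e + 1)))) m" for Q :: "(nat \<Rightarrow> nat) \<Rightarrow> (nat \<Rightarrow> nat \<Rightarrow> nat) \<Rightarrow> nat list \<Rightarrow> nat \<Rightarrow> bool" and m :: nat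
  have XS: "X Q (Suc m) = (\<lambda>R M U T. ok R M e \<and> (if ev R M e = 0 then Q R M U (T + (sz e + 1))
        else wp c (\<lambda>R M U T. X Q m R M U (T + 2)) R M U (T + (sz e + 1))))" for Q m
    by (simp only: X_def nat.rec)
  have "X Q m R M U T \<Longrightarrow> X Q' m R M U T" for m R M U T
  proof (induction m arbitrary: R M U T)
    case (Suc m)
    have "wp c (\<lambda>R M U T. X Q m R M U (T + 2)) R M U T \<Longrightarrow> wp c (\<lambda>R M U T. X Q' m R M U (T + 2)) R M U T"
      for R M U T
      by (erule Wh.IH) (rule Suc.IH)
    then show ?case
      using Suc.prems Wh.prems(2) unfolding XS by (auto split: if_splits)
  qed (simp add: X_def)
  then show ?case
    using Wh.prems(1) unfolding wp.simps X_def by blast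
qed auto

text \<open>\<open>wp\<close> grants a loop some finite number \<open>m\<close> of guard
  evaluations; any number above the initial value of the variant \<open>f\<close> is enough. The
  invariant is demanded at time \<open>T' + 2\<close> because jumping back takes two
  instructions.\<close>

lemma wp_while:
  assumes I: "I R M U T"
    and step: "\<And>R M U T. I R M U T \<Longrightarrow> ok R M e \<and>
      (if ev R M e = 0 then Q R M U (T + (sz e + 1))
       else wp c (\<lambda>R' M' U' T'. I R' M' U' (T' + 2) \<and> (f R' M' :: nat) < f R M) R M U (T + (sz e + 1)))"
  shows "wp (Wh e c) Q R M U T"
proof -
  have "\<exists>m. rec_nat (\<lambda>_ _ _ _. False)
     (\<lambda>_ X R M U T. ok R M e \<and> (if ev R M e = 0 then Q R M U (T + (sz e + 1))
        else wp c (\<lambda>R M U T. X R M U (T + 2)) R M U (T + (sz e + 1)))) m R M U T"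
    if "I R M U T" "f R M < k" for R M U T and k
  proof -
    define X where "X = rec_nat (\<lambda>_ _ _ _. False)
     (\<lambda>_ X R M U T. ok R M e \<and> (if ev R M e = 0 then Q R M U (T + (sz e + 1))
        else wp c (\<lambda>R M U T. X R M U (T + 2)) R M U (T + (sz e + 1))))"
    have "X k R M U T"
      using that
    proof (induction k arbitrary: R M U T)
      case (Suc k)
      have "wp c (\<lambda>R M U T. X k R M U (T + 2)) R M U (T + (sz e + 1))" if "ev R M e \<noteq> 0"
      proof (rule wp_mono)
        show "wp c (\<lambda>R' M' U' T'. I R' M' U' (T' + 2) \<and> f R' M' < f R M) R M U (T + (sz e + 1))"
          using step[OF Suc.prems(1)] that by auto
      qed (use Suc in auto)
      then show ?case
        using step[OF Suc.prems(1)] unfolding X_def nat.rec by (auto split: if_splits)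
    qed simp
    then have "\<exists>m. X m R M U T"
      by blast
    then show ?thesis
      by (simp only: X_def)
  qed
  from this[OF I] show ?thesis
    unfolding wp.simps by blast
qed

section \<open>Simulation of the structured language by the machine\<close>

definition reach :: "program \<Rightarrow> config \<Rightarrow> nat \<Rightarrow> config \<Rightarrow> bool" where
  "reach prog s t s' \<longleftrightarrow> (step w prog inp ^^ t) s = s' \<and>
     (\<forall>i<t. \<not> halted prog ((step w prog inp ^^ i) s))"

lemma reach_0: "reach prog s 0 s"
  by (simp add: reach_def)

lemma reach_trans:
  assumes "reach prog s t s'" "reach prog s' t' s''"
  shows "reach prog s (t + t') s''"
proof -
  have *: "(step w prog inp ^^ (t + k)) s = (step w prog inp ^^ k) s'" for k
    using assms(1) by (subst add.commute) (simp add: funpow_add reach_def)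
  have "\<not> halted prog ((step w prog inp ^^ i) s)" if "i < t + t'" for i
  proof (cases "i < t")
    case False
    then show ?thesis
      using *[of "i - t"] assms(2) that by (simp add: reach_def)
  qed (use assms(1) in \<open>simp add: reach_def\<close>)
  then show ?thesis
    using *[of t'] assms(2) by (simp add: reach_def)
qed

lemma reach_instr:
  "reach prog (exec_instr w inp ins s) t s' \<Longrightarrow> pc s < length prog \<Longrightarrow> prog ! pc s = ins \<Longrightarrow>
   reach prog s (Suc t) s'"
  using reach_trans[of prog s 1 "exec_instr w inp ins s" t s']
  by (auto simp: reach_def step_def halted_def)

text \<open>Odd registers are left free, as they hold only intermediate values. The ghost component
  is merely bounded; this bound becomes the space bound of the whole program.\<close>

definition sim :: "(nat \<Rightarrow> nat) \<Rightarrow> (nat \<Rightarrow> nat \<Rightarrow> nat) \<Rightarrow> nat list \<Rightarrow> config \<Rightarrow> bool" where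
  "sim R M U s \<longleftrightarrow> (\<forall>x. reg s (2 * x) = R x) \<and> (\<forall>a<16. \<forall>i. mem s (16 * i + a) = M a i) \<and>
     out s = U \<and> used s \<le> 16 * L"

lemma addr_less: "i < L \<Longrightarrow> a < 16 \<Longrightarrow> 16 * i + a < 16 * L"
  by linarith

lemma suc4: "x + Suc (Suc (Suc (Suc 0))) = x + 4"
  and suc5: "x + Suc (Suc (Suc (Suc (Suc 0)))) = x + 5"
  by simp_all

lemma addr_inj:
  assumes "a < 16" "b < 16"
  shows "16 * i + a = 16 * j + b \<longleftrightarrow> i = j \<and> a = (b :: nat)"
proof -
  have "(16 * i + a) div 16 = i" "(16 * j + b) div 16 = j"
    using assms by simp_all
  then show ?thesis
    by (metis add_left_cancel)
qed

text \<open>Preservation of the temporaries below \<open>d\<close> is what keeps the first operand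
  of a binary operation, and the address of a store, alive while the next expression is
  evaluated.\<close>

lemma cx_correct:
  assumes "code_at prog p (cx d e)" "ok R M e" "pc s = p" "sim R M U s"
  shows "\<exists>s'. reach prog s (sz e) s' \<and> sim R M U s' \<and> pc s' = p + sz e \<and>
    reg s' (tmp d) = ev R M e \<and> (\<forall>y<d. reg s' (tmp y) = reg s (tmp y))"
  using assms
proof (induction e arbitrary: d p s)
  case (N c)
  show ?case
    by (rule exI, intro conjI, simp only: sz.simps One_nat_def, rule reach_instr[OF reach_0])
      (use N in \<open>auto simp: sim_def \<close>)
next
  case (V x)
  show ?case
    by (rule exI, intro conjI, simp only: sz.simps One_nat_def, rule reach_instr[OF reach_0])
      (use V in \<open>auto simp: sim_def \<close>)
next
  case (In e)
  from In.IH[of p d s] In.prems obtain s' where s': "reach prog s (sz e) s'" "sim R M U s'"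
    "pc s' = p + sz e" "reg s' (tmp d) = ev R M e" "\<forall>y<d. reg s' (tmp y) = reg s (tmp y)"
    by auto
  let ?s = "exec_instr w inp (Input (tmp d) (tmp d)) s'"
  have "reach prog s' 1 ?s"
    unfolding One_nat_def by (rule reach_instr[OF reach_0]) (use In.prems s' in auto)
  then have "reach prog s (sz e + 1) ?s"
    using s'(1) reach_trans by blast
  then show ?case
    using s' by (intro exI[of _ ?s]) (auto simp: sim_def)
next
  case (Ld a e)
  from Ld.IH[of p d s] Ld.prems obtain s' where s': "reach prog s (sz e) s'" "sim R M U s'"
    "pc s' = p + sz e" "reg s' (tmp d) = ev R M e" "\<forall>y<d. reg s' (tmp y) = reg s (tmp y)"
    by auto
  let ?x = "ev R M e"
  let ?s = "s'\<lparr>pc := p + sz e + 5, reg := (reg s')(tmp (Suc d) := a, tmp d := M a ?x),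
    used := max (used s') (Suc (16 * ?x + a))\<rparr>"
  have b: "16 * ?x + a < 2 ^ w" "a < 2 ^ w" "?x * 16 < 2 ^ w"
    using Ld.prems(2) L16 w16 by auto
  have m: "mem s' (16 * ?x + a) = M a ?x"
    using s'(2) Ld.prems(2) by (simp add: sim_def)
  have "reach prog s' (Suc (Suc (Suc (Suc (Suc 0))))) ?s"
    apply (rule reach_instr[where ins="Const (tmp (Suc d)) 16"])
      apply (rule reach_instr[where ins="Op Mul (tmp d) (tmp d) (tmp (Suc d))"])
        apply (rule reach_instr[where ins="Const (tmp (Suc d)) a"])
          apply (rule reach_instr[where ins="Op Add (tmp d) (tmp d) (tmp (Suc d))"])
            apply (rule reach_instr[where ins="Load (tmp d) (tmp d)"])
    using Ld.prems(1) s' b m w16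
              apply (simp_all add: reach_def mult.commute[of _ 16] add.commute[of _ 4] add.commute[of _ 5] fun_upd_twist)

    done
  then have "reach prog s (sz e + 5) ?s"
    using reach_trans[OF s'(1), of "Suc (Suc (Suc (Suc (Suc 0))))" ?s] by (simp only: suc5)
  then show ?case
    using s' Ld.prems(2) addr_less[of ?x a]
    by (intro exI[of _ ?s]) (auto simp: sim_def)
next
  case (Bop f a b)
  from Bop.IH(1)[of p d s] Bop.prems obtain s1 where s1: "reach prog s (sz a) s1" "sim R M U s1"
    "pc s1 = p + sz a" "reg s1 (tmp d) = ev R M a" "\<forall>y<d. reg s1 (tmp y) = reg s (tmp y)"
    by auto
  from Bop.IH(2)[of "p + sz a" "Suc d" s1] Bop.prems s1 obtain s2 where s2: "reach prog s1 (sz b) s2" "sim R M U s2"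
    "pc s2 = p + sz a + sz b" "reg s2 (tmp (Suc d)) = ev R M b"
    "\<forall>y<Suc d. reg s2 (tmp y) = reg s1 (tmp y)"
    by auto
  let ?s = "exec_instr w inp (Op f (tmp d) (tmp d) (tmp (Suc d))) s2"
  have "reach prog s2 (Suc 0) ?s"
    by (rule reach_instr[OF reach_0]) (use Bop.prems s2 in \<open>auto simp: add.assoc\<close>)
  then have "reach prog s (sz a + sz b + 1) ?s"
    using s1(1) s2(1) reach_trans by (metis One_nat_def)
  then show ?case
    using s1 s2 Bop.prems(2) eval_op_exact
    by (intro exI[of _ ?s]) (auto simp: sim_def)
qed

lemma cc_correct:
  assumes "code_at prog p (cc p c)" "wp c Q R M U T" "pc s = p" "sim R M U s"
  shows "\<exists>s' t R' M' U'. reach prog s t s' \<and> sim R' M' U' s' \<and> pc s' = p + csz c \<and>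
    Q R' M' U' (T + t)"
  using assms
proof (induction c arbitrary: p s Q R M U T)
  case (Set x e)
  from cx_correct[of prog p 0 e R M s U] Set.prems obtain s1 where s1: "reach prog s (sz e) s1"
    "sim R M U s1" "pc s1 = p + sz e" "reg s1 (tmp 0) = ev R M e"
    by auto
  let ?s = "exec_instr w inp (Op Or (2*x) (tmp 0) (tmp 0)) s1"
  have "reach prog s1 (Suc 0) ?s"
    by (rule reach_instr[OF reach_0]) (use Set.prems s1 in auto)
  then have "reach prog s (sz e + 1) ?s"
    using s1(1) reach_trans by (metis One_nat_def)
  moreover have "sim (R(x := ev R M e)) M U ?s" "pc ?s = p + csz (Set x e)"
    using s1 by (auto simp: sim_def)
  moreover have "Q (R(x := ev R M e)) M U (T + (sz e + 1))"
    using Set.prems(2) by simp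
  ultimately show ?case
    by blast
next
  case (St a i v)
  from cx_correct[of prog p 0 i R M s U] St.prems obtain s1 where s1: "reach prog s (sz i) s1"
    "sim R M U s1" "pc s1 = p + sz i" "reg s1 (tmp 0) = ev R M i"
    by auto
  let ?x = "ev R M i"
  let ?s1 = "s1\<lparr>pc := p + sz i + 4, reg := (reg s1)(tmp 1 := a, tmp 0 := 16 * ?x + a)\<rparr>"
  have b: "16 * ?x + a < 2 ^ w" "a < 2 ^ w" "?x * 16 < 2 ^ w"
    using St.prems(2) L16 w16 by auto
  have "reach prog s1 (Suc (Suc (Suc (Suc 0)))) ?s1"
    apply (rule reach_instr[where ins="Const (tmp 1) 16"])
      apply (rule reach_instr[where ins="Op Mul (tmp 0) (tmp 0) (tmp 1)"])
        apply (rule reach_instr[where ins="Const (tmp 1) a"])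
          apply (rule reach_instr[where ins="Op Add (tmp 0) (tmp 0) (tmp 1)"])
    using St.prems(1) s1 b w16
            apply (simp_all add: reach_def mult.commute[of _ 16] add.commute[of _ 4] add.commute[of _ 5] fun_upd_twist)

    done
  then have r1: "reach prog s (sz i + 4) ?s1"
    using reach_trans[OF s1(1), of "Suc (Suc (Suc (Suc 0)))" ?s1] by (simp only: suc4)
  have "sim R M U ?s1"
    using s1(2) by (auto simp: sim_def)
  moreover have s4: "Suc (Suc (Suc (Suc x))) = x + 4" for x
    by simp
  have c: "code_at prog (p + sz i + 4) (cx 1 v)" "p + sz i + 4 + sz v < length prog"
    "prog ! (p + sz i + 4 + sz v) = Store (tmp 0) (tmp 1)"
    using St.prems(1) by (simp_all add: s4 add_ac)
  ultimately obtain s2 where s2: "reach prog ?s1 (sz v) s2" "sim R M U s2"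
    "pc s2 = p + sz i + 4 + sz v" "reg s2 (tmp 1) = ev R M v" "reg s2 (tmp 0) = 16 * ?x + a"
    using cx_correct[of prog "p + sz i + 4" 1 v R M ?s1 U] St.prems(2)
    by fastforce
  let ?s = "exec_instr w inp (Store (tmp 0) (tmp 1)) s2"
  have r2: "reach prog s2 (Suc 0) ?s"
    by (rule reach_instr[OF reach_0])
      (use c s2 in simp_all)
  have "reach prog s (sz i + 4 + sz v + 1) ?s"
    using reach_trans[OF reach_trans[OF r1 s2(1)] r2] by (simp only: One_nat_def)
  moreover have "sz i + 4 + sz v + 1 = sz i + sz v + 5"
    by simp
  ultimately have r3: "reach prog s (sz i + sz v + 5) ?s"
    by (simp only:)
  have "sim R (M(a := (M a)(?x := ev R M v))) U ?s"
    using s2 St.prems(2) addr_less[of ?x a] by (auto simp: sim_def addr_inj)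
  moreover have "Q R (M(a := (M a)(?x := ev R M v))) U (T + (sz i + sz v + 5))"
    "pc ?s = p + csz (St a i v)"
    using St.prems(2) s2(3) by simp_all
  ultimately show ?case
    using r3 by blast
next
  case (Out e)
  from cx_correct[of prog p 0 e R M s U] Out.prems obtain s1 where s1: "reach prog s (sz e) s1"
    "sim R M U s1" "pc s1 = p + sz e" "reg s1 (tmp 0) = ev R M e"
    by auto
  let ?s = "exec_instr w inp (Output (tmp 0)) s1"
  have "reach prog s1 (Suc 0) ?s"
    by (rule reach_instr[OF reach_0]) (use Out.prems s1 in auto)
  then have "reach prog s (sz e + 1) ?s"
    using s1(1) reach_trans by (metis One_nat_def)
  then show ?case
    using Out.prems(2) s1 by (intro exI[of _ ?s] exI[of _ "sz e + 1"]
        exI[of _ R] exI[of _ M] exI[of _ "U @ [ev R M e]"]) (auto simp: sim_def)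
next
  case (Seq c1 c2)
  from Seq.IH(1)[of p "wp c2 Q" R M U T s] Seq.prems obtain s1 t1 R1 M1 U1 where 1:
    "reach prog s t1 s1" "sim R1 M1 U1 s1" "pc s1 = p + csz c1" "wp c2 Q R1 M1 U1 (T + t1)"
    by auto
  from Seq.IH(2)[of "p + csz c1" Q R1 M1 U1 "T + t1" s1] 1 Seq.prems obtain s2 t2 R2 M2 U2 where 2:
    "reach prog s1 t2 s2" "sim R2 M2 U2 s2" "pc s2 = p + csz c1 + csz c2" "Q R2 M2 U2 (T + t1 + t2)"
    by auto
  show ?case
    using reach_trans[OF 1(1) 2(1)] 2(2-4) unfolding csz.simps add.assoc by blast
next
  case (If e c1 c2)
  have code: "code_at prog p (cx 0 e)" "p + sz e < length prog"
    "prog ! (p + sz e) = JumpZero (tmp 0) (p + sz e + csz c1 + 3)"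
    "code_at prog (p + sz e + 1) (cc (p + sz e + 1) c1)"
    "Suc (p + sz e + 1 + csz c1) < length prog" "prog ! (p + sz e + 1 + csz c1) = Const (tmp 0) 0"
    "prog ! Suc (p + sz e + 1 + csz c1) = JumpZero (tmp 0) (p + sz e + csz c1 + csz c2 + 3)"
    "code_at prog (p + sz e + csz c1 + 3) (cc (p + sz e + csz c1 + 3) c2)"
    using If.prems(1) by (simp_all add: numeral_3_eq_3)
  obtain s1 where s1: "reach prog s (sz e) s1"
    "sim R M U s1" "pc s1 = p + sz e" "reg s1 (tmp 0) = ev R M e"
    using cx_correct[OF code(1) _ If.prems(3,4)] If.prems(2) by auto
  let ?s1 = "exec_instr w inp (JumpZero (tmp 0) (p + sz e + csz c1 + 3)) s1"
  have "reach prog s1 1 ?s1"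
    unfolding One_nat_def by (rule reach_instr[OF reach_0]) (use code s1 in simp_all)
  then have r1: "reach prog s (sz e + 1) ?s1"
    by (rule reach_trans[OF s1(1)])
  have sim1: "sim R M U ?s1"
    using s1 by (simp add: sim_def)
  show ?case
  proof (cases "ev R M e = 0")
    case True
    then have pc1: "pc ?s1 = p + sz e + csz c1 + 3" and w2: "wp c2 Q R M U (T + (sz e + 1))"
      using s1 If.prems(2) by simp_all
    obtain s2 t2 R2 M2 U2 where 2: "reach prog ?s1 t2 s2" "sim R2 M2 U2 s2"
      "pc s2 = p + sz e + csz c1 + 3 + csz c2" "Q R2 M2 U2 (T + (sz e + 1) + t2)"
      using If.IH(2)[OF code(8) w2 pc1 sim1] by blast
    have "pc s2 = p + csz (If e c1 c2)" "Q R2 M2 U2 (T + (sz e + 1 + t2))"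
      using 2(3,4) by (simp_all add: add_ac)
    then show ?thesis
      using reach_trans[OF r1 2(1)] 2(2) by blast
  next
    case False
    then have pc1: "pc ?s1 = p + sz e + 1"
      and w2: "wp c1 (\<lambda>R M U T. Q R M U (T + 2)) R M U (T + (sz e + 1))"
      using s1 If.prems(2) by simp_all
    obtain s2 t2 R2 M2 U2 where 2: "reach prog ?s1 t2 s2" "sim R2 M2 U2 s2"
      "pc s2 = p + sz e + 1 + csz c1" "Q R2 M2 U2 (T + (sz e + 1) + t2 + 2)"
      using If.IH(1)[OF code(4) w2 pc1 sim1] by blast
    let ?s3 = "s2\<lparr>pc := p + sz e + csz c1 + csz c2 + 3, reg := (reg s2)(tmp 0 := 0)\<rparr>"
    have "reach prog s2 (Suc (Suc 0)) ?s3"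
      apply (rule reach_instr[where ins="Const (tmp 0) 0"])
        apply (rule reach_instr[where ins="JumpZero (tmp 0) (p + sz e + csz c1 + csz c2 + 3)"])
      using code 2 by (simp_all add: reach_def)
    from reach_trans[OF reach_trans[OF r1 2(1)] this]
    have "reach prog s (sz e + 1 + t2 + 2) ?s3"
      by (simp only: numeral_2_eq_2)
    moreover have "sim R2 M2 U2 ?s3"
      using 2(2) by (simp add: sim_def)
    moreover have "pc ?s3 = p + csz (If e c1 c2)" "Q R2 M2 U2 (T + (sz e + 1 + t2 + 2))"
      using 2(4) by (simp_all add: add_ac)
    ultimately show ?thesis
      by blast
  qed
next
  case (Wh e c)
  have code: "code_at prog p (cx 0 e)" "p + sz e < length prog"
    "prog ! (p + sz e) = JumpZero (tmp 0) (p + sz e + csz c + 3)"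
    "code_at prog (p + sz e + 1) (cc (p + sz e + 1) c)"
    "Suc (p + sz e + 1 + csz c) < length prog" "prog ! (p + sz e + 1 + csz c) = Const (tmp 0) 0"
    "prog ! Suc (p + sz e + 1 + csz c) = JumpZero (tmp 0) p"
    using Wh.prems(1) by simp_all
  \<comment> \<open>The code of a loop re-enters itself, so the structural induction is not enough;
    an inner induction runs over the number of guard evaluations that \<open>wp\<close>
    grants.\<close>
  define X where "X = rec_nat (\<lambda>_ _ _ _. False)
     (\<lambda>_ X R M U T. ok R M e \<and> (if ev R M e = 0 then Q R M U (T + (sz e + 1))
        else wp c (\<lambda>R M U T. X R M U (T + 2)) R M U (T + (sz e + 1))))"
  have X0: "X 0 = (\<lambda>_ _ _ _. False)"
    by (simp only: X_def nat.rec)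
  have XS: "X (Suc m) = (\<lambda>R M U T. ok R M e \<and> (if ev R M e = 0 then Q R M U (T + (sz e + 1))
        else wp c (\<lambda>R M U T. X m R M U (T + 2)) R M U (T + (sz e + 1))))" for m
    by (simp only: X_def nat.rec)
  obtain m where "X m R M U T"
    using Wh.prems(2) unfolding wp.simps X_def by blast
  then show ?case
    using Wh.prems(3,4)
  proof (induction m arbitrary: R M U T s)
    case 0
    then show ?case
      by (simp only: X0)
  next
    case (Suc m)
    have X: "ok R M e" "ev R M e = 0 \<Longrightarrow> Q R M U (T + (sz e + 1))"
      "ev R M e \<noteq> 0 \<Longrightarrow> wp c (\<lambda>R M U T. X m R M U (T + 2)) R M U (T + (sz e + 1))"
      using Suc.prems(1) unfolding XS by simp_all
    obtain s1 where s1: "reach prog s (sz e) s1"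
      "sim R M U s1" "pc s1 = p + sz e" "reg s1 (tmp 0) = ev R M e"
      using cx_correct[OF code(1) X(1) Suc.prems(2,3)] by auto
    let ?s1 = "exec_instr w inp (JumpZero (tmp 0) (p + sz e + csz c + 3)) s1"
    have "reach prog s1 1 ?s1"
      unfolding One_nat_def by (rule reach_instr[OF reach_0]) (use code s1 in simp_all)
    then have r1: "reach prog s (sz e + 1) ?s1"
      by (rule reach_trans[OF s1(1)])
    have sim1: "sim R M U ?s1"
      using s1 by (simp add: sim_def)
    show ?case
    proof (cases "ev R M e = 0")
      case True
      then have "pc ?s1 = p + csz (Wh e c)"
        using s1 by simp
      then show ?thesis
        using r1 sim1 X(2)[OF True] by blast
    next
      case False
      then have pc1: "pc ?s1 = p + sz e + 1"
        using s1 by simp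
      obtain s2 t2 R2 M2 U2 where 2: "reach prog ?s1 t2 s2" "sim R2 M2 U2 s2"
        "pc s2 = p + sz e + 1 + csz c" "X m R2 M2 U2 (T + (sz e + 1) + t2 + 2)"
        using Wh.IH[OF code(4) X(3)[OF False] pc1 sim1] by blast
      let ?s3 = "s2\<lparr>pc := p, reg := (reg s2)(tmp 0 := 0)\<rparr>"
      have "reach prog s2 (Suc (Suc 0)) ?s3"
        apply (rule reach_instr[where ins="Const (tmp 0) 0"])
          apply (rule reach_instr[where ins="JumpZero (tmp 0) p"])
        using code 2 by (simp_all add: reach_def)
      from reach_trans[OF reach_trans[OF r1 2(1)] this]
      have r3: "reach prog s (sz e + 1 + t2 + 2) ?s3"
        by (simp only: numeral_2_eq_2)
      have sim3: "sim R2 M2 U2 ?s3" and pc3: "pc ?s3 = p"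
        using 2(2) by (simp_all add: sim_def)
      obtain s4 t4 R4 M4 U4 where 4: "reach prog ?s3 t4 s4"
        "sim R4 M4 U4 s4" "pc s4 = p + csz (Wh e c)" "Q R4 M4 U4 (T + (sz e + 1) + t2 + 2 + t4)"
        using Suc.IH[OF 2(4) pc3 sim3] by blast
      have "Q R4 M4 U4 (T + (sz e + 1 + t2 + 2 + t4))"
        using 4(4) by (simp add: add_ac)
      then show ?thesis
        using reach_trans[OF r3 4(1)] 4(2,3) by blast
    qed
  qed
qed

text \<open>The compiled code falls off its own end exactly when the source program stops, and this
  is the machine's notion of halting.\<close>

theorem wp_runs_to:
  assumes "wp c (\<lambda>R M U T. Q U \<and> T \<le> tb) (\<lambda>_. 0) (\<lambda>_ _. 0) [] 0"
  shows "\<exists>res t m. Q res \<and> runs_to w (cc 0 c) inp res t m \<and> t \<le> tb \<and> m \<le> 16 * L"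
proof -
  have "code_at (cc 0 c) 0 (cc 0 c)"
    by (simp add: code_at_def)
  moreover have "pc init_config = 0" "sim (\<lambda>_. 0) (\<lambda>_ _. 0) [] init_config"
    by (simp_all add: sim_def init_config_def)
  ultimately obtain s t R M U where 1: "reach (cc 0 c) init_config t s" "sim R M U s"
    "pc s = 0 + csz c" "Q U \<and> 0 + t \<le> tb"
    using cc_correct[OF _ assms] by blast
  then have s: "reach (cc 0 c) init_config t s" "Q (out s)" "t \<le> tb"
    "used s \<le> 16 * L" "pc s = csz c"
    by (simp_all add: sim_def)
  have "runs_to w (cc 0 c) inp (out s) t (used s)"
    using s by (auto simp: runs_to_def reach_def halted_def Let_def)
  then show ?thesis
    using s by blast
qed

end

section \<open>Windows and common subsequences\<close>

lemma subseq_rev_iff: "subseq (rev xs) (rev ys) \<longleftrightarrow> subseq xs ys"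
proof -
  have "subseq xs ys \<Longrightarrow> subseq (rev xs) (rev ys)" for xs ys :: "'a list"
    by (induction rule: list_emb.induct) (auto intro: list_emb_prefix)
  from this[of xs ys] this[of "rev xs" "rev ys"] show ?thesis
    by auto
qed

lemma subseq_snoc:
  "subseq (xs @ [x]) (ys @ [y]) \<longleftrightarrow> (if x = y then subseq xs ys else subseq (xs @ [x]) ys)"
  using subseq_rev_iff[of "xs @ [x]" "ys @ [y]"] subseq_rev_iff[of xs ys]
    subseq_rev_iff[of "xs @ [x]" ys] by (cases "x = y") simp_all

lemma subseq_take_split:
  assumes "subseq (X @ Y) (take i A)" "i \<le> length A"
  obtains i0 where "i0 \<le> i" "subseq X (take i0 A)" "subseq Y (take (i - i0) (drop i0 A))"
proof -
  obtain us vs where uv: "take i A = us @ vs" "subseq X us" "subseq Y vs"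
    using assms(1) list_emb_appendD by meson
  have l: "length us + length vs = i"
    using arg_cong[OF uv(1), of length] assms(2) by simp
  have "us = take (length us) (take i A)"
    by (simp add: uv(1))
  then have "us = take (length us) A"
    using l by (simp add: min_def)
  moreover have "vs = drop (length us) (take i A)"
    by (simp add: uv(1))
  then have "vs = take (i - length us) (drop (length us) A)"
    by (simp add: drop_take)
  ultimately show ?thesis
    using that[of "length us"] uv l by simp
qed

lemma take_plus_split: "i0 \<le> i \<Longrightarrow> take i A = take i0 A @ take (i - i0) (drop i0 A)"
  by (metis le_add_diff_inverse take_add)

text \<open>Singling out the position \<open>j'\<close> that receives the last character yields the
  inner quantifier of the recurrence \<open>c_rec\<close> below.\<close>

lemma subseq_snoc_take:
  assumes "j \<le> length B"
  shows "subseq (X @ [a]) (take j B) \<longleftrightarrow> (\<exists>j'<j. B ! j' = a \<and> subseq X (take j' B))"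
  using assms
proof (induction j)
  case (Suc j)
  then have "take (Suc j) B = take j B @ [B ! j]"
    by (simp add: take_Suc_conv_app_nth)
  moreover have "subseq X (take j' B) \<Longrightarrow> j' < j \<Longrightarrow> subseq X (take j B)" for j'
    using take_plus_split[of j' j B] by (simp add: list_emb_prefix)
  ultimately show ?case
    using Suc by (auto simp: subseq_snoc less_Suc_eq)
qed simp

text \<open>The number of characters of \<open>P\<close> matched greedily in the \<open>d\<close> characters of \<open>A\<close> from position \<open>i\<close>
  on.\<close>

primrec gr :: "'a list \<Rightarrow> 'a list \<Rightarrow> nat \<Rightarrow> nat \<Rightarrow> nat" where
  "gr P A i 0 = 0"
| "gr P A i (Suc d) =
    (if gr P A i d < length P \<and> P ! gr P A i d = A ! (i + d) then Suc (gr P A i d) else gr P A i d)"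

lemma gr_le_length: "gr P A i d \<le> length P"
  by (induction d) auto

text \<open>Greedy matching is optimal for all prefixes of \<open>P\<close> simultaneously. The
  number \<open>k\<close> has to vary in the induction, since a match of the newest character
  reduces the claim for \<open>k\<close> to that for \<open>k - 1\<close>.\<close>

lemma gr_correct:
  assumes "i + d \<le> length A" "k \<le> length P"
  shows "subseq (take k P) (take d (drop i A)) \<longleftrightarrow> k \<le> gr P A i d"
  using assms
proof (induction d arbitrary: k)
  case 0
  then show ?case
    by (cases k) auto
next
  case (Suc d)
  have t: "take (Suc d) (drop i A) = take d (drop i A) @ [A ! (i + d)]"
    using Suc.prems by (simp add: take_Suc_conv_app_nth)
  show ?case
  proof (cases k)
    case (Suc k')
    then have "take k P = take k' P @ [P ! k']"
      using Suc.prems by (simp add: take_Suc_conv_app_nth)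
    then show ?thesis
      using t Suc.IH[of k] Suc.IH[of k'] Suc Suc.prems
      by (cases "gr P A i d = k'") (auto simp: subseq_snoc)
  qed simp
qed

section \<open>Windows of the pattern and their earliest ends\<close>

definition win :: "'a list \<Rightarrow> 'a list \<Rightarrow> nat \<Rightarrow> nat \<Rightarrow> bool" where
  "win P A i j \<longleftrightarrow> i \<le> j \<and> j \<le> length A \<and> subseq P (take (j - i) (drop i A))"

lemma win_gr: "win P A i j \<longleftrightarrow> i \<le> j \<and> j \<le> length A \<and> length P \<le> gr P A i (j - i)"
  using gr_correct[of i "j - i" A "length P" P] by (auto simp: win_def)

lemma win_0: "win P A 0 (length A) \<longleftrightarrow> subseq P A"
  by (simp add: win_def)

lemma win_mono:
  assumes "win P A i j" "i' \<le> i" "j \<le> j'" "j' \<le> length A"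
  shows "win P A i' j'"
proof -
  have "i - i' \<le> j' - i'"
    using assms by (auto simp: win_def)
  then have 1: "take (j' - i') (drop i' A) = take (i - i') (drop i' A) @ take (j' - i) (drop i A)"
    using assms take_plus_split[of "i - i'" "j' - i'" "drop i' A"] by (simp add: win_def)
  have 2: "take (j' - i) (drop i A) = take (j - i) (drop i A) @ take (j' - j) (drop j A)"
    using assms take_plus_split[of "j - i" "j' - i" "drop i A"] by (simp add: win_def)
  show ?thesis
    using assms unfolding win_def 1 2 by (auto intro: list_emb_append2 list_emb_prefix)
qed

lemma win_length: "win P A i j \<Longrightarrow> i + length P \<le> j"
  unfolding win_def using list_emb_length[of "(=)" P "take (j - i) (drop i A)"] by auto

text \<open>Reversal exchanges starts and ends, so that the starts of tight windows can be computed
  by the same program as the ends.\<close>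

lemma win_rev:
  assumes "i \<le> j" "j \<le> length A"
  shows "win (rev P) (rev A) i j \<longleftrightarrow> win P A (length A - j) (length A - i)"
proof -
  have "take (j - i) (drop i (rev A)) = rev (take (j - i) (drop (length A - j) A))"
  proof -
    have "take (j - i) (drop i (rev A)) = rev (drop (length A - i - (j - i)) (take (length A - i) A))"
      by (simp add: drop_rev take_rev)
    also have "length A - i - (j - i) = length A - j"
      using assms by simp
    finally show ?thesis
      using assms by (simp add: drop_take)
  qed
  moreover have "length A - j \<le> length A - i"
    using assms by simp
  ultimately show ?thesis
    using assms by (simp add: win_def subseq_rev_iff)
qed

text \<open>The earliest end of a window from \<open>i\<close> on, where
  \<open>Suc (length A)\<close> stands for infinity and keeps \<open>LEAST\<close> well
  defined.\<close>

definition EE :: "'a list \<Rightarrow> 'a list \<Rightarrow> nat \<Rightarrow> nat" where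
  "EE P A i = (LEAST j. j = Suc (length A) \<or> win P A i j)"

lemma EE_le_Suc: "EE P A i \<le> Suc (length A)"
  unfolding EE_def by (rule Least_le) simp

lemma EE_le_iff: "j \<le> length A \<Longrightarrow> EE P A i \<le> j \<longleftrightarrow> win P A i j"
proof
  assume j: "j \<le> length A" and "EE P A i \<le> j"
  then have "win P A i (EE P A i)"
    using LeastI[of "\<lambda>j. j = Suc (length A) \<or> win P A i j" "Suc (length A)"] by (auto simp: EE_def)
  then show "win P A i j"
    using win_mono \<open>EE P A i \<le> j\<close> j by blast
qed (auto simp: EE_def intro: Least_le)

lemma EE_mono: "i \<le> i' \<Longrightarrow> EE P A i \<le> EE P A i'"
proof (cases "EE P A i' \<le> length A")
  case True
  assume "i \<le> i'"
  then show ?thesis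
    using True EE_le_iff[OF True, of P i'] EE_le_iff[OF True, of P i] win_mono by (metis order_refl)
qed (use EE_le_Suc[of P A i] in linarith)

text \<open>Infinity is mapped to infinity, so an infinite entry of \<open>f\<close> can be looked
  up in the table of earliest ends like any other.\<close>

lemma EE_Suc_length: "EE P A (Suc (length A)) = Suc (length A)"
  using EE_le_Suc[of P A "Suc (length A)"] EE_le_iff[of "length A" A P "Suc (length A)"]
  by (auto simp: win_def)

lemma EE_ge: "EE P A i \<le> length A \<Longrightarrow> i + length P \<le> EE P A i"
  using EE_le_iff[of "EE P A i" A P i] win_length by blast

text \<open>Think of one token per starting position, advancing along \<open>P\<close> while \<open>A\<close> is read. \<open>pos\<close> says that
  some token stands at \<open>k\<close> after \<open>j\<close> characters, \<open>arr\<close> that one has just arrived there (tokens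
  start at \<open>0\<close> at any time). Tokens never overtake and stay together once they have met.\<close>

definition pos :: "'a list \<Rightarrow> 'a list \<Rightarrow> nat \<Rightarrow> nat \<Rightarrow> bool" where
  "pos P A k j \<longleftrightarrow> (\<exists>i\<le>j. gr P A i (j - i) = k)"

definition arr :: "'a list \<Rightarrow> 'a list \<Rightarrow> nat \<Rightarrow> nat \<Rightarrow> bool" where
  "arr P A k j \<longleftrightarrow> k = 0 \<or> (0 < j \<and> pos P A (k - 1) (j - 1) \<and> k \<le> length P \<and> P ! (k - 1) = A ! (j - 1))"

text \<open>The state after \<open>j\<close> characters depends only on the previous state at the
  same and at the preceding position of \<open>P\<close>. This locality is what permits many
  positions to be updated by a few word operations.\<close>

lemma pos_rec:
  "pos P A k j \<longleftrightarrow> arr P A k j \<or>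
    (0 < j \<and> pos P A k (j - 1) \<and> \<not> (k < length P \<and> P ! k = A ! (j - 1)))" (is "?l \<longleftrightarrow> ?r")
proof
  assume ?l
  then obtain i where i: "i \<le> j" "gr P A i (j - i) = k"
    by (auto simp: pos_def)
  show ?r
  proof (cases "i = j")
    case False
    then obtain d where d: "j = Suc (i + d)"
      using i(1) by (metis less_imp_Suc_add le_neq_implies_less)
    show ?thesis
      using i(2) unfolding arr_def pos_def d
      by (auto simp: Suc_diff_le split: if_splits intro: exI[of _ i])
  qed (use i in \<open>simp add: arr_def\<close>)
next
  assume ?r
  then consider "k = 0" | "0 < k" "0 < j" "pos P A (k - 1) (j - 1)" "k \<le> length P" "P ! (k - 1) = A ! (j - 1)"
    | "0 < j" "pos P A k (j - 1)" "\<not> (k < length P \<and> P ! k = A ! (j - 1))"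
    by (auto simp: arr_def)
  then show ?l
  proof cases
    case 1
    then show ?thesis
      by (auto simp: pos_def intro: exI[of _ j])
  next
    case 2
    then obtain i where i: "i \<le> j - 1" "gr P A i (j - 1 - i) = k - 1"
      by (auto simp: pos_def)
    have "j - i = Suc (j - 1 - i)" "i + (j - 1 - i) = j - 1"
      using i 2 by auto
    then have "gr P A i (j - i) = k"
      using i 2 by simp
    then show ?thesis
      using i by (auto simp: pos_def intro: exI[of _ i])
  next
    case 3
    then obtain i where i: "i \<le> j - 1" "gr P A i (j - 1 - i) = k"
      by (auto simp: pos_def)
    have "j - i = Suc (j - 1 - i)" "i + (j - 1 - i) = j - 1"
      using i 3 by auto
    then have "gr P A i (j - i) = k"
      using i 3 by auto
    then show ?thesis
      using i by (auto simp: pos_def intro: exI[of _ i])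
  qed
qed

text \<open>A token that has just arrived at the end of \<open>P\<close> has a window ending at
  \<open>j\<close> but none ending at \<open>j - 1\<close>. For the empty pattern every position is
  an end.\<close>

lemma arr_EE:
  assumes "j \<le> length A"
  shows "arr P A (length P) j \<longleftrightarrow> (\<exists>i. EE P A i = j)"
proof (cases "P = []")
  case True
  have "win P A j j"
    using assms True by (simp add: win_def)
  then have "EE P A j = j"
    using EE_le_iff[OF assms, of P j] EE_ge[of P A j] assms by force
  then show ?thesis
    using True by (auto simp: arr_def)
next
  case False
  define r where "r = length P - 1"
  have r: "length P = Suc r"
    using False by (cases P) (auto simp: r_def)
  show ?thesis
  proof
    assume "arr P A (length P) j"
    then have a: "0 < j" "pos P A r (j - 1)" "P ! r = A ! (j - 1)"
      using r by (auto simp: arr_def)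
    then obtain i where i: "i \<le> j - 1" "gr P A i (j - 1 - i) = r"
      by (auto simp: pos_def)
    have j: "j - i = Suc (j - 1 - i)" "i + (j - 1 - i) = j - 1"
      using i a by auto
    then have "win P A i j"
      using i a r assms by (simp add: win_gr)
    moreover have "\<not> win P A i (j - 1)"
      using i r by (simp add: win_gr)
    ultimately have "EE P A i = j"
      using EE_le_iff[of j A P i] EE_le_iff[of "j - 1" A P i] assms a(1) by linarith
    then show "\<exists>i. EE P A i = j" ..
  next
    assume "\<exists>i. EE P A i = j"
    then obtain i where i: "EE P A i = j" ..
    then have w: "win P A i j"
      using EE_le_iff[OF assms, of P i] by simp
    then have ij: "i + Suc r \<le> j"
      using win_length[OF w] r by simp
    then have "\<not> EE P A i \<le> j - 1"
      using i by linarith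
    then have "\<not> win P A i (j - 1)"
      using EE_le_iff[of "j - 1" A P i] assms by simp
    then have 1: "gr P A i (j - 1 - i) < Suc r"
      using ij assms r by (auto simp: win_gr)
    have j: "j - i = Suc (j - 1 - i)" "i + (j - 1 - i) = j - 1"
      using ij by auto
    have "Suc r \<le> gr P A i (Suc (j - 1 - i))"
      using w j r by (simp add: win_gr)
    with 1 have "gr P A i (j - 1 - i) = r" "P ! r = A ! (j - 1)"
      using j by (auto split: if_splits simp: le_Suc_eq)
    then show "arr P A (length P) j"
      using ij r by (auto simp: arr_def pos_def intro: exI[of _ i])
  qed
qed

text \<open>Mirrored, an earliest end is a latest start: \<open>s\<close> occurs if and only if some
  end reachable from \<open>s\<close> can no longer be reached from \<open>Suc s\<close>, that is,
  if the earliest end moves between them.\<close>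

lemma rev_EE:
  assumes "s \<le> length A"
  shows "(\<exists>i. EE (rev P) (rev A) i = length A - s) \<longleftrightarrow> EE P A s < EE P A (Suc s)" (is "?l \<longleftrightarrow> ?r")
proof
  assume ?l
  then obtain i where i: "EE (rev P) (rev A) i = length A - s" ..
  then have w: "win (rev P) (rev A) i (length A - s)"
    using EE_le_iff[of "length A - s" "rev A" "rev P" i] by simp
  then have ib: "i \<le> length A - s"
    by (simp add: win_def)
  have "win P A s (length A - i)"
    using win_rev[OF ib, where A = A and P = P] w assms by simp
  then have 1: "EE P A s \<le> length A - i"
    by (simp add: EE_le_iff)
  have "\<not> EE P A (Suc s) \<le> length A - i"
  proof
    assume "EE P A (Suc s) \<le> length A - i"
    then have w2: "win P A (Suc s) (length A - i)"
      by (simp add: EE_le_iff)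
    then have "Suc s \<le> length A - i"
      by (simp add: win_def)
    then have "win (rev P) (rev A) i (length A - Suc s)"
      using win_rev[of i "length A - Suc s" A P] w2 by simp
    then have "EE (rev P) (rev A) i \<le> length A - Suc s"
      by (simp add: EE_le_iff)
    then show False
      using i \<open>Suc s \<le> length A - i\<close> by linarith
  qed
  then show ?r
    using 1 by linarith
next
  assume r: ?r
  define e where "e = EE P A s"
  have e: "e \<le> length A"
    using r EE_le_Suc[of P A "Suc s"] by (simp add: e_def)
  have w: "win P A s e"
    using e by (simp add: e_def EE_le_iff[symmetric])
  then have se: "s \<le> e"
    by (simp add: win_def)
  have "win (rev P) (rev A) (length A - e) (length A - s)"
    using win_rev[of "length A - e" "length A - s" A P] w se e by simp
  then have 1: "EE (rev P) (rev A) (length A - e) \<le> length A - s"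
    by (simp add: EE_le_iff)
  have "\<not> EE (rev P) (rev A) (length A - e) < length A - s"
  proof
    define j where "j = EE (rev P) (rev A) (length A - e)"
    assume "EE (rev P) (rev A) (length A - e) < length A - s"
    then have j: "j < length A - s"
      by (simp add: j_def)
    then have w2: "win (rev P) (rev A) (length A - e) j"
      using EE_le_iff[of j "rev A" "rev P" "length A - e"] by (simp add: j_def)
    then have "length A - e \<le> j"
      by (simp add: win_def)
    then have "win P A (length A - j) e"
      using win_rev[of "length A - e" j A P] w2 j e by simp
    then have "win P A (Suc s) e"
      by (rule win_mono) (use j e in auto)
    then have "EE P A (Suc s) \<le> e"
      using e by (simp add: EE_le_iff)
    then show False
      using r by (simp add: e_def)
  qed
  then show ?l
    using 1 by (intro exI[of _ "length A - e"]) linarith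
qed

text \<open>The renaming need not be injective. Characters that do not occur in \<open>P\<close> may
  be identified with each other, which allows them all to get the number \<open>r\<close>.\<close>

lemma subseq_map_iff:
  assumes "\<And>p a. p \<in> set P \<Longrightarrow> a \<in> set A \<Longrightarrow> f p = f a \<longleftrightarrow> p = a"
  shows "subseq (map f P) (map f A) \<longleftrightarrow> subseq P A"
  using assms
proof (induction A arbitrary: P)
  case (Cons a A)
  note IH = Cons.IH and prems = Cons.prems
  show ?case
  proof (cases P)
    case (Cons p P')
    then show ?thesis
      using IH[of P] IH[of P'] prems by (cases "p = a") auto
  qed simp
next
  case Nil
  show ?case
    by (cases P) auto
qed

lemma EE_map:
  assumes "\<And>p a. p \<in> set P \<Longrightarrow> a \<in> set A \<Longrightarrow> f p = f a \<longleftrightarrow> p = a"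
  shows "EE (map f P) (map f A) i = EE P A i"
proof -
  have "win (map f P) (map f A) i j \<longleftrightarrow> win P A i j" for j
    using subseq_map_iff[of P "take (j - i) (drop i A)" f] assms in_set_takeD in_set_dropD
    unfolding win_def by (metis drop_map length_map take_map)
  then show ?thesis
    by (simp add: EE_def)
qed

section \<open>Recurrences for shortest prefixes\<close>

definition GG :: "nat \<Rightarrow> (nat \<Rightarrow> nat \<Rightarrow> nat \<Rightarrow> bool) \<Rightarrow> nat \<Rightarrow> nat \<Rightarrow> nat" where
  "GG n c k i = (LEAST j. j = Suc n \<or> (j \<le> n \<and> c k i j))"

text \<open>\<open>c k i j\<close> abstracts the statement that prefixes of lengths \<open>i\<close> and \<open>j\<close> have a common
  subsequence of length \<open>k\<close> of a certain kind; \<open>J\<close> is the way a chain of diagonal steps starts. It is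
  instantiated once for each of the two tables.\<close>

locale chain =
  fixes A B :: "'a list" and n k0 :: nat and c :: "nat \<Rightarrow> nat \<Rightarrow> nat \<Rightarrow> bool"
    and J :: "nat \<Rightarrow> nat \<Rightarrow> nat"
  assumes lenA: "length A = n" and lenB: "length B = n"
    and c_mono: "\<And>k i j j'. c k i j \<Longrightarrow> j \<le> j' \<Longrightarrow> c k i j'"
    and c_ge: "\<And>k i j. c k i j \<Longrightarrow> k0 \<le> k \<and> k \<le> i \<and> k \<le> j"
    and c_pred: "\<And>k i j. c k i j \<Longrightarrow> k0 < k \<Longrightarrow> c (k - 1) i j"
    and c_rec: "\<And>k i j. i \<le> n \<Longrightarrow> j \<le> n \<Longrightarrow> c k i j \<longleftrightarrow> (0 < i \<and> c k (i - 1) j) \<or>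
      (0 < i \<and> 0 < k \<and> (\<exists>j'<j. B ! j' = A ! (i - 1) \<and> c (k - 1) (i - 1) j')) \<or> J k i \<le> j"
begin

abbreviation "G \<equiv> GG n c"

lemma G_le_Suc: "G k i \<le> Suc n"
  unfolding GG_def by (rule Least_le) simp

lemma G_le_iff: "j \<le> n \<Longrightarrow> G k i \<le> j \<longleftrightarrow> c k i j"
proof
  assume j: "j \<le> n" and "G k i \<le> j"
  then have "c k i (G k i)"
    using LeastI[of "\<lambda>j. j = Suc n \<or> (j \<le> n \<and> c k i j)" "Suc n"] by (auto simp: GG_def)
  then show "c k i j"
    using c_mono \<open>G k i \<le> j\<close> by blast
qed (auto simp: GG_def intro: Least_le)

lemma G_ge: "k \<le> Suc n \<Longrightarrow> k \<le> G k i"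
  using G_le_iff[of "G k i" k i] c_ge G_le_Suc[of k i] by (metis le_SucE order_refl)

lemma G_triv: "k < k0 \<or> i < k \<Longrightarrow> G k i = Suc n"
  using G_le_iff[of "G k i" k i] c_ge G_le_Suc[of k i]
  by (metis le_SucE linorder_not_less order_refl)

text \<open>Entries of one row increase with \<open>k\<close>. The bound on the scanning time of a
  row rests on this.\<close>

lemma G_pred: "k0 < k \<Longrightarrow> G (k - 1) i \<le> G k i"
  using G_le_iff[of "G k i" k i] G_le_iff[of "G k i" "k - 1" i] c_pred G_le_Suc
  by (metis le_SucE order_refl)

text \<open>What a table stores: \<open>G\<close> with all values that cannot contribute to a solution replaced by the
  infinite value \<open>Suc n\<close>.\<close>

definition H :: "nat \<Rightarrow> nat \<Rightarrow> nat \<Rightarrow> nat \<Rightarrow> nat" where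
  "H D lm k i = (if G k i \<le> k + D \<and> G k i \<le> lm then G k i else Suc n)"

text \<open>This is the computation of one cell as the program performs it: \<open>v0\<close> is the
  value without a match in this row, \<open>u\<close> the value that a match has to beat,
  \<open>p\<close> the place where the scan starts and \<open>q\<close> the place where it stops,
  either at a match or because a match there could not beat \<open>u\<close> any more. A base value
  beyond the limits may be replaced by infinity.\<close>

lemma H_eq:
  assumes i: "i \<le> n" and lm: "lm \<le> n"
    and J': "J' = J k i \<or> (J' = Suc n \<and> (k + D < J k i \<or> lm < J k i))"
    and v0: "v0 = (if k < i then min J' (H D lm k (i - 1)) else J')"
    and p: "p = (if 0 < i \<and> k0 < k then H D lm (k - 1) (i - 1) else Suc n)"
    and u: "u = min v0 (Suc (min (k + D) lm))"
    and q: "p \<le> q" "\<And>j. p \<le> j \<Longrightarrow> j < q \<Longrightarrow> B ! j \<noteq> A ! (i - 1)"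
      "u \<le> q + 1 \<or> B ! q = A ! (i - 1)"
    and v: "v = (if q + 1 < u then q + 1 else v0)"
  shows "H D lm k i = (if v \<le> k + D \<and> v \<le> lm then v else Suc n)"
proof -
  define m where "m = min (k + D) lm"
  have m: "m \<le> k + D" "m \<le> lm" "m \<le> n"
    using lm by (auto simp: m_def)
  have v0j: "v0 \<le> j \<longleftrightarrow> J k i \<le> j \<or> (0 < i \<and> c k (i - 1) j)" if j: "j \<le> m" for j
  proof -
    have 1: "H D lm k (i - 1) \<le> j \<longleftrightarrow> c k (i - 1) j"
      using j m G_le_iff[of j k "i - 1"] by (auto simp: H_def)
    have 2: "J' \<le> j \<longleftrightarrow> J k i \<le> j"
      using J' j m by auto
    show ?thesis
    proof (cases "k < i")
      case False
      then have "\<not> (0 < i \<and> c k (i - 1) j)"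
        using c_ge[of k "i - 1" j] by auto
      then show ?thesis
        using v0 2 False by auto
    qed (use v0 1 2 in auto)
  qed
  \<comment> \<open>Strictness matters: \<open>j < m\<close> implies
    \<open>j \<le> (k - 1) + D\<close>, so the tighter limit of column \<open>k - 1\<close> is not
    visible here.\<close>
  have pj: "p \<le> j \<longleftrightarrow> 0 < i \<and> 0 < k \<and> c (k - 1) (i - 1) j" if j: "j < m" for j
  proof (cases "0 < i \<and> k0 < k")
    case True
    then have "p \<le> j \<longleftrightarrow> G (k - 1) (i - 1) \<le> j"
      using p j m by (auto simp: H_def m_def)
    then show ?thesis
      using G_le_iff[of j "k - 1" "i - 1"] True j m by auto
  next
    case False
    then have "\<not> (0 < i \<and> 0 < k \<and> c (k - 1) (i - 1) j)"
      using c_ge[of "k - 1" "i - 1" j] by auto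
    moreover have "p = Suc n"
      using p False by presburger
    ultimately show ?thesis
      using j m by auto
  qed
  have vj: "v \<le> j \<longleftrightarrow> c k i j" if j: "j \<le> m" for j
  proof -
    have ex: "(0 < i \<and> 0 < k \<and> (\<exists>j'<j. B ! j' = A ! (i - 1) \<and> c (k - 1) (i - 1) j')) \<longleftrightarrow>
      (\<exists>j'<j. p \<le> j' \<and> B ! j' = A ! (i - 1))"
      using pj j by (meson less_le_trans)
    have "c k i j \<longleftrightarrow> v0 \<le> j \<or> (\<exists>j'<j. p \<le> j' \<and> B ! j' = A ! (i - 1))"
      using c_rec[OF i, of j k] v0j[OF j] ex j m by auto
    also have "\<dots> \<longleftrightarrow> v \<le> j"
    proof
      assume "v \<le> j"
      then show "v0 \<le> j \<or> (\<exists>j'<j. p \<le> j' \<and> B ! j' = A ! (i - 1))"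
        using v q by (auto split: if_splits intro: exI[of _ q])
    next
      assume "v0 \<le> j \<or> (\<exists>j'<j. p \<le> j' \<and> B ! j' = A ! (i - 1))"
      then show "v \<le> j"
      proof
        assume v0: "v0 \<le> j"
        then show ?thesis
          using v u by (auto split: if_splits)
      next
        assume "\<exists>j'<j. p \<le> j' \<and> B ! j' = A ! (i - 1)"
        then obtain j' where j': "j' < j" "p \<le> j'" "B ! j' = A ! (i - 1)"
          by blast
        then have "q \<le> j'"
          using q(2)[of j'] by force
        then show ?thesis
          using v u j j' unfolding m_def by (auto split: if_splits)
      qed
    qed
    finally show ?thesis
      by simp
  qed
  show ?thesis
  proof (cases "v \<le> m")
    case True
    then have "c k i v"
      using vj[OF True] by simp
    then have "G k i \<le> v"
      using G_le_iff[of v] True m by simp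
    moreover from this have "c k i (G k i)"
      using G_le_iff[of "G k i" k i] True m by simp
    then have "v \<le> G k i"
      using vj[of "G k i"] True \<open>G k i \<le> v\<close> by simp
    ultimately show ?thesis
      using True m by (auto simp: H_def)
  next
    case False
    have "\<not> G k i \<le> m"
    proof
      assume g: "G k i \<le> m"
      then have "c k i (G k i)"
        using G_le_iff[of "G k i" k i] m by simp
      then show False
        using vj[of "G k i"] g False by simp
    qed
    then show ?thesis
      using False by (auto simp: H_def m_def)
  qed
qed

text \<open>A minimal value satisfies one of the three alternatives of \<open>c_rec\<close>, and
  minimality turns the inequality in it into an equation. This is the basis of tracing back.\<close>

lemma G_step:
  assumes "i \<le> n" "v = G k i" "v \<le> n"
  shows "(0 < i \<and> G k (i - 1) = v) \<or> J k i = v \<or>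
    (0 < i \<and> 0 < k \<and> G (k - 1) (i - 1) < v \<and> B ! (v - 1) = A ! (i - 1))"
proof -
  have "c k i v"
    using assms G_le_iff[of v k i] by simp
  have not: "\<not> c k i j" if "j < v" for j
    using assms G_le_iff[of j k i] that by simp
  from \<open>c k i v\<close> c_rec[of i v k] assms
  consider "0 < i" "c k (i - 1) v" | j where "0 < i" "0 < k" "j < v" "B ! j = A ! (i - 1)" "c (k - 1) (i - 1) j"
    | "J k i \<le> v"
    by blast
  then show ?thesis
  proof cases
    case 1
    then have "G k (i - 1) \<le> v"
      using G_le_iff[of v k "i - 1"] assms by simp
    moreover have "\<not> G k (i - 1) < v"
    proof
      assume g: "G k (i - 1) < v"
      then have "c k (i - 1) (G k (i - 1))"
        using G_le_iff[of "G k (i - 1)" k "i - 1"] assms by simp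
      then have "c k i (G k (i - 1))"
        using c_rec[of i "G k (i - 1)" k] assms g 1 by simp
      then show False
        using not g by blast
    qed
    ultimately show ?thesis
      using 1 by simp
  next
    case 2
    then have "c k i (Suc j)"
      using c_rec[of i "Suc j" k] assms by auto
    then have "\<not> Suc j < v"
      using not by blast
    then have "v = Suc j"
      using 2 by simp
    then show ?thesis
      using 2 G_le_iff[of j "k - 1" "i - 1"] assms by auto
  next
    case 3
    then have "c k i (J k i)"
      using c_rec[of i "J k i" k] assms by simp
    then have "\<not> J k i < v"
      using not by blast
    then show ?thesis
      using 3 by simp
  qed
qed

end

section \<open>The two instances, without and with the pattern\<close>

definition cxx :: "'a list \<Rightarrow> 'a list \<Rightarrow> nat \<Rightarrow> nat \<Rightarrow> nat \<Rightarrow> bool" where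
  "cxx A B k i j \<longleftrightarrow> (\<exists>X. length X = k \<and> subseq X (take i A) \<and> subseq X (take j B))"

definition czz :: "'a list \<Rightarrow> 'a list \<Rightarrow> 'a list \<Rightarrow> nat \<Rightarrow> nat \<Rightarrow> nat \<Rightarrow> bool" where
  "czz A B P k i j \<longleftrightarrow> (\<exists>X Y. length (X @ P @ Y) = k \<and> subseq (X @ P @ Y) (take i A) \<and>
     subseq (X @ P @ Y) (take j B))"

lemma subseq_take_mono: "subseq X (take i A) \<Longrightarrow> i \<le> j \<Longrightarrow> subseq X (take j A)"
  using take_plus_split[of i j A] by (simp add: list_emb_prefix)

lemma subseq_take_pred: "subseq X (take (i - 1) A) \<Longrightarrow> subseq X (take i A)"
  by (rule subseq_take_mono) auto

lemma subseq_take_length: "subseq X (take i A) \<Longrightarrow> length X \<le> i"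
  using list_emb_length[of "(=)" X "take i A"] by simp

lemma subseq_snoc_step:
  assumes "0 < i" "i \<le> length A" "j \<le> length B"
    "subseq (X @ [a]) (take i A)" "subseq (X @ [a]) (take j B)"
  shows "subseq (X @ [a]) (take (i - 1) A) \<or> (\<exists>j'<j. B ! j' = A ! (i - 1) \<and>
    subseq X (take (i - 1) A) \<and> subseq X (take j' B))"
proof -
  have "take i A = take (i - 1) A @ [A ! (i - 1)]"
    using assms(1,2) by (cases i) (auto simp: take_Suc_conv_app_nth)
  then show ?thesis
    using assms(3-5) by (auto simp: subseq_snoc subseq_snoc_take split: if_splits)
qed

lemma subseq_snoc_intro:
  assumes "0 < i" "i \<le> length A" "j \<le> length B" "j' < j" "B ! j' = A ! (i - 1)"
    "subseq X (take (i - 1) A)" "subseq X (take j' B)"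
  shows "subseq (X @ [A ! (i - 1)]) (take i A)" "subseq (X @ [A ! (i - 1)]) (take j B)"
  using assms by (auto simp: subseq_snoc_take intro: exI[of _ "i - 1"] exI[of _ j'])

lemma chain_cxx:
  assumes "length A = n" "length B = n"
  shows "chain A B n 0 (cxx A B) (\<lambda>k i. if k = 0 then 0 else Suc n)"
proof
  show "length A = n" "length B = n"
    by fact+
  fix k i j j'
  show "cxx A B k i j \<Longrightarrow> j \<le> j' \<Longrightarrow> cxx A B k i j'"
    unfolding cxx_def using subseq_take_mono by blast
  show "cxx A B k i j \<Longrightarrow> 0 \<le> k \<and> k \<le> i \<and> k \<le> j"
    unfolding cxx_def using subseq_take_length by blast
  show "cxx A B (k - 1) i j" if c: "cxx A B k i j" and k: "0 < k"
  proof -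
    obtain X where X: "length X = k" "subseq X (take i A)" "subseq X (take j B)"
      using c by (auto simp: cxx_def)
    then obtain x X' where "X = x # X'"
      using k by (cases X) auto
    then show ?thesis
      using X by (auto simp: cxx_def intro!: exI[of _ X'] intro: subseq_Cons')
  qed
  show "cxx A B k i j \<longleftrightarrow> (0 < i \<and> cxx A B k (i - 1) j) \<or>
      (0 < i \<and> 0 < k \<and> (\<exists>j'<j. B ! j' = A ! (i - 1) \<and> cxx A B (k - 1) (i - 1) j')) \<or>
      (if k = 0 then 0 else Suc n) \<le> j" (is "?l \<longleftrightarrow> ?r") if i: "i \<le> n" and j: "j \<le> n"
  proof
    assume ?l
    then obtain X where X: "length X = k" "subseq X (take i A)" "subseq X (take j B)"
      by (auto simp: cxx_def)
    show ?r
    proof (cases X rule: rev_cases)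
      case (snoc X' a)
      have "0 < i"
        using X(2) snoc by (cases i) auto
      then show ?thesis
        using subseq_snoc_step[of i A j B X' a] X snoc i j assms
        unfolding cxx_def by (metis One_nat_def diff_Suc_1 length_append_singleton zero_less_Suc)
    qed (use X in simp)
  next
    assume ?r
    then consider "0 < i" "cxx A B k (i - 1) j"
      | j' where "0 < i" "0 < k" "j' < j" "B ! j' = A ! (i - 1)" "cxx A B (k - 1) (i - 1) j'"
      | "k = 0"
      using j by (auto split: if_splits)
    then show ?l
    proof cases
      case 1
      then show ?thesis
        unfolding cxx_def using subseq_take_pred by blast
    next
      case 2
      then obtain X where X: "length X = k - 1" "subseq X (take (i - 1) A)" "subseq X (take j' B)"
        by (auto simp: cxx_def)
      show ?thesis
        unfolding cxx_def
        using subseq_snoc_intro[of i A j B j' X] 2 X i j assms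
        by (intro exI[of _ "X @ [A ! (i - 1)]"]) auto
    qed (simp add: cxx_def)
  qed
qed

text \<open>\<open>P\<close> is the last part of the string and its embedding in \<open>A\<close>
  ends exactly at \<open>i\<close>. Among the possible starts the latest is best, since it leaves
  the longest prefix of \<open>A\<close> to the characters before \<open>P\<close> and hence needs
  the shortest prefix of \<open>B\<close>.\<close>

definition JJ :: "'a list \<Rightarrow> 'a list \<Rightarrow> 'a list \<Rightarrow> nat \<Rightarrow> nat \<Rightarrow> nat" where
  "JJ A B P k i = (if length P \<le> k \<and> (\<exists>s. EE P A s = i)
     then EE P B (GG (length A) (cxx A B) (k - length P) (GREATEST s. EE P A s = i))
     else Suc (length A))"

text \<open>The bound on \<open>i\<close> is essential for \<open>GREATEST\<close>: a finite end
  bounds its starts, whereas infinity is attained from arbitrarily large starts.\<close>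

lemma EE_Greatest:
  assumes "EE P A s = i" "i \<le> length A"
  shows "EE P A (GREATEST s. EE P A s = i) = i" "s \<le> (GREATEST s. EE P A s = i)"
proof -
  have b: "\<forall>y. EE P A y = i \<longrightarrow> y \<le> i"
    using EE_ge[of P A] assms(2) by (metis add_leD1)
  show "EE P A (GREATEST s. EE P A s = i) = i"
    by (rule GreatestI_nat[where P = "\<lambda>s. EE P A s = i" and b = i, OF assms(1)]) (use b in simp)
  show "s \<le> (GREATEST s. EE P A s = i)"
    by (rule Greatest_le_nat[where P = "\<lambda>s. EE P A s = i" and b = i, OF assms(1)]) (use b in simp)
qed

lemma subseq_win:
  assumes "subseq X (take i0 A)" "win P A i0 i"
  shows "subseq (X @ P) (take i A)"
proof -
  have "take i A = take i0 A @ take (i - i0) (drop i0 A)"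
    using take_plus_split[of i0 i A] assms(2) by (simp add: win_def)
  moreover have "subseq P (take (i - i0) (drop i0 A))"
    using assms(2) by (simp add: win_def)
  ultimately show ?thesis
    using list_emb_append_mono[OF assms(1)] by simp
qed

lemma czzI:
  "length (X @ P @ Y) = k \<Longrightarrow> subseq (X @ P @ Y) (take i A) \<Longrightarrow> subseq (X @ P @ Y) (take j B) \<Longrightarrow>
   czz A B P k i j"
  unfolding czz_def by blast

text \<open>If something follows \<open>P\<close>, its last character is treated as for
  \<open>cxx\<close>. Otherwise \<open>P\<close> comes last, and the earliest end of its embedding
  in \<open>A\<close> is either \<open>i\<close>, which is covered by \<open>JJ\<close>, or smaller,
  and then the previous row has the same string.\<close>

lemma chain_czz:
  assumes "length A = n" "length B = n"
  shows "chain A B n (length P) (czz A B P) (JJ A B P)"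
proof -
  interpret f: chain A B n 0 "cxx A B" "\<lambda>k i. if k = 0 then 0 else Suc n"
    by (rule chain_cxx) fact+
  show ?thesis
  proof
    show "length A = n" "length B = n"
      by fact+
    fix k i j j'
    show "czz A B P k i j \<Longrightarrow> j \<le> j' \<Longrightarrow> czz A B P k i j'"
      unfolding czz_def using subseq_take_mono by blast
    show "length P \<le> k \<and> k \<le> i \<and> k \<le> j" if cz: "czz A B P k i j"
    proof -
      obtain X Y where X: "length (X @ P @ Y) = k" "subseq (X @ P @ Y) (take i A)" "subseq (X @ P @ Y) (take j B)"
        using cz unfolding czz_def by blast
      then show ?thesis
        using subseq_take_length[OF X(2)] subseq_take_length[OF X(3)] X(1) by simp
    qed
    show "czz A B P (k - 1) i j" if c: "czz A B P k i j" and k: "length P < k"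
    proof -
      obtain X Y where X: "length (X @ P @ Y) = k" "subseq (X @ P @ Y) (take i A)" "subseq (X @ P @ Y) (take j B)"
        using c unfolding czz_def by blast
      show ?thesis
      \<comment> \<open>The character to be removed must lie outside of \<open>P\<close>: the first
        one of \<open>X\<close>, or the last one of \<open>Y\<close> if \<open>X\<close> is
        empty.\<close>
      proof (cases X)
        case Nil
        then obtain Y' y where Y: "Y = Y' @ [y]"
          using X k by (cases Y rule: rev_cases) auto
        have "subseq (P @ Y') ((P @ Y') @ [y])"
          by (rule list_emb_prefix) simp
        moreover have "X @ P @ Y = (P @ Y') @ [y]"
          using Nil Y by simp
        ultimately have "subseq ([] @ P @ Y') (take i A)" "subseq ([] @ P @ Y') (take j B)"
          using X(2,3) subseq_order.trans by (metis append_Nil)+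
        moreover have "length ([] @ P @ Y') = k - 1"
          using X(1) Nil Y by auto
        ultimately show ?thesis
          by - (rule czzI)
      next
        case (Cons x X')
        then have "X @ P @ Y = x # (X' @ P @ Y)"
          by simp
        then have "subseq (X' @ P @ Y) (take i A)" "subseq (X' @ P @ Y) (take j B)"
          using X(2,3) subseq_Cons' by metis+
        moreover have "length (X' @ P @ Y) = k - 1"
          using X(1) Cons by auto
        ultimately show ?thesis
          by - (rule czzI)
      qed
    qed
    show "czz A B P k i j \<longleftrightarrow> (0 < i \<and> czz A B P k (i - 1) j) \<or>
      (0 < i \<and> 0 < k \<and> (\<exists>j'<j. B ! j' = A ! (i - 1) \<and> czz A B P (k - 1) (i - 1) j')) \<or>
      JJ A B P k i \<le> j" (is "?l \<longleftrightarrow> ?r") if i: "i \<le> n" and j: "j \<le> n"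
    proof
      assume ?l
      then obtain X Y where X: "length (X @ P @ Y) = k" "subseq (X @ P @ Y) (take i A)" "subseq (X @ P @ Y) (take j B)"
        unfolding czz_def by blast
      show ?r
      proof (cases Y rule: rev_cases)
        case (snoc Y' a)
        have "0 < i"
          using X(2) snoc by (cases i) auto
        moreover have "subseq ((X @ P @ Y') @ [a]) (take i A)" "subseq ((X @ P @ Y') @ [a]) (take j B)"
          using X snoc by simp_all
        ultimately have "subseq ((X @ P @ Y') @ [a]) (take (i - 1) A) \<or> (\<exists>j'<j. B ! j' = A ! (i - 1) \<and>
            subseq (X @ P @ Y') (take (i - 1) A) \<and> subseq (X @ P @ Y') (take j' B))"
          using subseq_snoc_step[of i A j B "X @ P @ Y'" a] i j assms by (simp only:)
        then show ?thesis
        proof (elim disjE exE conjE)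
          assume "subseq ((X @ P @ Y') @ [a]) (take (i - 1) A)"
          then have "czz A B P k (i - 1) j"
            using X snoc by (intro czzI[of X P Y]) simp_all
          then show ?thesis
            using \<open>0 < i\<close> by blast
        next
          fix j' assume "j' < j" "B ! j' = A ! (i - 1)" "subseq (X @ P @ Y') (take (i - 1) A)"
            "subseq (X @ P @ Y') (take j' B)"
          moreover from this have "czz A B P (k - 1) (i - 1) j'"
            using X(1) snoc by (intro czzI[of X P Y']) simp_all
          moreover have "0 < k"
            using X(1) snoc by auto
          ultimately show ?thesis
            using \<open>0 < i\<close> by blast
        qed
      next
        case Nil
        obtain i0 where i0: "i0 \<le> i" "subseq X (take i0 A)" "subseq P (take (i - i0) (drop i0 A))"
          using subseq_take_split[of X P i A] X(2) Nil i assms by auto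
        obtain j0 where j0: "j0 \<le> j" "subseq X (take j0 B)" "subseq P (take (j - j0) (drop j0 B))"
          using subseq_take_split[of X P j B] X(3) Nil j assms by auto
        have wA: "EE P A i0 \<le> i" and wB: "win P B j0 j"
          using i0 j0 i j assms EE_le_iff[of i A P i0] by (auto simp: win_def)
        show ?thesis
        proof (cases "EE P A i0 = i")
          case True
          define s where "s = (GREATEST s. EE P A s = i)"
          have s: "i0 \<le> s"
            using EE_Greatest[OF True] i assms by (simp add: s_def)
          have "cxx A B (k - length P) s j0"
            unfolding cxx_def using X(1) Nil i0 j0 s subseq_take_mono
            by (intro exI[of _ X]) auto
          then have "GG n (cxx A B) (k - length P) s \<le> j0"
            using f.G_le_iff[of j0] j0 j by simp
          then have "EE P B (GG n (cxx A B) (k - length P) s) \<le> EE P B j0"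
            by (rule EE_mono)
          also have "\<dots> \<le> j"
            using wB j assms by (simp add: EE_le_iff)
          finally have "JJ A B P k i \<le> j"
            using True X(1) assms by (auto simp: JJ_def s_def)
          then show ?thesis
            by blast
        next
          case False
          then have "EE P A i0 \<le> i - 1" "0 < i"
            using wA by auto
          then have "win P A i0 (i - 1)"
            using EE_le_iff[of "i - 1" A P i0] i assms by simp
          then have "subseq (X @ P) (take (i - 1) A)"
            using i0(2) subseq_win by blast
          then have "czz A B P k (i - 1) j"
            using X Nil by (intro czzI[of X P "[]"]) simp_all
          then show ?thesis
            using \<open>0 < i\<close> by blast
        qed
      qed
    next
      assume ?r
      then consider "0 < i" "czz A B P k (i - 1) j"
        | j' where "0 < i" "0 < k" "j' < j" "B ! j' = A ! (i - 1)" "czz A B P (k - 1) (i - 1) j'"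
        | "JJ A B P k i \<le> j"
        by blast
      then show ?l
      proof cases
        case 1
        then obtain X Y where "length (X @ P @ Y) = k" "subseq (X @ P @ Y) (take (i - 1) A)"
          "subseq (X @ P @ Y) (take j B)"
          unfolding czz_def by blast
        then show ?thesis
          by (rule czzI[OF _ subseq_take_pred])
      next
        case 2
        then obtain X Y where X: "length (X @ P @ Y) = k - 1" "subseq (X @ P @ Y) (take (i - 1) A)"
          "subseq (X @ P @ Y) (take j' B)"
          unfolding czz_def by blast
        have "subseq ((X @ P @ Y) @ [A ! (i - 1)]) (take i A)"
          "subseq ((X @ P @ Y) @ [A ! (i - 1)]) (take j B)"
          using subseq_snoc_intro[OF 2(1) _ _ 2(3,4) X(2,3)] i j assms by simp_all
        then have "subseq (X @ P @ (Y @ [A ! (i - 1)])) (take i A)"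
          "subseq (X @ P @ (Y @ [A ! (i - 1)])) (take j B)"
          by simp_all
        moreover have "length (X @ P @ (Y @ [A ! (i - 1)])) = k"
          using X(1) 2(2) by simp
        ultimately show ?thesis
          by - (rule czzI)
      next
        case 3
        define s where "s = (GREATEST s. EE P A s = i)"
        define g where "g = GG n (cxx A B) (k - length P) s"
        have ex: "length P \<le> k" "\<exists>s. EE P A s = i" and "EE P B g \<le> j"
          using 3 j assms by (auto simp: JJ_def s_def g_def split: if_splits)
        then have wB: "win P B g j"
          using j assms by (simp add: EE_le_iff)
        then have "g \<le> n"
          using j by (simp add: win_def)
        then have "cxx A B (k - length P) s g"
          using f.G_le_iff[of g "k - length P" s] by (simp add: g_def)
        then obtain X where X: "length X = k - length P" "subseq X (take s A)" "subseq X (take g B)"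
          by (auto simp: cxx_def)
        have "EE P A s = i"
          using EE_Greatest(1)[of P A _ i] ex i assms by (auto simp: s_def)
        then have "win P A s i"
          using EE_le_iff[of i A P s] i assms by simp
        then have "subseq (X @ P @ []) (take i A)"
          using subseq_win[OF X(2)] by simp
        moreover have "subseq (X @ P @ []) (take j B)"
          using subseq_win[OF X(3) wB] by simp
        moreover have "length (X @ P @ []) = k"
          using X(1) ex(1) by simp
        ultimately show ?thesis
          by - (rule czzI)
      qed
    qed
  qed
qed

section \<open>Preprocessing of the pattern\<close>

text \<open>Sums such as \<open>x + 1\<close> keep the form that they have in the programs, and
  loops are opened only by \<open>wp_while\<close>.\<close>

declare One_nat_def [simp del] add_2_eq_Suc [simp del] add_2_eq_Suc' [simp del]
declare (in ram) wp.simps(6) [simp del]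

lemma and_of_bool [simp]: "and (of_bool p) (of_bool q) = (of_bool (p \<and> q) :: nat)"
  by (cases p; cases q) simp_all

lemma gr_plus1: "gr P A i (d + 1) =
    (if gr P A i d < length P \<and> P ! gr P A i d = A ! (i + d) then gr P A i d + 1 else gr P A i d)"
  by (simp add: Suc_eq_plus1[symmetric])

text \<open>Registers \<open>0\<close> to \<open>3\<close> hold \<open>n\<close>, \<open>r\<close>, \<open>W\<close> and \<open>W * W\<close>; registers \<open>5\<close>, \<open>6\<close>, \<open>7\<close> the offsets of
  \<open>P\<close>, \<open>B\<close>, \<open>A\<close> in the input, \<open>8\<close> and \<open>9\<close> the last positions of \<open>A\<close> and \<open>B\<close> from which \<open>P\<close> can be matched.
  Array \<open>0\<close> holds the sorted pattern and later the solution, \<open>1\<close>, \<open>2\<close>, \<open>4\<close>, \<open>5\<close> the numberings of the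
  characters of \<open>P\<close> and of the text and of their reversals, \<open>3\<close> the bit masks of the pattern
  characters, \<open>6\<close> to \<open>9\<close> and \<open>10\<close> to \<open>13\<close> the end flags, start flags, earliest ends and latest starts
  of the windows of \<open>A\<close> and \<open>B\<close>, \<open>14\<close> and \<open>15\<close> the tables of \<open>f\<close> and \<open>F\<close>. Since the language has no
  skip, unneeded branches assign to a scratch register.\<close>

locale lcs = ram +
  fixes A B P :: "nat list" and n r :: nat
  assumes lenA: "length A = n" and lenB: "length B = n" and lenP: "length P = r" and rn: "r \<le> n"
    and inp: "inp = encode_input A B P"
    and nw: "64 * ((n + 2) * (n + 2)) < 2 ^ w"
begin

lemma nw': "64 * n + 128 < 2 ^ w"
proof -
  have "64 * n + 128 = 64 * ((n + 2) * 1)"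
    by simp
  also have "\<dots> \<le> 64 * ((n + 2) * (n + 2))"
    by (intro mult_le_mono) auto
  finally show ?thesis
    using nw by (rule le_less_trans)
qed

lemma length_inp: "length inp = 2 + 2 * n + r"
  by (simp add: inp encode_input_def lenA lenB lenP)

lemma inp_0: "inp ! 0 = n" and inp_1: "inp ! 1 = r"
  by (simp_all add: inp encode_input_def lenA lenP)

definition textat :: "nat \<Rightarrow> nat list \<Rightarrow> bool" where
  "textat b X \<longleftrightarrow> b \<le> 2 * n + 2 \<and> (\<forall>j<length X. b + j < length inp \<and> inp ! (b + j) = X ! j)"

lemma textat_A: "textat 2 A" and textat_B: "textat (2 + n) B" and textat_P: "textat (2 + 2 * n) P"
  unfolding textat_def using lenA lenB lenP
  by (auto simp: inp encode_input_def nth_Cons' nth_append)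

lemma textatD: "textat b X \<Longrightarrow> j < length X \<Longrightarrow> b + j < length inp \<and> inp ! (b + j) = X ! j"
  "textat b X \<Longrightarrow> b \<le> 2 * n + 2"
  by (auto simp: textat_def)

abbreviation "same S R' R \<equiv> (\<forall>x. x \<notin> S \<longrightarrow> R' x = (R :: nat \<Rightarrow> nat) x)"
abbreviation "same2 S M' M \<equiv> (\<forall>x. x \<notin> S \<longrightarrow> M' x = (M :: nat \<Rightarrow> nat \<Rightarrow> nat) x)"

definition greedy :: "nat \<Rightarrow> com" where
  "greedy b = (11 :=! N 0 ;; 12 :=! N 0 ;; Wh (V 12 <! V 0)
     (If (V 11 <! V 1) (If (In (V 5 +! V 11) =! In (V b +! V 12)) (11 :=! V 11 +! N 1) (13 :=! N 0)) (13 :=! N 0) ;;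
      12 :=! V 12 +! N 1))"

lemma wp_greedy:
  assumes R: "R 0 = n" "R 1 = r" "R 5 = 2 + 2 * n" "textat (R b) X" "length X = n" "b \<notin> {11, 12, 13}"
    and K: "\<And>R' T'. same {11, 12, 13} R' R \<Longrightarrow> R' 11 = gr P X 0 n \<Longrightarrow> T' \<le> T + 50 * n + 50 \<Longrightarrow> Q R' M U T'"
  shows "wp (greedy b) Q R M U T"
proof -
  define I where "I = (\<lambda>R' M' U' T'. same {11, 12, 13} R' R \<and> M' = M \<and> U' = U \<and> R' 12 \<le> n \<and>
     R' 11 = gr P X 0 (R' 12) \<and> T' \<le> T + 10 + 50 * R' 12)"
  have "wp (Wh (V 12 <! V 0)
     (If (V 11 <! V 1) (If (In (V 5 +! V 11) =! In (V b +! V 12)) (11 :=! V 11 +! N 1) (13 :=! N 0)) (13 :=! N 0) ;;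
      12 :=! V 12 +! N 1)) Q (R(11 := 0, 12 := 0)) M U T1" if "T1 \<le> T + 10" for T1
  proof (rule wp_while[where I = I and f = "\<lambda>R' M'. n - R' 12"], goal_cases)
    case 1
    then show ?case
      using that by (simp add: I_def)
  next
    case (2 R' M' U' T')
    then have s: "same {11, 12, 13} R' R" and M: "M' = M" "U' = U" and j: "R' 12 \<le> n"
      and g: "R' 11 = gr P X 0 (R' 12)" and T: "T' \<le> T + 10 + 50 * R' 12"
      unfolding I_def by blast+
    have R': "R' 0 = n" "R' 1 = r" "R' 5 = 2 + 2 * n" "R' b = R b"
      using s R by simp_all
    have gl: "gr P X 0 (R' 12) \<le> r"
      using gr_le_length lenP by metis
    have tx: "R' 12 < n \<Longrightarrow> R b + R' 12 < length inp \<and> inp ! (R b + R' 12) = X ! R' 12"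
      using textatD(1)[OF R(4)] R(5) by simp
    have pt: "R' 11 < r \<Longrightarrow> 2 + 2 * n + R' 11 < length inp \<and> inp ! (2 + 2 * n + R' 11) = P ! R' 11"
      using textatD(1)[OF textat_P] lenP by simp
    have bb: "R b \<le> 2 * n + 2"
      by (rule textatD(2)[OF R(4)])
    show ?case
    proof (cases "R' 12 < n")
      case False
      then have "R' 12 = n"
        using j by simp
      then have "Q R' M U T''" if "T'' \<le> T' + 4" for T''
        by (intro K) (use s g T that in auto)
      then show ?thesis
        using False R' M by simp
    next
      case True
      then show ?thesis
        using s M g T R' tx pt bb gl nw' rn lenP R(6) by (auto simp: I_def gr_plus1)
    qed
  qed
  then show ?thesis
    unfolding greedy_def using w16 by simp
qed


text \<open>Repeated doubling yields \<open>W = \<lfloor>log r\<rfloor>\<close>, but at least 1, so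
  that sections of the pattern are never empty.\<close>

definition wordlen :: com where
  "wordlen = (2 :=! N 1 ;; 10 :=! N 2 ;; Wh ((V 1 <! V 10 +! V 10) =! N 0)
     (10 :=! V 10 +! V 10 ;; 2 :=! V 2 +! N 1))"

lemma wp_wordlen:
  assumes R: "R 1 = r"
    and K: "\<And>R' T'. same {2, 10} R' R \<Longrightarrow> 1 \<le> R' 2 \<Longrightarrow> 2 ^ R' 2 \<le> max r 2 \<Longrightarrow> r < 2 ^ (R' 2 + 1) \<Longrightarrow>
      T' \<le> T + 50 * n + 150 \<Longrightarrow> Q R' M U T'"
  shows "wp wordlen Q R M U T"
proof -
  define I where "I = (\<lambda>R' M' U' T'. same {2, 10} R' R \<and> M' = M \<and> U' = U \<and> 1 \<le> R' 2 \<and>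
     R' 10 = 2 ^ R' 2 \<and> R' 10 \<le> max r 2 \<and> T' \<le> T + 10 + 20 * R' 2)"
  have "wp (Wh ((V 1 <! V 10 +! V 10) =! N 0) (10 :=! V 10 +! V 10 ;; 2 :=! V 2 +! N 1)) Q
      (R(2 := 1, 10 := 2)) M U T1" if "T1 \<le> T + 10" for T1
  proof (rule wp_while[where I = I and f = "\<lambda>R' M'. r - R' 2"], goal_cases)
    case 1
    then show ?case
      using that by (simp add: I_def)
  next
    case (2 R' M' U' T')
    then have s: "same {2, 10} R' R" and M: "M' = M" "U' = U" and W: "1 \<le> R' 2"
      and p: "R' 10 = 2 ^ R' 2" and pr: "R' 10 \<le> max r 2" and T: "T' \<le> T + 10 + 20 * R' 2"
      unfolding I_def by blast+
    have R': "R' 1 = r"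
      using s R by simp
    have W2: "R' 2 < R' 10"
      unfolding p by (rule less_exp)
    show ?case
    proof (cases "r < R' 10 + R' 10")
      case True
      have "R' 2 \<le> n + 2"
        using W2 pr rn by linarith
      then have "Q R' M U T''" if "T'' \<le> T' + 10" for T''
        by (intro K) (use s p pr T W W2 rn that True in \<open>auto simp: power_add\<close>)
      then show ?thesis
        using True R' M w16 pr rn nw' by simp
    next
      case False
      show ?thesis
      proof -
        have "R' 2 + 1 \<le> r"
          using False W2 by linarith
        then show ?thesis
          using False s M T R' W p pr nw' rn w16 by (auto simp: I_def power_add)
      qed
    qed
  qed
  then show ?thesis
    unfolding wordlen_def using w16 by simp
qed

end

text \<open>Together with \<open>2 ^ W \<le> r + 2\<close> this bounds \<open>W * W\<close> by a
  multiple of \<open>r div W + 1\<close>. So sorting the blocks, which takes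
  \<open>O(r * W * W)\<close> steps, stays within the time bound.\<close>

lemma wordlen_cube: "(W :: nat) ^ 3 \<le> 7 * 2 ^ W"
proof (induction W rule: less_induct)
  case (less W)
  show ?case
  proof (cases "W \<le> 6")
    case True
    then have "W \<in> {0, 1, 2, 3, 4, 5, 6}"
      by auto
    then show ?thesis
      by auto
  next
    case False
    then obtain V where V: "W = Suc V" "6 \<le> V"
      by (cases W) auto
    have "Suc V ^ 3 \<le> 2 * V ^ 3"
    proof -
      have "3 * V ^ 2 + 3 * V + 1 \<le> 3 * V ^ 2 + 4 * V"
        using V by simp
      also have "\<dots> \<le> 4 * V ^ 2"
        using V by (simp add: power2_eq_square)
      also have "\<dots> \<le> V ^ 3"
        using V by (simp add: power2_eq_square power3_eq_cube)
      finally show ?thesis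
        by (simp add: power3_eq_cube power2_eq_square algebra_simps)
    qed
    also have "\<dots> \<le> 2 * (7 * 2 ^ V)"
      using less.IH[of V] V by simp
    finally show ?thesis
      using V by simp
  qed
qed

text \<open>The characters of \<open>P\<close> have to be numbered in order to index the table of masks, but sorting
  \<open>P\<close> completely would take too long. Insertion sort of blocks of \<open>W * W\<close> characters costs
  \<open>O(r * W * W)\<close>; in a sorted block a character is found in \<open>O(W)\<close> steps by looking at every \<open>W\<close>-th
  entry first, thus in \<open>O(r div W + W)\<close> steps in all blocks.\<close>

definition bsorted :: "nat \<Rightarrow> nat \<Rightarrow> (nat \<Rightarrow> nat) \<Rightarrow> bool" where
  "bsorted Q i S \<longleftrightarrow> (\<forall>t t'. t < t' \<and> t' < i \<and> t div Q = t' div Q \<longrightarrow> S t \<le> S t')"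

text \<open>Entries of earlier blocks lie below \<open>Q * m \<le> j\<close> and do not move; the
  entries that are shifted belong to the current block and exceed \<open>x\<close>.\<close>

lemma bsorted_insert:
  assumes S: "bsorted Q i S" and i: "Q * m \<le> i" "i < Q * m + Q" and j: "Q * m \<le> j" "j \<le> i"
    and lo: "Q * m < j \<Longrightarrow> S (j - 1) \<le> x" and hi: "\<And>t. j \<le> t \<Longrightarrow> t < i \<Longrightarrow> x < S t"
    and S': "\<And>t. t \<le> i \<Longrightarrow> S' t = (if t = j then x else if j < t then S (t - 1) else S t)"
  shows "bsorted Q (Suc i) S'"
  unfolding bsorted_def
proof (intro allI impI, elim conjE)
  fix t t'
  assume t: "t < t'" "t' < Suc i" "t div Q = t' div Q"
  have Q: "0 < Q"
    using i by (cases Q) auto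
  have blk: "u div Q = m \<longleftrightarrow> Q * m \<le> u" if "u \<le> i" for u
    using that i Q by (auto simp: div_nat_eqI mult.commute dividend_less_times_div
        times_div_less_eq_dividend intro!: div_nat_eqI)
  have SS: "S a \<le> S b" if "a \<le> b" "b < i" "a div Q = b div Q" for a b
    using S that unfolding bsorted_def by (cases "a = b") auto
  show "S' t \<le> S' t'"
  proof (cases "t' < j")
    case True
    then show ?thesis
      using SS[of t t'] t j S' by simp
  next
    case False
    then have m: "t' div Q = m" "t div Q = m" "Q * m \<le> t"
      using blk[of t'] blk[of t] t j by auto
    have below: "S a \<le> x" if "Q * m \<le> a" "a < j" for a
    proof -
      have a: "a \<le> j - 1" "j - 1 < i" "Q * m < j" "Q * m \<le> j - 1" "a \<le> i" "j - 1 \<le> i"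
        using that j by auto
      moreover have "a div Q = (j - 1) div Q"
        using blk[OF a(5)] blk[OF a(6)] a(4) that(1) by simp
      ultimately show ?thesis
        using SS[of a "j - 1"] lo by simp
    qed
    have dj: "a div Q = m" if "Q * m \<le> a" "a \<le> i" for a
      using that blk by blast
    consider "t < j" "t' = j" | "t < j" "j < t'" | "t = j" "j < t'" | "j < t" "j < t'"
      using False t by linarith
    then show ?thesis
    proof cases
      case 1
      then show ?thesis
        using below m t S' by simp
    next
      case 2
      then show ?thesis
        using SS[of t "t' - 1"] m t S' dj[of "t' - 1"] j by simp
    next
      case 3
      have "x < S (t' - 1)"
        by (rule hi) (use 3 t in auto)
      then show ?thesis
        using 3 t S' by simp
    next
      case 4
      then show ?thesis
        using SS[of "t - 1" "t' - 1"] m t S' dj[of "t' - 1"] dj[of "t - 1"] j by simp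
    qed
  qed
qed

text \<open>Multiplicities are irrelevant, since a character is numbered by its first index in the
  sorted array; so only the set of entries is tracked instead of a permutation.\<close>

lemma image_insert:
  assumes "j \<le> i"
    and S': "\<And>t. t \<le> i \<Longrightarrow> S' t = (if t = j then x else if j < t then S (t - 1) else S t)"
  shows "S' ` {..<Suc i} = insert x (S ` {..<i})"
proof (intro equalityI subsetI)
  fix y assume "y \<in> S' ` {..<Suc i}"
  then obtain t where "t \<le> i" "y = S' t"
    by (metis imageE lessThan_iff less_Suc_eq_le)
  then show "y \<in> insert x (S ` {..<i})"
    using S'[of t] assms(1) by (cases "j < t") auto
next
  fix y assume "y \<in> insert x (S ` {..<i})"
  then consider "y = x" | t where "t < i" "y = S t"
    by auto
  then show "y \<in> S' ` {..<Suc i}"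
  proof cases
    case 1
    then show ?thesis
      using S'[of j] assms(1) by (auto intro!: image_eqI[of _ _ j])
  next
    case 2
    show ?thesis
    proof (cases "t < j")
      case True
      then show ?thesis
        using 2 S'[of t] by (intro image_eqI[of _ _ t]) auto
    next
      case False
      then show ?thesis
        using 2 S'[of "Suc t"] by (intro image_eqI[of _ _ "Suc t"]) auto
    qed
  qed
qed

context lcs
begin

text \<open>Both conjuncts of a guard are always evaluated. Entry \<open>t\<close> of the sorted
  pattern is therefore stored at index \<open>t + 1\<close>, so that the cell to the left of the
  first entry exists.\<close>

definition insert_loop :: com where
  "insert_loop = Wh ((V 11 <! V 12) &! (V 13 <! Ld 0 (V 12)))
     (St 0 (V 12 +! N 1) (Ld 0 (V 12)) ;; 12 :=! V 12 -! N 1)"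

lemma wp_insert_loop:
  assumes R: "R 10 < r" "R 11 \<le> R 10" "R 12 = R 10" and L: "n + 2 \<le> L"
    and K: "\<And>R' M' T'. same {12} R' R \<Longrightarrow> same2 {0} M' M \<Longrightarrow> R 11 \<le> R' 12 \<Longrightarrow> R' 12 \<le> R 10 \<Longrightarrow>
      M' 0 = (\<lambda>t. if R' 12 + 1 < t \<and> t \<le> R 10 + 1 then M 0 (t - 1) else M 0 t) \<Longrightarrow>
      (R 11 < R' 12 \<Longrightarrow> M 0 (R' 12) \<le> R 13) \<Longrightarrow> (\<And>t. R' 12 < t \<Longrightarrow> t \<le> R 10 \<Longrightarrow> R 13 < M 0 t) \<Longrightarrow>
      T' \<le> T + 50 * (R 10 - R 11) + 20 \<Longrightarrow> Q R' M' U T'"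
  shows "wp insert_loop Q R M U T"
  unfolding insert_loop_def
proof -
  define I where "I = (\<lambda>R' M' U' T'. same {12} R' R \<and> same2 {0} M' M \<and> U' = U \<and> R 11 \<le> R' 12 \<and> R' 12 \<le> R 10 \<and>
     M' 0 = (\<lambda>t. if R' 12 + 1 < t \<and> t \<le> R 10 + 1 then M 0 (t - 1) else M 0 t) \<and>
     (\<forall>t. R' 12 < t \<and> t \<le> R 10 \<longrightarrow> R 13 < M 0 t) \<and> T' + 50 * R' 12 \<le> T + 50 * R 10)"
  show "wp (Wh ((V 11 <! V 12) &! (V 13 <! Ld 0 (V 12)))
     (St 0 (V 12 +! N 1) (Ld 0 (V 12)) ;; 12 :=! V 12 -! N 1)) Q R M U T"
  proof (rule wp_while[where I = I and f = "\<lambda>R' M'. R' 12"], goal_cases)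
    case 1
    then show ?case
      using R by (auto simp: I_def)
  next
    case (2 R' M' U' T')
    then have s: "same {12} R' R" and s2: "same2 {0} M' M" and U: "U' = U" and j: "R 11 \<le> R' 12" "R' 12 \<le> R 10"
      and M: "M' 0 = (\<lambda>t. if R' 12 + 1 < t \<and> t \<le> R 10 + 1 then M 0 (t - 1) else M 0 t)"
      and x: "\<forall>t. R' 12 < t \<and> t \<le> R 10 \<longrightarrow> R 13 < M 0 t" and T: "T' + 50 * R' 12 \<le> T + 50 * R 10"
      unfolding I_def by blast+
    have R': "R' 10 = R 10" "R' 11 = R 11" "R' 13 = R 13"
      using s by simp_all
    have M': "M' 0 (R' 12) = M 0 (R' 12)"
      by (simp add: M)
    show ?case
    proof (cases "R 11 < R' 12 \<and> R 13 < M 0 (R' 12)")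
      case False
      have "Q R' M' U T''" if "T'' \<le> T' + 20" for T''
        by (rule K) (use s s2 j M x T False that in auto)
      then show ?thesis
        using False R' M' U j R rn L w16 nw' by auto
    next
      case True
      have "(M' 0)(R' 12 + 1 := M 0 (R' 12)) =
        (\<lambda>t. if R' 12 < t \<and> t \<le> R 10 + 1 then M 0 (t - 1) else M 0 t)"
        using j by (auto simp: M fun_eq_iff)
      moreover have "R' 12 - 1 + 1 = R' 12"
        using True by simp
      moreover have "R 13 < M 0 t" if "R' 12 - 1 < t" "t \<le> R 10" for t
        using that True x by (cases "t = R' 12") auto
      ultimately show ?thesis
        using True R' M' U j R rn L w16 nw' s s2 x T by (auto simp: I_def le_less_Suc_eq)
    qed
  qed
qed


definition sort_blocks :: com where
  "sort_blocks = (10 :=! N 0 ;; 11 :=! N 0 ;; Wh (V 10 <! V 1)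
     (If (V 10 =! V 11 +! V 3) (11 :=! V 10) (12 :=! N 0) ;;
      13 :=! In (V 5 +! V 10) ;; 12 :=! V 10 ;; insert_loop ;;
      St 0 (V 12 +! N 1) (V 13) ;; 10 :=! V 10 +! N 1))"

lemma wp_sort_blocks:
  assumes R: "R 0 = n" "R 1 = r" "R 3 = Q0" "R 5 = 2 + 2 * n" "0 < Q0" "Q0 \<le> 64 * n + 64"
    "n + Q0 < 2 ^ w" and L: "n + 2 \<le> L"
    and K: "\<And>R' M' T'. same {10, 11, 12, 13} R' R \<Longrightarrow> same2 {0} M' M \<Longrightarrow>
      bsorted Q0 r (\<lambda>t. M' 0 (t + 1)) \<Longrightarrow> (\<lambda>t. M' 0 (t + 1)) ` {..<r} = set P \<Longrightarrow>
      T' \<le> T + 100 * (r * Q0) + 100 * r + 20 \<Longrightarrow> Q R' M' U T'"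
  shows "wp sort_blocks Q R M U T"
proof -
  define I where "I = (\<lambda>R' M' U' T'. same {10, 11, 12, 13} R' R \<and> same2 {0} M' M \<and> U' = U \<and> R' 10 \<le> r \<and>
     (\<exists>m. R' 11 = Q0 * m) \<and> R' 11 \<le> R' 10 \<and> R' 10 \<le> R' 11 + Q0 \<and>
     bsorted Q0 (R' 10) (\<lambda>t. M' 0 (t + 1)) \<and> (\<lambda>t. M' 0 (t + 1)) ` {..<R' 10} = (!) P ` {..<R' 10} \<and>
     T' \<le> T + 10 + (100 * Q0 + 100) * R' 10)"
  have "wp (Wh (V 10 <! V 1)
     (If (V 10 =! V 11 +! V 3) (11 :=! V 10) (12 :=! N 0) ;;
      13 :=! In (V 5 +! V 10) ;; 12 :=! V 10 ;; insert_loop ;;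
      St 0 (V 12 +! N 1) (V 13) ;; 10 :=! V 10 +! N 1)) Q (R(10 := 0, 11 := 0)) M U T1" if "T1 \<le> T + 10" for T1
  proof (rule wp_while[where I = I and f = "\<lambda>R' M'. r - R' 10"], goal_cases)
    case 1
    then show ?case
      using that by (auto simp: I_def bsorted_def intro: exI[of _ 0])
  next
    case (2 R' M' U' T')
    then have s: "same {10, 11, 12, 13} R' R" and s2: "same2 {0} M' M" and U: "U' = U" and i: "R' 10 \<le> r"
      and m: "\<exists>m. R' 11 = Q0 * m" and b: "R' 11 \<le> R' 10" "R' 10 \<le> R' 11 + Q0"
      and bs: "bsorted Q0 (R' 10) (\<lambda>t. M' 0 (t + 1))"
      and im: "(\<lambda>t. M' 0 (t + 1)) ` {..<R' 10} = (!) P ` {..<R' 10}"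
      and T: "T' \<le> T + 10 + (100 * Q0 + 100) * R' 10"
      unfolding I_def by blast+
    have R': "R' 0 = n" "R' 1 = r" "R' 3 = Q0" "R' 5 = 2 + 2 * n"
      using s R by simp_all
    show ?case
    proof (cases "R' 10 < r")
      case False
      then have ir: "R' 10 = r"
        using i by simp
      have "(!) P ` {..<r} = set P"
        using lenP by (auto simp: set_conv_nth)
      then have "Q R' M' U T''" if "T'' \<le> T' + 10" for T''
        by (intro K) (use s s2 bs im T that ir in \<open>auto simp: algebra_simps\<close>)
      then show ?thesis
        using False R' U by simp
    next
      case True
      define b' where "b' = (if R' 10 = R' 11 + Q0 then R' 10 else R' 11)"
      obtain m where m': "b' = Q0 * m"
      proof -
        obtain m0 where "R' 11 = Q0 * m0"
          using m by blast
        then have "b' = Q0 * (if R' 10 = R' 11 + Q0 then m0 + 1 else m0)"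
          by (simp add: b'_def algebra_simps)
        then show ?thesis
          using that by blast
      qed
      have b': "b' \<le> R' 10" "R' 10 < b' + Q0"
        using b R(5) by (auto simp: b'_def)
      have x: "2 + 2 * n + R' 10 < length inp \<and> inp ! (2 + 2 * n + R' 10) = P ! R' 10"
        using textatD(1)[OF textat_P] lenP True by simp
      have main: "wp (insert_loop ;; St 0 (V 12 +! N 1) (V 13) ;; 10 :=! V 10 +! N 1)
        (\<lambda>R'' M'' U'' T''. I R'' M'' U'' (T'' + 2) \<and> r - R'' 10 < r - R' 10) R1 M' U T1"
        if R1: "same {11, 12, 13} R1 R'" "R1 11 = b'" "R1 12 = R' 10" "R1 13 = P ! R' 10" and T1: "T1 \<le> T' + 30"
        for R1 T1
        unfolding wp.simps(4)
      proof (rule wp_insert_loop, goal_cases)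
        case (5 R2 M2 T2)
        have R1': "R1 10 = R' 10" "R1 0 = n" "R1 1 = r" "R1 3 = Q0" "R1 5 = 2 + 2 * n"
          using R1 R' by simp_all
        define M3 where "M3 = M2(0 := (M2 0)(R2 12 + 1 := P ! R' 10))"
        have e: "M3 0 (t + 1) = (if t = R2 12 then P ! R' 10 else if R2 12 < t then M' 0 (t - 1 + 1) else M' 0 (t + 1))"
          if "t \<le> R' 10" for t
          using 5 R1' that by (simp add: M3_def)
        have 51: "R1 11 \<le> R2 12" "R2 12 \<le> R' 10" "T2 \<le> T1 + 50 * (R' 10 - b') + 20"
          using 5 R1' R1 by simp_all
        have bs3: "bsorted Q0 (Suc (R' 10)) (\<lambda>t. M3 0 (t + 1))"
        proof (rule bsorted_insert[OF bs, of m "R2 12" "P ! R' 10"])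
          show "M' 0 (R2 12 - 1 + 1) \<le> P ! R' 10" if "Q0 * m < R2 12"
            using 5(6) that m' R1 by simp
          show "P ! R' 10 < M' 0 (t + 1)" if "R2 12 \<le> t" "t < R' 10" for t
            using 5(7)[of "t + 1"] that R1' R1 by simp
        qed (use b' m' 51 R1 e in auto)
        have im3: "(\<lambda>t. M3 0 (t + 1)) ` {..<Suc (R' 10)} = insert (P ! R' 10) ((\<lambda>t. M' 0 (t + 1)) ` {..<R' 10})"
          by (rule image_insert) (use 51 e in auto)
        have im4: "(\<lambda>t. M3 0 (t + 1)) ` {..<R' 10 + 1} = (!) P ` {..<R' 10 + 1}"
          using im3 im by (simp add: lessThan_Suc Suc_eq_plus1[symmetric])
        have s3: "same {10, 11, 12, 13} (R2(10 := R' 10 + 1)) R" "same2 {0} M3 M"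
          using 5 R1 s s2 by (auto simp: M3_def)
        have R2: "R2 10 = R' 10" "R2 11 = b'" "R2 13 = P ! R' 10"
          using 5(1) R1 by simp_all
        have "R' 10 - b' \<le> Q0"
          using b' by linarith
        then have "50 * (R' 10 - b') \<le> 50 * Q0"
          by simp
        then have T3: "T2 + 40 \<le> T + 10 + (100 * Q0 + 100) * (R' 10 + 1)"
          using 51 T T1 R(5) by (simp add: algebra_simps)
        have "I (R2(10 := R' 10 + 1)) M3 U T3" if "T3 \<le> T2 + 40" for T3
          unfolding I_def using s3 bs3 im4 T3 that True b' m' R2
          by (auto simp: Suc_eq_plus1)
        then show ?case
          using True R2 51 rn L nw' w16 R1 by (simp add: M3_def)
      qed (use R1 R' True b' m' L in auto)
      have "2 + 2 * n + R' 10 < 2 ^ w" "b' + Q0 < 2 ^ w" "R' 11 + Q0 < 2 ^ w"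
        using True rn nw' b b' R(7) by (auto simp: b'_def)
      then show ?thesis
        using True R' U x w16 b'_def main R(5) by (auto simp del: wp.simps(4) simp: wp.simps(4)[of "If _ _ _"] wp.simps(4)[of "Set _ _"])
    qed
  qed
  then show ?thesis
    unfolding sort_blocks_def using w16 by simp
qed


text \<open>The number of a character; \<open>r\<close> if it does not occur in \<open>P\<close>.\<close>

definition kap :: "(nat \<Rightarrow> nat) \<Rightarrow> nat \<Rightarrow> nat" where
  "kap S c = (LEAST v. v = r \<or> (v < r \<and> S v = c))"

lemma kap_eqI: "v < r \<Longrightarrow> S v = c \<Longrightarrow> (\<And>t. t < v \<Longrightarrow> S t \<noteq> c) \<Longrightarrow> kap S c = v"
  unfolding kap_def by (rule Least_equality) (auto simp: not_less[symmetric])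

lemma kap_eqI': "(\<And>t. t < r \<Longrightarrow> S t \<noteq> c) \<Longrightarrow> kap S c = r"
  unfolding kap_def by (rule Least_equality) auto

lemma kap_le: "kap S c \<le> r"
  unfolding kap_def by (rule Least_le) simp

text \<open>The numbering separates the characters of \<open>P\<close> from each other and from all
  others, as \<open>EE_map\<close> requires.\<close>

lemma kap_iff:
  assumes "S ` {..<r} = set P" "p \<in> set P"
  shows "kap S p < r" "kap S p = kap S a \<longleftrightarrow> p = a"
proof -
  have ex: "kap S c = r \<or> (kap S c < r \<and> S (kap S c) = c)" for c
    unfolding kap_def using LeastI[of "\<lambda>v. v = r \<or> (v < r \<and> S v = c)" r] by simp
  obtain t where "t < r" "S t = p"
    using assms by (metis imageE lessThan_iff)
  then have "kap S p \<le> t"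
    unfolding kap_def by (intro Least_le) simp
  then show *: "kap S p < r"
    using \<open>t < r\<close> by simp
  show "kap S p = kap S a \<longleftrightarrow> p = a"
    using ex[of p] ex[of a] * by (metis less_irrefl)
qed

definition scan_heads :: com where
  "scan_heads = Wh ((V 24 +! V 2 <! V 23) &! (Ld 0 (V 24 +! V 2 +! N 1) <! V 20)) (24 :=! V 24 +! V 2)"

definition scan_block :: com where
  "scan_block = Wh ((V 24 <! V 23) &! (Ld 0 (V 24 +! N 1) <! V 20)) (24 :=! V 24 +! N 1)"

lemma wp_scan_heads:
  assumes R: "R 24 = b" "R 23 = e" "R 2 = W" "1 \<le> W" "W \<le> n + 2" "e \<le> r" "b < e" "e \<le> b + W * W"
    and L: "2 * n + 8 \<le> L"
    and srt: "\<And>t t'. b \<le> t \<Longrightarrow> t \<le> t' \<Longrightarrow> t' < e \<Longrightarrow> M 0 (t + 1) \<le> M 0 (t' + 1)"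
    and K: "\<And>R' T'. same {24} R' R \<Longrightarrow> b \<le> R' 24 \<Longrightarrow> R' 24 < e \<Longrightarrow>
      (\<And>t. b \<le> t \<Longrightarrow> t < R' 24 \<Longrightarrow> M 0 (t + 1) < R 20) \<Longrightarrow>
      (R' 24 + W < e \<Longrightarrow> R 20 \<le> M 0 (R' 24 + W + 1)) \<Longrightarrow> T' \<le> T + 50 * W + 50 \<Longrightarrow> Q R' M U T'"
  shows "wp scan_heads Q R M U T"
  unfolding scan_heads_def
proof -
  define I where "I = (\<lambda>R' M' U' T'. same {24} R' R \<and> M' = M \<and> U' = U \<and> R' 24 < e \<and>
     (\<exists>m. R' 24 = b + W * m \<and> m \<le> W \<and> T' \<le> T + 50 * m) \<and>
     (\<forall>t. b \<le> t \<and> t < R' 24 \<longrightarrow> M 0 (t + 1) < R 20))"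
  show "wp (Wh ((V 24 +! V 2 <! V 23) &! (Ld 0 (V 24 +! V 2 +! N 1) <! V 20)) (24 :=! V 24 +! V 2)) Q R M U T"
  proof (rule wp_while[where I = I and f = "\<lambda>R' M'. e - R' 24"], goal_cases)
    case 1
    then show ?case
      using R by (auto simp: I_def intro: exI[of _ 0])
  next
    case (2 R' M' U' T')
    then have s: "same {24} R' R" and M: "M' = M" "U' = U" and lo: "R' 24 < e"
      and m: "\<exists>m. R' 24 = b + W * m \<and> m \<le> W \<and> T' \<le> T + 50 * m"
      and lt: "\<forall>t. b \<le> t \<and> t < R' 24 \<longrightarrow> M 0 (t + 1) < R 20"
      unfolding I_def by blast+
    obtain m where m: "R' 24 = b + W * m" "m \<le> W" "T' \<le> T + 50 * m"
      using m by blast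
    have R': "R' 23 = e" "R' 2 = W" "R' 20 = R 20"
      using s R by simp_all
    \<comment> \<open>The guard reads \<open>W\<close> entries ahead even at the end of the block.
      With \<open>W \<le> n + 2\<close> this leads to indices slightly above \<open>2 * n\<close>,
      hence the lower bound \<open>2 * n + 8\<close> on \<open>L\<close>.\<close>
    have bnd: "R' 24 + W + 1 < L" "R' 24 + W + 1 < 2 ^ w"
      using lo R rn L nw' by linarith+
    show ?case
    proof (cases "R' 24 + W < e \<and> M 0 (R' 24 + W + 1) < R 20")
      case False
      have "Q R' M U T''" if "T'' \<le> T' + 30" for T''
        by (rule K) (use s lo m lt False that in auto)
      then show ?thesis
        using False R' M bnd w16 by auto
    next
      case True
      \<comment> \<open>A block has at most \<open>W * W\<close> entries, so there are at most
        \<open>W\<close> jumps of width \<open>W\<close>.\<close>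
      have "W * m < W * W"
        using True m R by linarith
      then have "m + 1 \<le> W"
        by simp
      moreover have "R' 24 + W = b + W * (m + 1)"
        using m by (simp add: algebra_simps)
      moreover have "M 0 (t + 1) < R 20" if "b \<le> t" "t < R' 24 + W" for t
        using srt[of t "R' 24 + W"] that True by simp
      moreover have "same {24} (R'(24 := R' 24 + W)) R"
        using s by simp
      ultimately have "I (R'(24 := R' 24 + W)) M U T''" if "T'' \<le> T' + 40" for T''
        unfolding I_def using True m that by (auto intro!: exI[of _ "m + 1"])
      then show ?thesis
        using True R' M bnd w16 R by auto
    qed
  qed
qed

lemma wp_scan_block:
  assumes R: "R 24 = l" "R 23 = e" "e \<le> r" "l < e" and L: "2 * n + 8 \<le> L"
    and stop: "l + W < e \<Longrightarrow> R 20 \<le> M 0 (l + W + 1)"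
    and K: "\<And>R' T'. same {24} R' R \<Longrightarrow> l \<le> R' 24 \<Longrightarrow> R' 24 \<le> e \<Longrightarrow>
      (\<And>t. l \<le> t \<Longrightarrow> t < R' 24 \<Longrightarrow> M 0 (t + 1) < R 20) \<Longrightarrow>
      (R' 24 < e \<Longrightarrow> R 20 \<le> M 0 (R' 24 + 1)) \<Longrightarrow> T' \<le> T + 50 * W + 50 \<Longrightarrow> Q R' M U T'"
  shows "wp scan_block Q R M U T"
  unfolding scan_block_def
proof -
  define I where "I = (\<lambda>R' M' U' T'. same {24} R' R \<and> M' = M \<and> U' = U \<and> l \<le> R' 24 \<and> R' 24 \<le> e \<and>
     R' 24 \<le> l + W \<and> T' + 50 * l \<le> T + 50 * R' 24 \<and>
     (\<forall>t. l \<le> t \<and> t < R' 24 \<longrightarrow> M 0 (t + 1) < R 20))"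
  show "wp (Wh ((V 24 <! V 23) &! (Ld 0 (V 24 +! N 1) <! V 20)) (24 :=! V 24 +! N 1)) Q R M U T"
  proof (rule wp_while[where I = I and f = "\<lambda>R' M'. e - R' 24"], goal_cases)
    case 1
    then show ?case
      using R by (auto simp: I_def)
  next
    case (2 R' M' U' T')
    then have s: "same {24} R' R" and M: "M' = M" "U' = U" and lo: "l \<le> R' 24" "R' 24 \<le> e" "R' 24 \<le> l + W"
      and T: "T' + 50 * l \<le> T + 50 * R' 24"
      and lt: "\<forall>t. l \<le> t \<and> t < R' 24 \<longrightarrow> M 0 (t + 1) < R 20"
      unfolding I_def by blast+
    have R': "R' 23 = e" "R' 20 = R 20"
      using s R by simp_all
    have bnd: "R' 24 + 1 < L" "R' 24 + 1 < 2 ^ w"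
      using lo R rn L nw' by linarith+
    show ?case
    proof (cases "R' 24 < e \<and> M 0 (R' 24 + 1) < R 20")
      case False
      have "Q R' M U T''" if "T'' \<le> T' + 30" for T''
        by (rule K) (use s lo T lt False that in auto)
      then show ?thesis
        using False R' M bnd w16 by auto
    next
      case True
      have "R' 24 \<noteq> l + W"
        using True stop by auto
      then have "R' 24 + 1 \<le> l + W"
        using lo by simp
      moreover have "M 0 (t + 1) < R 20" if "l \<le> t" "t < R' 24 + 1" for t
        using that True lt by (cases "t = R' 24") auto
      moreover have "same {24} (R'(24 := R' 24 + 1)) R"
        using s by simp
      ultimately have "I (R'(24 := R' 24 + 1)) M U T''" if "T'' \<le> T' + 40" for T''
        unfolding I_def using True that lo T by auto
      then show ?thesis
        using True R' M bnd w16 R by auto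
    qed
  qed
qed

definition lookup :: com where
  "lookup = (22 :=! N 0 ;; 21 :=! V 1 ;; Wh ((V 22 <! V 1) &! (V 21 =! V 1))
     (23 :=! V 22 +! V 3 ;; If (V 1 <! V 23) (23 :=! V 1) (24 :=! N 0) ;; 24 :=! V 22 ;;
      scan_heads ;; scan_block ;;
      If ((V 24 <! V 23) &! (Ld 0 (V 24 +! N 1) =! V 20)) (21 :=! V 24) (24 :=! N 0) ;;
      22 :=! V 22 +! V 3))"

text \<open>The scans stop at the first entry of a block that is not below the character, and the
  search continues only if it does not occur in the earlier blocks. Hence the index found is the
  least one, as \<open>kap\<close> demands.\<close>

lemma wp_lookup:
  assumes R: "R 1 = r" "R 2 = W" "R 3 = W * W" "1 \<le> W" "W \<le> n + 2"
    and srt: "bsorted (W * W) r (\<lambda>t. M 0 (t + 1))" and L: "2 * n + 8 \<le> L"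
    and K: "\<And>R' T'. same {21, 22, 23, 24} R' R \<Longrightarrow> R' 21 = kap (\<lambda>t. M 0 (t + 1)) (R 20) \<Longrightarrow>
      T' \<le> T + 400 * (r div W + W + 1) \<Longrightarrow> Q R' M U T'"
  shows "wp lookup Q R M U T"
proof -
  define S where "S = (\<lambda>t. M 0 (t + 1))"
  have WW: "W * W \<le> (n + 2) * (n + 2)"
    using R by (intro mult_le_mono) auto
  have nn: "n \<le> (n + 2) * (n + 2)"
    using mult_le_mono[of n "n + 2" 1 "n + 2"] by simp
  define I where "I = (\<lambda>R' M' U' T'. same {21, 22, 23, 24} R' R \<and> M' = M \<and> U' = U \<and>
     (\<exists>m. R' 22 = W * W * m \<and> R' 22 \<le> r + W * W \<and> T' \<le> T + 20 + 300 * (W * m) \<and>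
       W * m \<le> r div W + W) \<and>
     (if R' 21 = r then (\<forall>t. t < R' 22 \<and> t < r \<longrightarrow> S t \<noteq> R 20) else R' 21 = kap S (R 20)))"
  have "wp (Wh ((V 22 <! V 1) &! (V 21 =! V 1))
     (23 :=! V 22 +! V 3 ;; If (V 1 <! V 23) (23 :=! V 1) (24 :=! N 0) ;; 24 :=! V 22 ;;
      scan_heads ;; scan_block ;;
      If ((V 24 <! V 23) &! (Ld 0 (V 24 +! N 1) =! V 20)) (21 :=! V 24) (24 :=! N 0) ;;
      22 :=! V 22 +! V 3)) Q (R(22 := 0, 21 := r)) M U T1" if "T1 \<le> T + 10" for T1
  proof (rule wp_while[where I = I and f = "\<lambda>R' M'. r + W * W - R' 22"], goal_cases)
    case 1
    then show ?case
      using that by (auto simp: I_def intro!: exI[of _ 0])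
  next
    case (2 R' M' U' T')
    then have s: "same {21, 22, 23, 24} R' R" and M: "M' = M" "U' = U"
      and m: "\<exists>m. R' 22 = W * W * m \<and> R' 22 \<le> r + W * W \<and> T' \<le> T + 20 + 300 * (W * m) \<and> W * m \<le> r div W + W"
      and kp: "if R' 21 = r then (\<forall>t. t < R' 22 \<and> t < r \<longrightarrow> S t \<noteq> R 20) else R' 21 = kap S (R 20)"
      unfolding I_def by blast+
    obtain m where m: "R' 22 = W * W * m" "R' 22 \<le> r + W * W" "T' \<le> T + 20 + 300 * (W * m)" "W * m \<le> r div W + W"
      using m by blast
    have R': "R' 1 = r" "R' 2 = W" "R' 3 = W * W" "R' 20 = R 20"
      using s R by simp_all
    show ?case
    proof (cases "R' 22 < r \<and> R' 21 = r")
      case False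
      have "R' 21 = kap S (R 20)"
      proof (cases "R' 21 = r")
        case True
        then have "kap S (R 20) = r"
          using kp False by (intro kap_eqI') auto
        then show ?thesis
          using True by simp
      qed (use kp in simp)
      then have "Q R' M U T''" if "T'' \<le> T' + 20" for T''
        by (intro K) (use s m that in \<open>auto simp: S_def\<close>)
      then show ?thesis
        using False R' M by auto
    next
      case True
      define e where "e = min (R' 22 + W * W) r"
      have e: "e \<le> r" "R' 22 < e" "e \<le> R' 22 + W * W"
        using True R by (auto simp: e_def)
      have dv: "t div (W * W) = m" if "R' 22 \<le> t" "t < e" for t
        using that m(1) e(3) by (intro div_nat_eqI) (auto simp: algebra_simps)
      have srt': "M 0 (t + 1) \<le> M 0 (t' + 1)" if "R' 22 \<le> t" "t \<le> t'" "t' < e" for t t'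
        using srt dv[of t] dv[of t'] that e(1) unfolding bsorted_def by (cases "t = t'") auto
      \<comment> \<open>The \<open>m\<close> blocks searched so far cover \<open>W * W * m\<close>
        entries at a cost of \<open>O(W)\<close> each, so their total cost \<open>O(W * m)\<close>
        is \<open>O(r div W)\<close>.\<close>
      have "W * (W * m) \<le> r"
        using True m(1) by (simp add: mult.assoc)
      then have rW: "W * m \<le> r div W"
        using R(4) by (simp add: less_eq_div_iff_mult_less_eq mult.commute)
      have body: "wp (scan_heads ;; scan_block ;;
          If ((V 24 <! V 23) &! (Ld 0 (V 24 +! N 1) =! V 20)) (21 :=! V 24) (24 :=! N 0) ;;
          22 :=! V 22 +! V 3)
        (\<lambda>R'' M'' U'' T''. I R'' M'' U'' (T'' + 2) \<and> r + W * W - R'' 22 < r + W * W - R' 22) R1 M U T1"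
        if R1: "same {23, 24} R1 R'" "R1 23 = e" "R1 24 = R' 22" and T1: "T1 \<le> T' + 40" for R1 T1
        unfolding wp.simps(4)
      proof (rule wp_scan_heads[where b = "R' 22" and e = e and W = W], goal_cases)
        case (11 R2 T2)
        have R2: "R2 1 = r" "R2 2 = W" "R2 3 = W * W" "R2 20 = R 20" "R2 21 = r" "R2 22 = R' 22" "R2 23 = e"
          using 11(1) R1 R' True by simp_all
        show ?case
        proof (rule wp_scan_block[where l = "R2 24" and e = e and W = W], goal_cases)
          case (7 R3 T3)
          have R3: "R3 1 = r" "R3 2 = W" "R3 3 = W * W" "R3 20 = R 20" "R3 21 = r" "R3 22 = R' 22" "R3 23 = e"
            using 7(1) R2 by simp_all
          have R1': "R1 20 = R 20"
            using R1 R' by simp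
          have sm: "same {21, 22, 23, 24} R3 R"
            using 7(1) 11(1) R1(1) s by simp
          have lt: "S t < R 20" if "R' 22 \<le> t" "t < R3 24" for t
            using 11(4)[of t] 7(4)[of t] that R2 R1' by (cases "t < R2 24") (auto simp: S_def)
          have lt': "S t \<noteq> R 20" if "t < R3 24" for t
            using lt[of t] kp True that 7(3) e(1) by (cases "R' 22 \<le> t") auto
          have l3: "R' 22 \<le> R3 24" "R3 24 \<le> e"
            using 7 11 by simp_all
          have T3: "T3 \<le> T' + 140 + 100 * W"
            using 7 11 T1 by simp
          have fin: "I R4 M U T4 \<and> r + W * W - R4 22 < r + W * W - R' 22"
            if R4: "same {21, 22, 24} R4 R3" "R4 22 = R' 22 + W * W" "T4 \<le> T3 + 60"
              "R4 21 = (if R3 24 < e \<and> S (R3 24) = R 20 then R3 24 else r)" for R4 T4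
          proof -
            have "same {21, 22, 23, 24} R4 R"
              using R4(1) sm by simp
            moreover have "R4 22 = W * W * (m + 1)" "R4 22 \<le> r + W * W"
              using R4 m(1) True by (simp_all add: algebra_simps)
            moreover have "T4 \<le> T + 20 + 300 * (W * (m + 1))" "W * (m + 1) \<le> r div W + W"
              using R4(3) T3 m(3) rW R(4) by (simp_all add: algebra_simps)
            moreover have "if R4 21 = r then (\<forall>t. t < R4 22 \<and> t < r \<longrightarrow> S t \<noteq> R 20) else R4 21 = kap S (R 20)"
            proof (cases "R3 24 < e \<and> S (R3 24) = R 20")
              case True
              then have "kap S (R 20) = R3 24"
                using lt' e(1) by (intro kap_eqI) auto
              then show ?thesis
                using True R4(4) e(1) by auto
            next
              case False
              have "S t \<noteq> R 20" if t: "t < R4 22" "t < r" for t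
              proof (cases "t < R3 24")
                case False
                have "t < e"
                  using t R4(2) by (simp add: e_def)
                then have "R3 24 < e" "R3 24 \<le> t"
                  using False by simp_all
                then have "R 20 \<le> S (R3 24)"
                  using 7(5) R2 by (simp add: S_def)
                then have "R 20 < S (R3 24)"
                  using \<open>R3 24 < e\<close> \<open>\<not> (R3 24 < e \<and> S (R3 24) = R 20)\<close> by simp
                also have "S (R3 24) \<le> S t"
                  using srt'[of "R3 24" t] l3 \<open>R3 24 \<le> t\<close> \<open>t < e\<close> by (simp add: S_def)
                finally show ?thesis
                  by simp
              qed (use lt' in simp)
              moreover have "R4 21 = r"
                using False R4(4) by presburger
              ultimately show ?thesis
                by simp
            qed
            moreover have "r + W * W - R4 22 < r + W * W - R' 22"
            proof -
              have "0 < W * W"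
                using R(4) by simp
              then show ?thesis
                using R4(2) \<open>R' 22 < e\<close> e(1) by linarith
            qed
            ultimately show ?thesis
              unfolding I_def using R4(3) by (auto intro!: exI[of _ "m + 1"])
          qed
          have bd: "R3 24 + 1 < 2 ^ w" "R3 24 + 1 < L" "R' 22 + W * W < 2 ^ w"
            using l3 e(1) rn nw' L m(2) WW nw nn True by linarith+
          have "0 < W * W"
            using R(4) by simp
          then have "r - R' 22 < r + W * W - R' 22"
            using True by linarith
          then show ?case
            using R3 bd w16 fin by (auto simp: S_def)
        qed (use R2 R1 e 11 L in auto)
      qed (use R1 R' R e L srt' rn in auto)
      have "R' 22 + W * W < 2 ^ w"
        using rn nw' L m(2) WW nw nn True by linarith
      then show ?thesis
        using True R' M w16 e_def body by (auto simp: min_def)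
    qed
  qed
  then show ?thesis
    unfolding lookup_def using w16 R by simp
qed


text \<open>Array \<open>b\<close> is filled from right to left and thus numbers the reversed
  string, which is needed for the starts of the windows.\<close>

definition ids :: "nat \<Rightarrow> nat \<Rightarrow> nat \<Rightarrow> nat \<Rightarrow> com" where
  "ids a b rl bs = (31 :=! N 0 ;; Wh (V 31 <! V rl) (20 :=! In (V bs +! V 31) ;; lookup ;;
     St a (V 31) (V 21) ;; St b (V rl -! N 1 -! V 31) (V 21) ;; 31 :=! V 31 +! N 1))"

lemma wp_ids:
  assumes R: "R 1 = r" "R 2 = W" "R 3 = W * W" "1 \<le> W" "W \<le> n + 2"
    and srt: "bsorted (W * W) r S" "S = (\<lambda>t. M 0 (t + 1))" and L: "2 * n + 8 \<le> L"
    and ab: "a \<noteq> 0" "b \<noteq> 0" "a \<noteq> b" "a < 16" "b < 16" "rl < 10" "bs < 10"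
    and X: "R rl = length X" "textat (R bs) X" "length X \<le> n"
    and K: "\<And>R' M' T'. same {20, 21, 22, 23, 24, 31} R' R \<Longrightarrow> same2 {a, b} M' M \<Longrightarrow>
      (\<And>j. j < length X \<Longrightarrow> M' a j = kap S (X ! j)) \<Longrightarrow>
      (\<And>j. j < length X \<Longrightarrow> M' b j = kap S (rev X ! j)) \<Longrightarrow>
      T' \<le> T + 20 + length X * (400 * (r div W + W + 1) + 100) \<Longrightarrow> Q R' M' U T'"
  shows "wp (ids a b rl bs) Q R M U T"
proof -
  define C where "C = 400 * (r div W + W + 1)"
  define I where "I = (\<lambda>R' M' U' T'. same {20, 21, 22, 23, 24, 31} R' R \<and> same2 {a, b} M' M \<and> U' = U \<and>
     R' 31 \<le> length X \<and> (\<forall>j<R' 31. M' a j = kap S (X ! j) \<and> M' b (length X - 1 - j) = kap S (X ! j)) \<and>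
     T' \<le> T + 10 + R' 31 * (C + 100))"
  have "wp (Wh (V 31 <! V rl) (20 :=! In (V bs +! V 31) ;; lookup ;;
     St a (V 31) (V 21) ;; St b (V rl -! N 1 -! V 31) (V 21) ;; 31 :=! V 31 +! N 1)) Q (R(31 := 0)) M U T1"
    if "T1 \<le> T + 10" for T1
  proof (rule wp_while[where I = I and f = "\<lambda>R' M'. length X - R' 31"], goal_cases)
    case 1
    then show ?case
      using that by (simp add: I_def)
  next
    case (2 R' M' U' T')
    then have s: "same {20, 21, 22, 23, 24, 31} R' R" and s2: "same2 {a, b} M' M" and U: "U' = U"
      and j: "R' 31 \<le> length X"
      and m: "\<forall>j<R' 31. M' a j = kap S (X ! j) \<and> M' b (length X - 1 - j) = kap S (X ! j)"
      and T: "T' \<le> T + 10 + R' 31 * (C + 100)"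
      unfolding I_def by blast+
    have R': "R' 1 = r" "R' 2 = W" "R' 3 = W * W" "R' rl = length X" "R' bs = R bs"
      using s R ab X by simp_all
    have M0: "M' 0 = M 0"
      using s2 ab by simp
    show ?case
    proof (cases "R' 31 < length X")
      case False
      then have j: "R' 31 = length X"
        using j by simp
      have ma: "M' a j = kap S (X ! j)" if "j < length X" for j
        using m that \<open>R' 31 = length X\<close> by simp
      have mb: "M' b j = kap S (rev X ! j)" if "j < length X" for j
        using m[rule_format, of "length X - Suc j"] that \<open>R' 31 = length X\<close>
        by (simp add: rev_nth One_nat_def)
      have "Q R' M' U T''" if "T'' \<le> T' + 10" for T''
        by (rule K[OF s s2 ma mb]) (use that T j in \<open>auto simp: C_def\<close>)
      then show ?thesis
        using False R' U by simp
    next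
      case True
      have tx: "R bs + R' 31 < length inp" "inp ! (R bs + R' 31) = X ! R' 31" "R bs + R' 31 < 2 ^ w"
        using textatD[OF X(2)] True X(3) nw' by auto
      have body: "wp (lookup ;; St a (V 31) (V 21) ;; St b (V rl -! N 1 -! V 31) (V 21) ;; 31 :=! V 31 +! N 1)
         (\<lambda>R'' M'' U'' T''. I R'' M'' U'' (T'' + 2) \<and> length X - R'' 31 < length X - R' 31) R1 M' U T1"
        if R1: "same {20} R1 R'" "R1 20 = X ! R' 31" and T1: "T1 \<le> T' + 20" for R1 T1
        unfolding wp.simps(4)
      proof (rule wp_lookup[where W = W], goal_cases)
        case (8 R2 T2)
        have R2: "R2 31 = R' 31" "R2 rl = length X" "R2 21 = kap S (X ! R' 31)"
          using 8(1,2) R1 R' ab srt M0 by simp_all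
        have s3: "same {20, 21, 22, 23, 24, 31} (R2(31 := R' 31 + 1)) R"
          using 8(1) R1(1) s by simp
        define M3 where "M3 = M'(a := (M' a)(R' 31 := kap S (X ! R' 31)),
          b := (M' b)(length X - 1 - R' 31 := kap S (X ! R' 31)))"
        have m3: "M3 a j = kap S (X ! j) \<and> M3 b (length X - 1 - j) = kap S (X ! j)"
          if "j < R' 31 + 1" for j
          using m that ab True by (cases "j = R' 31") (auto simp: M3_def)
        have s23: "same2 {a, b} M3 M"
          using s2 by (simp add: M3_def)
        have T3: "T3 + 2 \<le> T + 10 + (R' 31 + 1) * (C + 100)" if "T3 \<le> T2 + 40" for T3
          using that 8(3) T1 T by (simp add: C_def algebra_simps)
        have fin: "I (R2(31 := R' 31 + 1)) M3 U T3" if "T3 \<le> T2 + 40" for T3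
          unfolding I_def using s3 s23 m3 T3[OF that] True by simp
        show ?case
          using R2 fin True X(3) L nw' w16 ab by (auto simp: M3_def)
      qed (use R1 R' R srt M0 L in auto)
      then show ?thesis
        using True R' U tx by auto
    qed
  qed
  then show ?thesis
    unfolding ids_def using w16 by simp
qed

end

section \<open>Minimal windows of the pattern\<close>

lemma bit_double: "bit (x + x :: nat) t \<longleftrightarrow> 0 < t \<and> bit x (t - 1)"
proof -
  have "x + x = push_bit 1 x"
    by (simp add: push_bit_eq_mult)
  then show ?thesis
    by (simp add: bit_push_bit_iff) (cases t; auto simp: One_nat_def)
qed

lemma less_power_if_bits:
  assumes "\<And>t. q \<le> t \<Longrightarrow> \<not> bit (x :: nat) t"
  shows "x < 2 ^ q"
proof -
  have "take_bit q x = x"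
    by (rule bit_eqI) (use assms in \<open>auto simp: bit_take_bit_iff not_le[symmetric]\<close>)
  then show ?thesis
    by (simp add: take_bit_nat_eq_self_iff)
qed

text \<open>The machine word after \<open>j\<close> characters, for the section of \<open>P\<close> from \<open>p\<close> to \<open>p + q\<close>: bit \<open>t\<close> is a token
  at \<open>p + t\<close>. Tokens that leave the section are recorded in a flag array, from which the next section
  takes them. Bit \<open>0\<close> does not yet contain the arrivals from the previous section.\<close>

definition tokbit :: "nat list \<Rightarrow> nat list \<Rightarrow> nat \<Rightarrow> nat \<Rightarrow> nat \<Rightarrow> nat \<Rightarrow> bool" where
  "tokbit ps xs p q j t \<longleftrightarrow>
    (if t = 0 then 0 < j \<and> pos ps xs p (j - 1) \<and> ps ! p \<noteq> xs ! (j - 1)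
     else if t < q then pos ps xs (p + t) j else t = q \<and> arr ps xs (p + q) j)"

context
  fixes ps xs :: "nat list" and p q j T T1 :: nat
  assumes q: "0 < q" "p + q \<le> length ps" and T: "\<And>t. bit T t \<longleftrightarrow> tokbit ps xs p q j t"
    and T1: "T1 = or (and T (2 ^ q - 1)) (of_bool (arr ps xs p j))"
begin

text \<open>No bit above \<open>q\<close> is ever set, so the shifted word is already the flag to be
  stored.\<close>

lemma tok_out: "drop_bit q T = of_bool (arr ps xs (p + q) j)"
proof (rule bit_eqI)
  fix t
  show "bit (drop_bit q T) t = bit (of_bool (arr ps xs (p + q) j) :: nat) t"
    using q by (cases t) (auto simp: bit_drop_bit_eq T tokbit_def bit_of_bool_iff)
qed

text \<open>Masking removes the token that has left the section, and the incoming flag completes bit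
  \<open>0\<close> according to \<open>pos_rec\<close>.\<close>

lemma tok_in: "bit T1 t \<longleftrightarrow> t < q \<and> pos ps xs (p + t) j"
proof (cases t)
  case 0
  have "bit T1 0 \<longleftrightarrow> bit T 0 \<or> arr ps xs p j"
    using q by (simp add: T1 bit_or_iff bit_and_iff bit_of_bool_iff mask_eq_exp_minus_1[symmetric] bit_mask_iff)
  also have "\<dots> \<longleftrightarrow> pos ps xs p j"
    using q unfolding T tokbit_def by (subst (2) pos_rec) auto
  finally show ?thesis
    using 0 q by simp
next
  case (Suc t')
  then show ?thesis
    using q by (auto simp: T1 bit_or_iff bit_and_iff bit_of_bool_iff mask_eq_exp_minus_1[symmetric] bit_mask_iff T tokbit_def)
qed

text \<open>\<open>x\<close> collects the tokens whose next character is being read.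
  \<open>xor\<close> takes them away, \<open>x + x\<close> puts them one position further, and
  \<open>or\<close> merges tokens that meet. The bound on \<open>x\<close> excludes an overflow of
  the sum.\<close>

lemma tok_step:
  assumes m: "\<And>t. bit m t \<longleftrightarrow> t < q \<and> ps ! (p + t) = xs ! j" and x: "x = and T1 m"
  shows "bit (or (xor T1 x) (x + x)) t \<longleftrightarrow> tokbit ps xs p q (j + 1) t" "x < 2 ^ q"
proof -
  have xb: "bit x t \<longleftrightarrow> t < q \<and> pos ps xs (p + t) j \<and> ps ! (p + t) = xs ! j" for t
    using m by (auto simp: x bit_and_iff tok_in)
  show "x < 2 ^ q"
    by (rule less_power_if_bits) (simp add: xb)
  have b: "bit (or (xor T1 x) (x + x)) t \<longleftrightarrow>
    (t < q \<and> pos ps xs (p + t) j \<and> ps ! (p + t) \<noteq> xs ! j) \<or>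
    (0 < t \<and> t - 1 < q \<and> pos ps xs (p + (t - 1)) j \<and> ps ! (p + (t - 1)) = xs ! j)"
    by (auto simp: bit_or_iff bit_xor_iff bit_double xb tok_in)
  have a: "arr ps xs (p + t) (j + 1) \<longleftrightarrow> pos ps xs (p + (t - 1)) j \<and> p + t \<le> length ps \<and> ps ! (p + (t - 1)) = xs ! j"
    if "0 < t"
    using that by (simp add: arr_def)
  show "bit (or (xor T1 x) (x + x)) t \<longleftrightarrow> tokbit ps xs p q (j + 1) t"
  proof (cases "t = 0")
    case True
    then show ?thesis
      using q b by (simp add: tokbit_def)
  next
    case False
    show ?thesis
    proof (cases "t < q")
      case True
      have "pos ps xs (p + t) (j + 1) \<longleftrightarrow> arr ps xs (p + t) (j + 1) \<or>
          (pos ps xs (p + t) j \<and> \<not> (p + t < length ps \<and> ps ! (p + t) = xs ! j))"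
        by (subst pos_rec) simp
      then show ?thesis
        using True False q a b by (auto simp: tokbit_def)
    next
      case False
      then show ?thesis
        using \<open>t \<noteq> 0\<close> q a b by (cases "t = q") (auto simp: tokbit_def)
    qed
  qed
qed

end

text \<open>Before the first character only position \<open>0\<close> of \<open>P\<close> carries a
  token. It counts as an arrival and is therefore not yet in the word, even for the first
  section.\<close>

lemma tok_init: "0 < q \<Longrightarrow> \<not> tokbit ps xs p q 0 t"
  by (subst tokbit_def, subst pos_rec) (auto simp: arr_def)

context lcs
begin

definition init_flags :: "nat \<Rightarrow> com" where
  "init_flags af = (45 :=! N 0 ;; Wh (V 45 <! V 0 +! N 1) (St af (V 45) (N 1) ;; 45 :=! V 45 +! N 1))"

lemma wp_init_flags:
  assumes R: "R 0 = n" and L: "2 * n + 8 \<le> L" and af: "af < 16"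
    and K: "\<And>R' M' T'. same {45} R' R \<Longrightarrow> same2 {af} M' M \<Longrightarrow> (\<And>j. j \<le> n \<Longrightarrow> M' af j = 1) \<Longrightarrow>
      T' \<le> T + 50 * n + 100 \<Longrightarrow> Q R' M' U T'"
  shows "wp (init_flags af) Q R M U T"
proof -
  define I where "I = (\<lambda>R' M' U' T'. same {45} R' R \<and> same2 {af} M' M \<and> U' = U \<and> R' 45 \<le> n + 1 \<and>
     (\<forall>j<R' 45. M' af j = 1) \<and> T' \<le> T + 10 + 40 * R' 45)"
  have "wp (Wh (V 45 <! V 0 +! N 1) (St af (V 45) (N 1) ;; 45 :=! V 45 +! N 1)) Q (R(45 := 0)) M U T1"
    if "T1 \<le> T + 10" for T1
  proof (rule wp_while[where I = I and f = "\<lambda>R' M'. n + 1 - R' 45"], goal_cases)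
    case 1
    then show ?case
      using that by (simp add: I_def)
  next
    case (2 R' M' U' T')
    then have s: "same {45} R' R" and s2: "same2 {af} M' M" and U: "U' = U" and j: "R' 45 \<le> n + 1"
      and m: "\<forall>j<R' 45. M' af j = 1" and T: "T' \<le> T + 10 + 40 * R' 45"
      unfolding I_def by blast+
    have R': "R' 0 = n"
      using s R by simp
    show ?case
    proof (cases "R' 45 < n + 1")
      case False
      have "Q R' M' U T''" if "T'' \<le> T' + 10" for T''
        by (rule K) (use s s2 m T that j False in auto)
      then show ?thesis
        using False R' U nw' by simp
    next
      case True
      have "I (R'(45 := R' 45 + 1)) (M'(af := (M' af)(R' 45 := 1))) U T''" if "T'' \<le> T' + 40" for T''
        unfolding I_def using s s2 m T that True by (auto simp: less_Suc_eq Suc_eq_plus1[symmetric])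
      then show ?thesis
        using True R' U L af nw' by auto
    qed
  qed
  then show ?thesis
    unfolding init_flags_def using w16 by simp
qed

definition set_masks :: "nat \<Rightarrow> com" where
  "set_masks ap = (43 :=! N 0 ;; Wh (V 43 <! V 41) (46 :=! Ld ap (V 40 +! V 43) ;;
     St 3 (V 46) (Bop Or (Ld 3 (V 46)) (Bop Shl (N 1) (V 43))) ;; 43 :=! V 43 +! N 1))"

text \<open>Only the masks of characters in the section are reset, so that a change of section costs
  \<open>O(q)\<close> and not the length of the whole array.\<close>

definition clear_masks :: "nat \<Rightarrow> com" where
  "clear_masks ap = (43 :=! N 0 ;; Wh (V 43 <! V 41) (St 3 (Ld ap (V 40 +! V 43)) (N 0) ;;
     43 :=! V 43 +! N 1))"

lemma wp_set_masks:
  assumes R: "R 40 = p" "R 41 = q" "p + q \<le> r" and L: "2 * n + 8 \<le> L" and ap: "ap < 16" "ap \<noteq> 3"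
    and q: "2 ^ q \<le> n + 2"
    and ps: "\<And>k. k < r \<Longrightarrow> M ap k = ps ! k \<and> ps ! k \<le> r" and MT: "\<And>x. x \<le> r \<Longrightarrow> M 3 x = 0"
    and K: "\<And>R' M' T'. same {43, 46} R' R \<Longrightarrow> same2 {3} M' M \<Longrightarrow>
      (\<And>x t. x \<le> r \<Longrightarrow> bit (M' 3 x) t \<longleftrightarrow> t < q \<and> ps ! (p + t) = x) \<Longrightarrow>
      T' \<le> T + 50 * q + 50 \<Longrightarrow> Q R' M' U T'"
  shows "wp (set_masks ap) Q R M U T"
proof -
  define I where "I = (\<lambda>R' M' U' T'. same {43, 46} R' R \<and> same2 {3} M' M \<and> U' = U \<and> R' 43 \<le> q \<and>
     (\<forall>x t. x \<le> r \<longrightarrow> (bit (M' 3 x) t \<longleftrightarrow> t < R' 43 \<and> ps ! (p + t) = x)) \<and> T' \<le> T + 10 + 50 * R' 43)"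
  have "wp (Wh (V 43 <! V 41) (46 :=! Ld ap (V 40 +! V 43) ;;
     St 3 (V 46) (Bop Or (Ld 3 (V 46)) (Bop Shl (N 1) (V 43))) ;; 43 :=! V 43 +! N 1)) Q (R(43 := 0)) M U T1"
    if "T1 \<le> T + 10" for T1
  proof (rule wp_while[where I = I and f = "\<lambda>R' M'. q - R' 43"], goal_cases)
    case 1
    then show ?case
      using that MT by (simp add: I_def)
  next
    case (2 R' M' U' T')
    then have s: "same {43, 46} R' R" and s2: "same2 {3} M' M" and U: "U' = U" and j: "R' 43 \<le> q"
      and m: "\<forall>x t. x \<le> r \<longrightarrow> (bit (M' 3 x) t \<longleftrightarrow> t < R' 43 \<and> ps ! (p + t) = x)"
      and T: "T' \<le> T + 10 + 50 * R' 43"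
      unfolding I_def by blast+
    have R': "R' 40 = p" "R' 41 = q"
      using s R by simp_all
    show ?case
    proof (cases "R' 43 < q")
      case False
      have "Q R' M' U T''" if "T'' \<le> T' + 10" for T''
        by (rule K) (use s s2 m T that j False in auto)
      then show ?thesis
        using False R' U nw' by simp
    next
      case True
      define x where "x = ps ! (p + R' 43)"
      have x: "M' ap (p + R' 43) = x" "x \<le> r"
        using ps[of "p + R' 43"] s2 ap True R(3) by (auto simp: x_def)
      define M3 where "M3 = M'(3 := (M' 3)(x := or (M' 3 x) (2 ^ R' 43)))"
      have bt: "bit (2 ^ R' 43 :: nat) t \<longleftrightarrow> t = R' 43" for t
        by (auto simp: bit_exp_iff)
      have m3: "bit (M3 3 y) t \<longleftrightarrow> t < R' 43 + 1 \<and> ps ! (p + t) = y" if "y \<le> r" for y t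
        using that m by (auto simp: M3_def bit_or_iff bt x_def less_Suc_eq Suc_eq_plus1[symmetric])
      have fin: "I (R'(46 := x, 43 := R' 43 + 1)) M3 U T''" if "T'' \<le> T' + 45" for T''
        unfolding I_def using s s2 m3 T that True by (auto simp: M3_def)
      have "(2 :: nat) ^ R' 43 \<le> 2 ^ q"
        using True by (intro power_increasing) auto
      then have "(2 :: nat) ^ R' 43 < 2 ^ w"
        using q nw' by linarith
      then show ?thesis
        using True R' U L ap nw' x fin rn R(3) by (auto simp: push_bit_of_1 M3_def)
    qed
  qed
  then show ?thesis
    unfolding set_masks_def using w16 by simp
qed

lemma wp_clear_masks:
  assumes R: "R 40 = p" "R 41 = q" "p + q \<le> r" and L: "2 * n + 8 \<le> L" and ap: "ap < 16" "ap \<noteq> 3"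
    and ps: "\<And>k. k < r \<Longrightarrow> M ap k = ps ! k \<and> ps ! k \<le> r"
    and MT: "\<And>x t. x \<le> r \<Longrightarrow> bit (M 3 x) t \<longleftrightarrow> t < q \<and> ps ! (p + t) = x"
    and K: "\<And>R' M' T'. same {43} R' R \<Longrightarrow> same2 {3} M' M \<Longrightarrow> (\<And>x. x \<le> r \<Longrightarrow> M' 3 x = 0) \<Longrightarrow>
      T' \<le> T + 50 * q + 50 \<Longrightarrow> Q R' M' U T'"
  shows "wp (clear_masks ap) Q R M U T"
proof -
  define I where "I = (\<lambda>R' M' U' T'. same {43} R' R \<and> same2 {3} M' M \<and> U' = U \<and> R' 43 \<le> q \<and>
     (\<forall>x\<le>r. M' 3 x = (if \<exists>t<R' 43. ps ! (p + t) = x then 0 else M 3 x)) \<and> T' \<le> T + 10 + 50 * R' 43)"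
  have "wp (Wh (V 43 <! V 41) (St 3 (Ld ap (V 40 +! V 43)) (N 0) ;; 43 :=! V 43 +! N 1)) Q (R(43 := 0)) M U T1"
    if "T1 \<le> T + 10" for T1
  proof (rule wp_while[where I = I and f = "\<lambda>R' M'. q - R' 43"], goal_cases)
    case 1
    then show ?case
      using that MT by (simp add: I_def)
  next
    case (2 R' M' U' T')
    then have s: "same {43} R' R" and s2: "same2 {3} M' M" and U: "U' = U" and j: "R' 43 \<le> q"
      and m: "\<forall>x\<le>r. M' 3 x = (if \<exists>t<R' 43. ps ! (p + t) = x then 0 else M 3 x)"
      and T: "T' \<le> T + 10 + 50 * R' 43"
      unfolding I_def by blast+
    have R': "R' 40 = p" "R' 41 = q"
      using s R by simp_all
    show ?case
    proof (cases "R' 43 < q")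
      case False
      then have jq: "R' 43 = q"
        using j by simp
      have z: "M' 3 x = 0" if "x \<le> r" for x
      proof (cases "\<exists>t<q. ps ! (p + t) = x")
        case False
        then have "M 3 x = 0"
          using MT[OF that] by (intro bit_eqI) simp
        then show ?thesis
          using m that jq by simp
      qed (use m that jq in simp)
      have "Q R' M' U T''" if "T'' \<le> T' + 10" for T''
        by (rule K) (use s s2 z T that jq in auto)
      then show ?thesis
        using False R' U nw' by simp
    next
      case True
      define x where "x = ps ! (p + R' 43)"
      have x: "M' ap (p + R' 43) = x" "x \<le> r"
        using ps[of "p + R' 43"] s2 ap True R(3) by (auto simp: x_def)
      define M3 where "M3 = M'(3 := (M' 3)(x := 0))"
      have m3: "M3 3 y = (if \<exists>t<R' 43 + 1. ps ! (p + t) = y then 0 else M 3 y)" if "y \<le> r" for y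
        using that m by (auto simp: M3_def x_def less_Suc_eq Suc_eq_plus1[symmetric])
      have fin: "I (R'(43 := R' 43 + 1)) M3 U T''" if "T'' \<le> T' + 45" for T''
        unfolding I_def using s s2 m3 T that True by (auto simp: M3_def)
      then show ?thesis
        using True R' U L ap nw' x fin rn R(3) w16 by (auto simp: M3_def)
    qed
  qed
  then show ?thesis
    unfolding clear_masks_def using w16 by simp
qed

text \<open>The flags are replaced in place: the arrivals at \<open>p\<close> after \<open>j\<close>
  characters are read immediately before those at \<open>p + q\<close> overwrite them. The last
  round, at \<open>j = n\<close>, reads no character and only updates the flag.\<close>

definition scan_text :: "nat \<Rightarrow> nat \<Rightarrow> com" where
  "scan_text ax af = (44 :=! N 0 ;; 45 :=! N 0 ;; Wh (V 45 <! V 0 +! N 1)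
     (46 :=! Ld af (V 45) ;; St af (V 45) (Bop Shr (V 44) (V 41)) ;;
      44 :=! Bop Or (V 44 &! V 42) (V 46) ;;
      If (V 45 <! V 0) (47 :=! (V 44 &! Ld 3 (Ld ax (V 45))) ;; 44 :=! Bop Or (Bop Xor (V 44) (V 47)) (V 47 +! V 47))
        (47 :=! N 0) ;;
      45 :=! V 45 +! N 1))"

lemma wp_scan_text:
  assumes R: "R 0 = n" "R 41 = q" "R 42 = 2 ^ q - 1" "0 < q" "p + q \<le> r" and L: "2 * n + 8 \<le> L"
    and ar: "ax < 16" "af < 16" "ax \<noteq> af" "ax \<noteq> 3" "af \<noteq> 3" and q: "2 ^ q \<le> n + 2"
    and len: "length ps = r" "length xs = n"
    and xs: "\<And>j. j < n \<Longrightarrow> M ax j = xs ! j \<and> xs ! j \<le> r"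
    and MT: "\<And>x t. x \<le> r \<Longrightarrow> bit (M 3 x) t \<longleftrightarrow> t < q \<and> ps ! (p + t) = x"
    and fl: "\<And>j. j \<le> n \<Longrightarrow> M af j = of_bool (arr ps xs p j)"
    and K: "\<And>R' M' T'. same {44, 45, 46, 47} R' R \<Longrightarrow> same2 {af} M' M \<Longrightarrow>
      (\<And>j. j \<le> n \<Longrightarrow> M' af j = of_bool (arr ps xs (p + q) j)) \<Longrightarrow>
      T' \<le> T + 100 * n + 150 \<Longrightarrow> Q R' M' U T'"
  shows "wp (scan_text ax af) Q R M U T"
proof -
  define I where "I = (\<lambda>R' M' U' T'. same {44, 45, 46, 47} R' R \<and> same2 {af} M' M \<and> U' = U \<and> R' 45 \<le> n + 1 \<and>
     (\<forall>j\<le>n. M' af j = of_bool (arr ps xs (if j < R' 45 then p + q else p) j)) \<and>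
     (R' 45 \<le> n \<longrightarrow> (\<forall>t. bit (R' 44) t \<longleftrightarrow> tokbit ps xs p q (R' 45) t)) \<and>
     T' \<le> T + 20 + 100 * R' 45)"
  have "wp (Wh (V 45 <! V 0 +! N 1)
     (46 :=! Ld af (V 45) ;; St af (V 45) (Bop Shr (V 44) (V 41)) ;;
      44 :=! Bop Or (V 44 &! V 42) (V 46) ;;
      If (V 45 <! V 0) (47 :=! (V 44 &! Ld 3 (Ld ax (V 45))) ;; 44 :=! Bop Or (Bop Xor (V 44) (V 47)) (V 47 +! V 47))
        (47 :=! N 0) ;;
      45 :=! V 45 +! N 1)) Q (R(44 := 0, 45 := 0)) M U T1"
    if "T1 \<le> T + 10" for T1
  proof (rule wp_while[where I = I and f = "\<lambda>R' M'. n + 1 - R' 45"], goal_cases)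
    case 1
    then show ?case
      using that fl R(4) tok_init by (auto simp: I_def)
  next
    case (2 R' M' U' T')
    then have s: "same {44, 45, 46, 47} R' R" and s2: "same2 {af} M' M" and U: "U' = U" and j: "R' 45 \<le> n + 1"
      and f: "\<forall>j\<le>n. M' af j = of_bool (arr ps xs (if j < R' 45 then p + q else p) j)"
      and b: "R' 45 \<le> n \<longrightarrow> (\<forall>t. bit (R' 44) t \<longleftrightarrow> tokbit ps xs p q (R' 45) t)"
      and T: "T' \<le> T + 20 + 100 * R' 45"
      unfolding I_def by blast+
    have R': "R' 0 = n" "R' 41 = q" "R' 42 = 2 ^ q - 1"
      using s R by simp_all
    show ?case
    proof (cases "R' 45 < n + 1")
      case False
      have "Q R' M' U T''" if "T'' \<le> T' + 10" for T''
        by (rule K) (use s s2 f T that j False in auto)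
      then show ?thesis
        using False R' U nw' by simp
    next
      case True
      define c where "c = R' 45"
      have c: "c \<le> n" "R' 45 = c"
        using True by (simp_all add: c_def)
      have pq: "p + q \<le> length ps"
        using R(5) len by simp
      have tb: "bit (R' 44) t \<longleftrightarrow> tokbit ps xs p q c t" for t
        using b c by simp
      define T1 where "T1 = or (and (R' 44) (2 ^ q - 1)) (of_bool (arr ps xs p c))"
      note out = tok_out[OF R(4) pq tb T1_def]
      have f0: "M' af c = of_bool (arr ps xs p c)"
        using f c by simp
      define M3 where "M3 = M'(af := (M' af)(c := of_bool (arr ps xs (p + q) c)))"
      have f3: "M3 af j = of_bool (arr ps xs (if j < c + 1 then p + q else p) j)" if "j \<le> n" for j
        using f that c by (auto simp: M3_def less_Suc_eq Suc_eq_plus1[symmetric])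
      have s23: "same2 {af} M3 M"
        using s2 by (simp add: M3_def)
      show ?thesis
      proof (cases "c < n")
        case False
        have fin: "I (R'(46 := of_bool (arr ps xs p c), 44 := T1, 47 := 0, 45 := c + 1)) M3 U T''"
          if "T'' \<le> T' + 90" for T''
          unfolding I_def using s s23 f3 T that False c by auto
        show ?thesis
          using False c R' U L ar nw' f0 out fin w16 by (auto simp: M3_def T1_def)
      next
        case cn: True
        define x where "x = and T1 (M 3 (xs ! c))"
        have xc: "xs ! c \<le> r" "M ax c = xs ! c"
          using xs[OF cn] by simp_all
        note st = tok_step[OF R(4) pq tb T1_def MT[OF xc(1)] x_def]
        have x2: "x + x < 2 ^ w"
          using st(2) q nw' by linarith
        have fin: "I (R'(46 := of_bool (arr ps xs p c), 47 := x, 44 := or (xor T1 x) (x + x), 45 := c + 1)) M3 U T''"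
          if "T'' \<le> T' + 90" for T''
          unfolding I_def using s s23 f3 T that c st(1) by auto
        have m: "M' ax = M ax" "M' 3 = M 3"
          using s2 ar by simp_all
        have "xs ! c < L"
          using xc rn L by linarith
        then show ?thesis
          using cn c R' U L ar nw' f0 out fin w16 x2 xc m
          by (auto simp: M3_def T1_def[symmetric] x_def[symmetric])
      qed
    qed
  qed
  then show ?thesis
    unfolding scan_text_def using w16 by simp
qed


definition run :: "nat \<Rightarrow> nat \<Rightarrow> nat \<Rightarrow> com" where
  "run ap ax af = (init_flags af ;; 40 :=! N 0 ;; Wh (V 40 <! V 1)
     (If (V 1 -! V 40 <! V 2) (41 :=! V 1 -! V 40) (41 :=! V 2) ;;
      42 :=! Bop Shl (N 1) (V 41) -! N 1 ;; set_masks ap ;; scan_text ax af ;; clear_masks ap ;;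
      40 :=! V 40 +! V 41))"

text \<open>The flags start with all ones because \<open>arr\<close> holds at \<open>0\<close> after
  any number of characters. Each of the at most \<open>r div W + 1\<close> sections moves them on by
  its length, until they describe \<open>arr\<close> at \<open>r\<close>, which marks the window
  ends by \<open>arr_EE\<close>.\<close>

lemma wp_run:
  assumes R: "R 0 = n" "R 1 = r" "R 2 = W" "1 \<le> W" "2 ^ W \<le> n + 2" and L: "2 * n + 8 \<le> L"
    and ar: "ap < 16" "ax < 16" "af < 16" "ax \<noteq> af" "ax \<noteq> 3" "af \<noteq> 3" "ap \<noteq> 3" "ap \<noteq> af"
    and len: "length ps = r" "length xs = n"
    and ps: "\<And>k. k < r \<Longrightarrow> M ap k = ps ! k \<and> ps ! k \<le> r"
    and xs: "\<And>j. j < n \<Longrightarrow> M ax j = xs ! j \<and> xs ! j \<le> r"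
    and MT: "\<And>x. x \<le> r \<Longrightarrow> M 3 x = 0"
    and K: "\<And>R' M' T'. same {40..47} R' R \<Longrightarrow> same2 {af, 3} M' M \<Longrightarrow>
      (\<And>j. j \<le> n \<Longrightarrow> M' af j = of_bool (arr ps xs r j)) \<Longrightarrow> (\<And>x. x \<le> r \<Longrightarrow> M' 3 x = 0) \<Longrightarrow>
      T' \<le> T + 600 * ((n + 2) * (r div W + 2)) \<Longrightarrow> Q R' M' U T'"
  shows "wp (run ap ax af) Q R M U T"
  unfolding run_def wp.simps(4)
proof (rule wp_init_flags, goal_cases)
  case (4 R0 M0 T0)
  define I where "I = (\<lambda>R' M' U' T'. same {40..47} R' R \<and> same2 {af, 3} M' M \<and> U' = U \<and> R' 40 \<le> r \<and>
     (\<forall>j\<le>n. M' af j = of_bool (arr ps xs (R' 40) j)) \<and> (\<forall>x\<le>r. M' 3 x = 0) \<and>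
     (\<exists>m. (R' 40 = W * m \<or> R' 40 = r) \<and> m \<le> r div W + 1 \<and> T' \<le> T + 50 * n + 150 + 500 * (n + 2) * m))"
  have "wp (Wh (V 40 <! V 1)
     (If (V 1 -! V 40 <! V 2) (41 :=! V 1 -! V 40) (41 :=! V 2) ;;
      42 :=! Bop Shl (N 1) (V 41) -! N 1 ;; set_masks ap ;; scan_text ax af ;; clear_masks ap ;;
      40 :=! V 40 +! V 41)) Q (R0(40 := 0)) M0 U T1" if T1: "T1 \<le> T0 + 10" for T1
  proof (rule wp_while[where I = I and f = "\<lambda>R' M'. r - R' 40"], goal_cases)
    case 1
    have "same {40..47} (R0(40 := 0)) R" "same2 {af, 3} M0 M"
      using \<open>same {45} R0 R\<close> \<open>same2 {af} M0 M\<close> by auto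
    moreover have "\<forall>x\<le>r. M0 3 x = 0"
      using \<open>same2 {af} M0 M\<close> MT ar by simp
    moreover have "\<forall>j\<le>n. M0 af j = of_bool (arr ps xs 0 j)"
      using \<open>\<And>j. j \<le> n \<Longrightarrow> M0 af j = 1\<close> by (simp add: arr_def)
    ultimately show ?case
      unfolding I_def using T1 \<open>T0 \<le> T + 50 * n + 100\<close> by (auto intro!: exI[of _ 0])
  next
    case (2 R' M' U' T')
    then have s: "same {40..47} R' R" and s2: "same2 {af, 3} M' M" and U: "U' = U" and p: "R' 40 \<le> r"
      and f: "\<forall>j\<le>n. M' af j = of_bool (arr ps xs (R' 40) j)" and z: "\<forall>x\<le>r. M' 3 x = 0"
      and m: "\<exists>m. (R' 40 = W * m \<or> R' 40 = r) \<and> m \<le> r div W + 1 \<and> T' \<le> T + 50 * n + 150 + 500 * (n + 2) * m"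
      unfolding I_def by blast+
    obtain m where m: "R' 40 = W * m \<or> R' 40 = r" "m \<le> r div W + 1" "T' \<le> T + 50 * n + 150 + 500 * (n + 2) * m"
      using m by blast
    have R': "R' 0 = n" "R' 1 = r" "R' 2 = W"
      using s R by simp_all
    have mm: "M' ap = M ap" "M' ax = M ax"
      using s2 ar by simp_all
    show ?case
    proof (cases "R' 40 < r")
      case False
      then have pr: "R' 40 = r"
        using p by simp
      have "500 * (n + 2) * m \<le> 500 * (n + 2) * (r div W + 1)"
        using m(2) by (intro mult_le_mono2) simp
      also have "\<dots> + 50 * n + 250 \<le> 600 * ((n + 2) * (r div W + 2))"
        by (simp add: algebra_simps)
      finally have T'': "T' + 100 \<le> T + 600 * ((n + 2) * (r div W + 2))"
        using m(3) by linarith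
      have "Q R' M' U T''" if "T'' \<le> T' + 10" for T''
        by (rule K[OF s s2]) (use f z T'' that pr in auto)
      then show ?thesis
        using False R' U by simp
    next
      case True
      define q where "q = min (r - R' 40) W"
      have q: "0 < q" "R' 40 + q \<le> r" "q \<le> W"
        using True R(4) by (auto simp: q_def)
      have "W * m \<le> r"
        using m(1) True by auto
      then have mr: "m \<le> r div W"
        using R(4) by (simp add: less_eq_div_iff_mult_less_eq mult.commute)
      have "(2 :: nat) ^ q \<le> 2 ^ W"
        using q(3) by (intro power_increasing) auto
      then have q2: "2 ^ q \<le> n + 2"
        using R(5) by linarith
      have qn: "q \<le> n + 2"
        using q2 less_exp[of q] by linarith
      have body: "wp (set_masks ap ;; scan_text ax af ;; clear_masks ap ;; 40 :=! V 40 +! V 41)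
        (\<lambda>R'' M'' U'' T''. I R'' M'' U'' (T'' + 2) \<and> r - R'' 40 < r - R' 40) R1 M' U T1"
        if R1: "same {41, 42} R1 R'" "R1 41 = q" "R1 42 = 2 ^ q - 1" and T1: "T1 \<le> T' + 40" for R1 T1
        unfolding wp.simps(4)
      proof (rule wp_set_masks[where p = "R' 40" and q = q and ps = ps], goal_cases)
        case (10 R2 M2 T2)
        note a = 10
        have R2: "R2 0 = n" "R2 40 = R' 40" "R2 41 = q" "R2 42 = 2 ^ q - 1"
          using a(1) R1 R' by simp_all
        have M2: "M2 ap = M ap" "M2 ax = M ax" "M2 af = M' af"
          using a(2) mm ar by simp_all
        show ?case
        proof (rule wp_scan_text[where p = "R' 40" and q = q and ps = ps and xs = xs], goal_cases)
          case (18 R3 M3 T3)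
          note b = 18
          have R3: "R3 0 = n" "R3 40 = R' 40" "R3 41 = q"
            using b(1) R2 by simp_all
          have M3: "M3 ap = M ap" "M3 ax = M ax" "M3 3 = M2 3"
            using b(2) M2 ar by simp_all
          show ?case
          proof (rule wp_clear_masks[where p = "R' 40" and q = q and ps = ps], goal_cases)
            case (9 R4 M4 T4)
            note c = 9
            have R4: "R4 40 = R' 40" "R4 41 = q"
              using c(1) R3 by simp_all
            have s3: "same {40..47} (R4(40 := R' 40 + q)) R"
              using c(1) b(1) a(1) R1(1) s by auto
            have s23: "same2 {af, 3} M4 M"
              using c(2) b(2) a(2) s2 by auto
            have f3: "\<forall>j\<le>n. M4 af j = of_bool (arr ps xs (R' 40 + q) j)"
              using c(2) b(3) ar by auto
            have "T4 + 10 \<le> T' + 500 * (n + 2)"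
              using c(4) b(4) a(4) T1 qn by simp
            then have T4: "T4 + 10 \<le> T + 50 * n + 150 + 500 * (n + 2) * (m + 1)"
              using m(3) by (simp add: algebra_simps)
            have mq: "R' 40 + q = W * (m + 1) \<or> R' 40 + q = r"
              using m(1) True by (auto simp: q_def min_def algebra_simps)
            have fin: "I (R4(40 := R' 40 + q)) M4 U T''" if "T'' \<le> T4 + 10" for T''
              unfolding I_def using s3 s23 f3 c(3) mq mr q(2) T4 that
              by (auto intro!: exI[of _ "m + 1"])
            show ?case
              using R4 fin q rn nw' True by auto
          qed (use R3 M3 a(3) q L ar ps in auto)
        qed (use R2 M2 R(1) q q2 L ar len xs f a(3) in auto)
      qed (use R1 R' q q2 L ar ps mm z in auto)
      have "2 ^ q < (2 :: nat) ^ w" "r - R' 40 < 2 ^ w"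
        using q2 nw' rn by linarith+
      then show ?thesis
      proof (cases "r - R' 40 < W")
        case lt: True
        then have "r - R' 40 = q"
          by (simp add: q_def)
        then show ?thesis
          using True lt R' U body w16 nw' rn \<open>2 ^ q < (2 :: nat) ^ w\<close> \<open>r - R' 40 < 2 ^ w\<close>
          by (simp add: push_bit_of_1)
      next
        case ge: False
        then have "q = W"
          by (simp add: q_def)
        then show ?thesis
          using True ge R' U body w16 nw' rn \<open>2 ^ q < (2 :: nat) ^ w\<close> \<open>r - R' 40 < 2 ^ w\<close>
          by (simp add: push_bit_of_1)
      qed
    qed
  qed
  then show ?case
    using w16 by simp
qed (use R L ar in auto)

text \<open>Ends are monotone in the starts, so that going from right to left each position in which an
  embedding of \<open>P\<close> can start tightly (an end in the reversed strings) is paired with the previous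
  end.\<close>

definition pair_windows :: "nat \<Rightarrow> nat \<Rightarrow> nat \<Rightarrow> nat \<Rightarrow> com" where
  "pair_windows fe fs ea sa = (50 :=! V 0 +! N 1 ;; St ea (V 0 +! N 1) (V 50) ;; 51 :=! V 0 +! N 1 ;;
     Wh (N 0 <! V 51) (51 :=! V 51 -! N 1 ;;
       If (Ld fs (V 0 -! V 51)) (50 :=! V 50 -! N 1 ;; Wh (Ld fe (V 50) =! N 0) (50 :=! V 50 -! N 1) ;;
         St sa (V 50) (V 51)) (52 :=! N 0) ;;
       St ea (V 51) (V 50)))"

text \<open>The time is charged to the descent of register \<open>50\<close>. This register never
  rises during the sweep over all starts, so all calls together take linear time.\<close>

lemma wp_pair_down:
  assumes R: "R 50 \<le> n" "e \<le> R 50" and fe: "fe < 16" "M fe e \<noteq> 0" "\<And>j. e < j \<Longrightarrow> j \<le> R 50 \<Longrightarrow> M fe j = 0"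
    and L: "2 * n + 8 \<le> L"
    and K: "\<And>R' T'. same {50} R' R \<Longrightarrow> R' 50 = e \<Longrightarrow> T' + 50 * e \<le> T + 50 * R 50 + 50 \<Longrightarrow> Q R' M U T'"
  shows "wp (Wh (Ld fe (V 50) =! N 0) (50 :=! V 50 -! N 1)) Q R M U T"
proof -
  define I where "I = (\<lambda>R' M' U' T'. same {50} R' R \<and> M' = M \<and> U' = U \<and> e \<le> R' 50 \<and> R' 50 \<le> R 50 \<and>
     T' + 50 * R' 50 \<le> T + 50 * R 50)"
  show ?thesis
  proof (rule wp_while[where I = I and f = "\<lambda>R' M'. R' 50"], goal_cases)
    case 1
    then show ?case
      using R by (simp add: I_def)
  next
    case (2 R' M' U' T')
    then have s: "same {50} R' R" and M: "M' = M" "U' = U" and e: "e \<le> R' 50" "R' 50 \<le> R 50"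
      and T: "T' + 50 * R' 50 \<le> T + 50 * R 50"
      unfolding I_def by blast+
    show ?case
    proof (cases "R' 50 = e")
      case True
      have "Q R' M U T''" if "T'' \<le> T' + 20" for T''
        by (rule K) (use s T True that in auto)
      then show ?thesis
        using True M L R fe w16 by auto
    next
      case False
      then have "M fe (R' 50) = 0"
        using fe(3)[of "R' 50"] e by simp
      moreover have "I (R'(50 := R' 50 - 1)) M U T''" if "T'' \<le> T' + 40" for T''
        unfolding I_def using s T e False that by auto
      ultimately show ?thesis
        using False M L R fe w16 e nw' by auto
    qed
  qed
qed

lemma wp_pair_windows:
  assumes R: "R 0 = n" and L: "2 * n + 8 \<le> L" and X: "length X = n"
    and ar: "fe < 16" "fs < 16" "ea < 16" "sa < 16" "distinct [fe, fs, ea, sa]"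
    and fe: "\<And>j. j \<le> n \<Longrightarrow> M fe j = of_bool (\<exists>i. EE P X i = j)"
    and fs: "\<And>j. j \<le> n \<Longrightarrow> M fs j = of_bool (\<exists>i. EE (rev P) (rev X) i = j)"
    and K: "\<And>R' M' T'. same {50, 51, 52} R' R \<Longrightarrow> same2 {ea, sa} M' M \<Longrightarrow>
      (\<And>s. s \<le> n + 1 \<Longrightarrow> M' ea s = EE P X s) \<Longrightarrow>
      (\<And>i. EE P X i \<le> n \<Longrightarrow> M' sa (EE P X i) = (GREATEST i'. EE P X i' = EE P X i)) \<Longrightarrow>
      T' \<le> T + 500 * n + 1000 \<Longrightarrow> Q R' M' U T'"
  shows "wp (pair_windows fe fs ea sa) Q R M U T"
proof -
  define I where "I = (\<lambda>R' M' U' T'. same {50, 51, 52} R' R \<and> same2 {ea, sa} M' M \<and> U' = U \<and> R' 51 \<le> n + 1 \<and>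
     R' 50 = EE P X (R' 51) \<and> (\<forall>s. R' 51 \<le> s \<and> s \<le> n + 1 \<longrightarrow> M' ea s = EE P X s) \<and>
     (\<forall>i. R' 51 \<le> i \<and> EE P X i \<le> n \<longrightarrow> M' sa (EE P X i) = (GREATEST i'. EE P X i' = EE P X i)) \<and>
     T' + 150 * R' 51 + 50 * R' 50 \<le> T + 50 + 200 * (n + 1))"
  have En1: "EE P X (n + 1) = n + 1"
    using EE_Suc_length[of P X] X by (simp add: Suc_eq_plus1)
  have "wp (Wh (N 0 <! V 51) (51 :=! V 51 -! N 1 ;;
       If (Ld fs (V 0 -! V 51)) (50 :=! V 50 -! N 1 ;; Wh (Ld fe (V 50) =! N 0) (50 :=! V 50 -! N 1) ;;
         St sa (V 50) (V 51)) (52 :=! N 0) ;;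
       St ea (V 51) (V 50))) Q (R(50 := n + 1, 51 := n + 1)) (M(ea := (M ea)(n + 1 := n + 1))) U T1"
    if T1: "T1 \<le> T + 40" for T1
  proof (rule wp_while[where I = I and f = "\<lambda>R' M'. R' 51"], goal_cases)
    case 1
    have "i \<le> n" if "EE P X i \<le> n" for i
      using EE_ge[of P X i] that X by simp
    then have "\<not> (n + 1 \<le> i \<and> EE P X i \<le> n)" for i
      by force
    then show ?case
      using T1 En1 by (auto simp: I_def)
  next
    case (2 R' M' U' T')
    then have s: "same {50, 51, 52} R' R" and s2: "same2 {ea, sa} M' M" and U: "U' = U" and b: "R' 51 \<le> n + 1"
      and p: "R' 50 = EE P X (R' 51)" and E: "\<forall>s. R' 51 \<le> s \<and> s \<le> n + 1 \<longrightarrow> M' ea s = EE P X s"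
      and G: "\<forall>i. R' 51 \<le> i \<and> EE P X i \<le> n \<longrightarrow> M' sa (EE P X i) = (GREATEST i'. EE P X i' = EE P X i)"
      and T: "T' + 150 * R' 51 + 50 * R' 50 \<le> T + 50 + 200 * (n + 1)"
      unfolding I_def by blast+
    have R': "R' 0 = n"
      using s R by simp
    have mf: "M' fe = M fe" "M' fs = M fs"
      using s2 ar by auto
    show ?case
    proof (cases "0 < R' 51")
      case False
      have "Q R' M' U T''" if "T'' \<le> T' + 20" for T''
        by (rule K[OF s s2]) (use E G T False that in auto)
      then show ?thesis
        using False U w16 by auto
    next
      case True
      define a where "a = R' 51 - 1"
      have a: "R' 51 = Suc a" "a \<le> n" "R' 50 = EE P X (Suc a)"
        using True b p by (auto simp: a_def)
      have pn: "R' 50 \<le> n + 1"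
        using EE_le_Suc[of P X "Suc a"] X a by simp
      \<comment> \<open>By \<open>rev_EE\<close> the flag of the reversed strings tells whether the
        earliest end changes between \<open>a\<close> and \<open>Suc a\<close>.\<close>
      have fsa: "M' fs (n - a) = of_bool (EE P X a < EE P X (Suc a))"
        using fs[of "n - a"] rev_EE[of a X P] a X mf by simp
      have Ea: "EE P X a \<le> EE P X (Suc a)"
        by (rule EE_mono) simp
      have fin: "I (R''(50 := EE P X a)) (M''(ea := (M'' ea)(a := EE P X a))) U T'' \<and> a < R' 51"
        if s': "same {50, 51, 52} R'' R" "R'' 51 = a" "same2 {sa} M'' M'"
          "M'' sa = (if EE P X a < EE P X (Suc a) then (M' sa)(EE P X a := a) else M' sa)"
          and T'': "T'' + 50 * EE P X a \<le> T' + 50 * R' 50 + 140" for R'' M'' T''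
      proof -
        define M3 where "M3 = M''(ea := (M'' ea)(a := EE P X a))"
        have c1: "same2 {ea, sa} M3 M"
          using s'(3) s2 by (simp add: M3_def)
        have c2: "M3 ea j = EE P X j" if "a \<le> j" "j \<le> n + 1" for j
          using E s'(3) that a(1) ar(5) by (cases "j = a") (auto simp: M3_def)
        have c3: "M3 sa (EE P X i) = (GREATEST i'. EE P X i' = EE P X i)"
          if i: "a \<le> i" "EE P X i \<le> n" for i
        proof -
          have M3sa: "M3 sa = M'' sa"
            using ar(5) by (simp add: M3_def)
          show ?thesis
          proof (cases "EE P X i = EE P X a")
            case False
            then have "Suc a \<le> i"
              using i by (cases "i = a") auto
            then show ?thesis
              using M3sa s'(4) G a(1) i False by auto
          next
            case True
            show ?thesis
            proof (cases "EE P X a < EE P X (Suc a)")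
              case False
              then have "EE P X (Suc a) = EE P X i"
                using Ea True by simp
              then show ?thesis
                using M3sa s'(4) G[rule_format, of "Suc a"] a(1) i False by simp
            next
              case lt: True
              \<comment> \<open>Starts beyond \<open>a\<close> have a later end, so the sweep from
                right to left meets the latest start of each end first.\<close>
              have "(GREATEST i'. EE P X i' = EE P X a) = a"
              proof (rule Greatest_equality)
                fix y assume y: "EE P X y = EE P X a"
                show "y \<le> a"
                proof (rule ccontr)
                  assume "\<not> y \<le> a"
                  then have "EE P X (Suc a) \<le> EE P X y"
                    by (intro EE_mono) simp
                  then show False
                    using y lt by simp
                qed
              qed simp
              then show ?thesis
                using M3sa s'(4) True lt by simp
            qed
          qed
        qed
        have c4: "same {50, 51, 52} (R''(50 := EE P X a)) R"
          using s'(1) by simp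
        have c5: "(R''(50 := EE P X a)) 51 = a" "(R''(50 := EE P X a)) 50 = EE P X a"
          using s'(2) by simp_all
        have c6: "T'' + 150 * a + 50 * EE P X a \<le> T + 50 + 200 * (n + 1)"
          using T T'' a(1) by simp
        have "I (R''(50 := EE P X a)) M3 U T''"
          unfolding I_def c5 using c1 c2 c3 c4 c6 a(2) by simp
        then show ?thesis
          using a(1) by (simp add: M3_def)
      qed
      show ?thesis
      proof (cases "EE P X a < EE P X (Suc a)")
        case False
        then have eq: "EE P X a = R' 50"
          using Ea a by simp
        have "I (R'(51 := a, 52 := 0)) (M'(ea := (M' ea)(a := R' 50))) U T'' \<and> a < R' 51"
          if "T'' \<le> T' + 100" for T''
          using fin[of "R'(51 := a, 52 := 0)" M' T''] s that False eq by (simp add: fun_upd_idem)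
        then show ?thesis
          using False a R' U fsa ar L nw' by auto
      next
        case lt: True
        have Een: "EE P X a \<le> n"
          using lt pn a by simp
        have body: "wp (Wh (Ld fe (V 50) =! N 0) (50 :=! V 50 -! N 1))
          (wp (St sa (V 50) (V 51)) (\<lambda>R M U T. wp (St ea (V 51) (V 50))
            (\<lambda>R'' M'' U'' T''. I R'' M'' U'' (T'' + 2) \<and> R'' 51 < R' 51) R M U (T + 2)))
          (R'(51 := a, 50 := R' 50 - 1)) M' U T1" if T1: "T1 \<le> T' + 60" for T1
        proof (rule wp_pair_down[where e = "EE P X a"], goal_cases)
          case (5 j)
          then have "j < EE P X (Suc a)" "j \<le> n"
            using a pn lt by auto
          \<comment> \<open>By monotonicity no end lies strictly between those of \<open>a\<close>
            and \<open>Suc a\<close>, so the first flag met on the way down is the right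
            one.\<close>
          have "EE P X i \<noteq> j" for i
          proof
            assume i: "EE P X i = j"
            show False
            proof (cases "i \<le> a")
              case True
              then show False
                using EE_mono[OF True, of P X] i 5 by simp
            next
              case False
              then have "EE P X (Suc a) \<le> EE P X i"
                by (intro EE_mono) simp
              then show False
                using i \<open>j < EE P X (Suc a)\<close> by simp
            qed
          qed
          then show ?case
            using fe[OF \<open>j \<le> n\<close>] mf by simp
        next
          case (7 R3 T3)
          have R3: "R3 51 = a" "R3 50 = EE P X a" "R3 0 = n"
            using 7 R' by simp_all
          have s3: "same {50, 51, 52} R3 R"
            using 7(1) s by simp
          define M3 where "M3 = M'(sa := (M' sa)(EE P X a := a))"
          have "R3 = R3(50 := EE P X a)"
            using R3(2) by (simp add: fun_upd_idem)
          then have "I R3 (M3(ea := (M3 ea)(a := EE P X a))) U T'' \<and> a < R' 51"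
            if "T'' \<le> T3 + 25" for T''
            using fin[of R3 M3 T''] s3 that 7(3) T1 lt R3 a by (simp add: M3_def fun_upd_idem)
          then show ?case
            using R3 ar L a nw' Een by (simp add: M3_def)
        qed (use lt a pn ar L Een fe mf in auto)
        then show ?thesis
          using lt a R' U fsa ar L nw' pn by auto
      qed
    qed
  qed
  then show ?thesis
    unfolding pair_windows_def using w16 R ar L nw' by auto
qed

definition last_start :: "nat \<Rightarrow> nat \<Rightarrow> com" where
  "last_start ea x = (x :=! V 0 ;; Wh (V 0 <! Ld ea (V x)) (x :=! V x -! N 1))"

lemma wp_last_start:
  assumes R: "R 0 = n" "x \<noteq> 0" and L: "2 * n + 8 \<le> L" and X: "length X = n" "subseq P X" and ea: "ea < 16"
    and E: "\<And>s. s \<le> n \<Longrightarrow> M ea s = EE P X s"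
    and K: "\<And>R' T'. same {x} R' R \<Longrightarrow> R' x \<le> n \<Longrightarrow> (\<And>s. s \<le> n \<Longrightarrow> s \<le> R' x \<longleftrightarrow> EE P X s \<le> n) \<Longrightarrow>
      T' \<le> T + 50 * n + 50 \<Longrightarrow> Q R' M U T'"
  shows "wp (last_start ea x) Q R M U T"
proof -
  define I where "I = (\<lambda>R' M' U' T'. same {x} R' R \<and> M' = M \<and> U' = U \<and> R' x \<le> n \<and>
     (\<forall>s. R' x < s \<and> s \<le> n \<longrightarrow> n < EE P X s) \<and> T' + 50 * R' x \<le> T + 10 + 50 * n)"
  have "win P X 0 n"
    using X win_0 by blast
  then have E0: "EE P X 0 \<le> n"
    using X EE_le_iff[of n X P 0] by simp
  have "wp (Wh (V 0 <! Ld ea (V x)) (x :=! V x -! N 1)) Q (R(x := n)) M U T1" if T1: "T1 \<le> T + 10" for T1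
  proof (rule wp_while[where I = I and f = "\<lambda>R' M'. R' x"], goal_cases)
    case 1
    then show ?case
      using T1 by (simp add: I_def)
  next
    case (2 R' M' U' T')
    then have s: "same {x} R' R" and M: "M' = M" "U' = U" and b: "R' x \<le> n"
      and E1: "\<forall>s. R' x < s \<and> s \<le> n \<longrightarrow> n < EE P X s" and T: "T' + 50 * R' x \<le> T + 10 + 50 * n"
      unfolding I_def by blast+
    have R': "R' 0 = n"
      using s R by simp
    show ?case
    proof (cases "n < EE P X (R' x)")
      case False
      have "s \<le> R' x \<longleftrightarrow> EE P X s \<le> n" if "s \<le> n" for s
      proof
        assume "s \<le> R' x"
        then show "EE P X s \<le> n"
          using EE_mono[of s "R' x" P X] False by simp
      next
        assume "EE P X s \<le> n"
        then show "s \<le> R' x"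
          using E1 that by (meson not_le)
      qed
      then have "Q R' M U T''" if "T'' \<le> T' + 20" for T''
        by (intro K) (use s b T that in auto)
      then show ?thesis
        using False R' M E b ea L by auto
    next
      case True
      have pos: "0 < R' x"
        using True E0 by (cases "R' x") auto
      have "n < EE P X t" if "R' x - 1 < t" "t \<le> n" for t
        using E1 True that by (cases "t = R' x") auto
      then have "I (R'(x := R' x - 1)) M U T''" if "T'' \<le> T' + 40" for T''
        unfolding I_def using s T b pos that by auto
      then show ?thesis
        using True R' M E b ea L pos nw' w16 by auto
    qed
  qed
  then show ?thesis
    unfolding last_start_def using R by simp
qed

end

section \<open>Filling the tables row by row\<close>

lemma index_inj:
  assumes "e < d" "e' < (d :: nat)"
  shows "k * d + e = k' * d + e' \<longleftrightarrow> k = k' \<and> e = e'"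
proof
  assume eq: "k * d + e = k' * d + e'"
  have "(k * d + e) div d = k" "(k' * d + e') div d = k'"
    using assms by (simp_all add: div_mult_self3)
  then have "k = k'"
    using eq by simp
  then show "k = k' \<and> e = e'"
    using eq by simp
qed simp

lemma index_less:
  assumes "e < d" "k < K" "K * d \<le> (L :: nat)"
  shows "k * d + e < L"
proof -
  have "k * d + e < (k + 1) * d"
    using assms(1) by (simp add: algebra_simps)
  also have "\<dots> \<le> K * d"
    using assms(2) by (intro mult_le_mono1) simp
  finally show ?thesis
    using assms(3) by simp
qed

text \<open>The entry for \<open>k\<close> and row \<open>i = k + e\<close> is stored at index \<open>k * (D + 1) + e\<close>. Columns
  \<open>k \<ge> KM\<close> are not stored: all their entries computed so far are infinite.\<close>

definition tab :: "(nat \<Rightarrow> nat \<Rightarrow> nat) \<Rightarrow> nat \<Rightarrow> nat \<Rightarrow> nat \<Rightarrow> nat \<Rightarrow> (nat \<Rightarrow> nat) \<Rightarrow> nat \<Rightarrow> nat \<Rightarrow> bool" where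
  "tab h k0 D nf KM m i kc \<longleftrightarrow> (\<forall>k e. k0 \<le> k \<longrightarrow> e \<le> D \<longrightarrow> (k + e < i \<or> (k + e = i \<and> k < kc)) \<longrightarrow>
     (if k < KM then m (k * (D + 1) + e) = h k (k + e) else h k (k + e) = nf))"

lemma tab_get:
  assumes "tab h k0 D nf KM m i kc" "k0 \<le> k" "k \<le> i'" "i' \<le> k + D" "i' < i \<or> (i' = i \<and> k < kc)"
  shows "k < KM \<Longrightarrow> m (k * (D + 1) + (i' - k)) = h k i'" "KM \<le> k \<Longrightarrow> h k i' = nf"
  using assms(1)[unfolded tab_def, rule_format, of k "i' - k"] assms(2-) by simp_all

section \<open>Columns that are stored on demand\<close>

context lcs
begin

text \<open>A new column has to be filled with infinity because its cells may contain values from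
  the search with a smaller \<open>D\<close>, which had another layout.\<close>

definition fill_column :: "nat \<Rightarrow> nat \<Rightarrow> com" where
  "fill_column ta km = (76 :=! N 0 ;; Wh (V 76 <! V 61)
     (St ta (V km *! V 61 +! V 76) (V 0 +! N 1) ;; 76 :=! V 76 +! N 1))"

definition add_columns :: "nat \<Rightarrow> nat \<Rightarrow> com" where
  "add_columns ta km = Wh (V km <! V 65 +! N 1) (fill_column ta km ;; km :=! V km +! N 1)"

lemma wp_fill_column:
  assumes R: "R 0 = n" "R 61 = D + 1" "R km = k" "km \<notin> {0, 61, 76}" and ta: "ta < 16"
    and L: "k < KX" "KX * (D + 1) \<le> L"
    and K: "\<And>R' M' T'. same {76} R' R \<Longrightarrow> same2 {ta} M' M \<Longrightarrow>
      (\<And>k' e. e \<le> D \<Longrightarrow> M' ta (k' * (D + 1) + e) = (if k' = k then n + 1 else M ta (k' * (D + 1) + e))) \<Longrightarrow>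
      T' \<le> T + 50 * (D + 1) + 20 \<Longrightarrow> Q R' M' U T'"
  shows "wp (fill_column ta km) Q R M U T"
proof -
  define I where "I = (\<lambda>R' M' U' T'. same {76} R' R \<and> same2 {ta} M' M \<and> U' = U \<and> R' 76 \<le> D + 1 \<and>
     (\<forall>k' e. e \<le> D \<longrightarrow> M' ta (k' * (D + 1) + e) = (if k' = k \<and> e < R' 76 then n + 1 else M ta (k' * (D + 1) + e))) \<and>
     T' \<le> T + 10 + 50 * R' 76)"
  have "wp (Wh (V 76 <! V 61) (St ta (V km *! V 61 +! V 76) (V 0 +! N 1) ;; 76 :=! V 76 +! N 1)) Q (R(76 := 0)) M U T1"
    if T1: "T1 \<le> T + 10" for T1
  proof (rule wp_while[where I = I and f = "\<lambda>R' M'. D + 1 - R' 76"], goal_cases)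
    case 1
    then show ?case
      using T1 by (simp add: I_def)
  next
    case (2 R' M' U' T')
    then have s: "same {76} R' R" and s2: "same2 {ta} M' M" and U: "U' = U" and b: "R' 76 \<le> D + 1"
      and m: "\<forall>k' e. e \<le> D \<longrightarrow> M' ta (k' * (D + 1) + e) = (if k' = k \<and> e < R' 76 then n + 1 else M ta (k' * (D + 1) + e))"
      and T: "T' \<le> T + 10 + 50 * R' 76"
      unfolding I_def by blast+
    have R': "R' 0 = n" "R' 61 = D + 1" "R' km = k"
      using s R by simp_all
    show ?case
    proof (cases "R' 76 < D + 1")
      case False
      have "Q R' M' U T''" if "T'' \<le> T' + 10" for T''
        by (rule K[OF s s2]) (use m T b that False in auto)
      then show ?thesis
        using False R' U by simp
    next
      case True
      have idx: "k * (D + 1) + R' 76 < L"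
        by (rule index_less[OF True L])
      define M3 where "M3 = M'(ta := (M' ta)(k * (D + 1) + R' 76 := n + 1))"
      have m3: "M3 ta (k' * (D + 1) + e) = (if k' = k \<and> e < R' 76 + 1 then n + 1 else M ta (k' * (D + 1) + e))"
        if "e \<le> D" for k' e
      proof -
        have "k' * (D + 1) + e = k * (D + 1) + R' 76 \<longleftrightarrow> k' = k \<and> e = R' 76"
          by (rule index_inj) (use that True in auto)
        then show ?thesis
          using m that by (auto simp: M3_def)
      qed
      have s23: "same2 {ta} M3 M"
        using s2 by (simp add: M3_def)
      have fin: "I (R'(76 := R' 76 + 1)) M3 U T''" if "T'' \<le> T' + 40" for T''
        unfolding I_def using s s23 m3 T that True by simp
      have "k * (D + 1) + R' 76 < 2 ^ w" "R' 76 + 1 < 2 ^ w"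
        using idx L16 w16 by linarith+
      then show ?thesis
        using True R' U ta nw' idx fin by (auto simp: M3_def)
    qed
  qed
  then show ?thesis
    unfolding fill_column_def using w16 by simp
qed

text \<open>The number of columns acts as a potential in the time bound. A single entry may create
  many columns, but all rows together create at most \<open>KX\<close>.\<close>

lemma wp_add_columns:
  assumes R: "R 0 = n" "R 61 = D + 1" "R 65 = k" "km \<notin> {0, 61, 65, 76}" and ta: "ta < 16"
    and L: "k < KX" "KX * (D + 1) \<le> L" "KX \<le> L"
    and K: "\<And>R' M' T'. same {km, 76} R' R \<Longrightarrow> same2 {ta} M' M \<Longrightarrow> R' km = max (R km) (k + 1) \<Longrightarrow>
      (\<And>k' e. e \<le> D \<Longrightarrow> M' ta (k' * (D + 1) + e) =
         (if R km \<le> k' \<and> k' \<le> k then n + 1 else M ta (k' * (D + 1) + e))) \<Longrightarrow>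
      T' + 100 * (D + 1) * R km \<le> T + 20 + 100 * (D + 1) * R' km \<Longrightarrow> Q R' M' U T'"
  shows "wp (add_columns ta km) Q R M U T"
  unfolding add_columns_def
proof -
  define I where "I = (\<lambda>R' M' U' T'. same {km, 76} R' R \<and> same2 {ta} M' M \<and> U' = U \<and> R km \<le> R' km \<and>
     R' km \<le> max (R km) (k + 1) \<and>
     (\<forall>k' e. e \<le> D \<longrightarrow> M' ta (k' * (D + 1) + e) =
        (if R km \<le> k' \<and> k' < R' km then n + 1 else M ta (k' * (D + 1) + e))) \<and>
     T' + 100 * (D + 1) * R km \<le> T + 100 * (D + 1) * R' km)"
  show "wp (Wh (V km <! V 65 +! N 1) (fill_column ta km ;; km :=! V km +! N 1)) Q R M U T"
  proof (rule wp_while[where I = I and f = "\<lambda>R' M'. k + 1 - R' km"], goal_cases)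
    case 1
    then show ?case
      by (simp add: I_def)
  next
    case (2 R' M' U' T')
    then have s: "same {km, 76} R' R" and s2: "same2 {ta} M' M" and U: "U' = U"
      and b: "R km \<le> R' km" "R' km \<le> max (R km) (k + 1)"
      and m: "\<forall>k' e. e \<le> D \<longrightarrow> M' ta (k' * (D + 1) + e) =
        (if R km \<le> k' \<and> k' < R' km then n + 1 else M ta (k' * (D + 1) + e))"
      and T: "T' + 100 * (D + 1) * R km \<le> T + 100 * (D + 1) * R' km"
      unfolding I_def by blast+
    have R': "R' 0 = n" "R' 61 = D + 1" "R' 65 = k"
      using s R by simp_all
    have kw: "k + 1 < 2 ^ w"
      using L L16 w16 by linarith
    show ?case
    proof (cases "R' km < k + 1")
      case False
      then have km: "R' km = max (R km) (k + 1)"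
        using b by simp
      have "Q R' M' U T''" if "T'' \<le> T' + 10" for T''
      proof (rule K[OF s s2 km])
        fix k' e assume "e \<le> D"
        then have "M' ta (k' * (D + 1) + e) = (if R km \<le> k' \<and> k' < R' km then n + 1 else M ta (k' * (D + 1) + e))"
          using m by blast
        moreover have "R km \<le> k' \<and> k' < R' km \<longleftrightarrow> R km \<le> k' \<and> k' \<le> k"
          using km by auto
        ultimately show "M' ta (k' * (D + 1) + e) = (if R km \<le> k' \<and> k' \<le> k then n + 1 else M ta (k' * (D + 1) + e))"
          by simp
      qed (use T that in simp)
      then show ?thesis
        using False R' U kw w16 by simp
    next
      case True
      have "wp (fill_column ta km) (wp (km :=! V km +! N 1) (\<lambda>R'' M'' U'' T''. I R'' M'' U'' (T'' + 2) \<and>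
          k + 1 - R'' km < k + 1 - R' km)) R' M' U T1" if T1: "T1 \<le> T' + 10" for T1
      proof (rule wp_fill_column[where D = D and k = "R' km" and KX = KX], goal_cases)
        case (8 R3 M3 T3)
        have R3: "R3 km = R' km"
          using 8(1) R(4) by simp
        have s3: "same {km, 76} (R3(km := R' km + 1)) R"
          using 8(1) s by auto
        have s23: "same2 {ta} M3 M"
          using 8(2) s2 by simp
        have m3: "M3 ta (k' * (D + 1) + e) =
            (if R km \<le> k' \<and> k' < R' km + 1 then n + 1 else M ta (k' * (D + 1) + e))" if "e \<le> D" for k' e
          using 8(3)[OF that, of k'] m that b(1) by auto
        have T3: "T3 + 20 + 100 * (D + 1) * R km \<le> T + 100 * (D + 1) * (R' km + 1)"
          using 8(4) T T1 by (simp add: algebra_simps)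
        have fin: "I (R3(km := R' km + 1)) M3 U T''" if "T'' \<le> T3 + 20" for T''
          unfolding I_def using s3 s23 m3 T3 that b True by simp
        show ?case
          using R3 fin True kw w16 by simp
      qed (use R' R ta L True in auto)
      then show ?thesis
        using True R' U kw w16 by simp
    qed
  qed
qed

text \<open>The first match of \<open>A ! (i - 1)\<close> in \<open>B\<close> from position \<open>p\<close> on, given up at the value \<open>u\<close> that the entry
  has without it.\<close>

definition scan_match :: com where
  "scan_match = Wh ((V 75 +! N 1 <! V 74) &! ((In (V 6 +! V 75) =! In (N 1 +! V 64)) =! N 0)) (75 :=! V 75 +! N 1)"

lemma wp_scan_match:
  assumes R: "R 6 = 2 + n" "R 64 = i" "R 75 = p" "R 74 = u" "u \<le> n + 1" "p \<le> n + 1" "i \<le> n"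
    and i: "1 \<le> i \<or> u \<le> p + 1"
    and K: "\<And>R' T'. same {75} R' R \<Longrightarrow> p \<le> R' 75 \<Longrightarrow> R' 75 \<le> n + 1 \<Longrightarrow>
      (\<And>j. p \<le> j \<Longrightarrow> j < R' 75 \<Longrightarrow> B ! j \<noteq> A ! (i - 1)) \<Longrightarrow>
      (u \<le> R' 75 + 1 \<or> B ! (R' 75) = A ! (i - 1)) \<Longrightarrow> (R' 75 = p \<or> R' 75 + 1 \<le> u) \<Longrightarrow>
      T' + 60 * p \<le> T + 60 * R' 75 + 50 \<Longrightarrow> Q R' M U T'"
  shows "wp scan_match Q R M U T"
  unfolding scan_match_def
proof -
  define I where "I = (\<lambda>R' M' U' T'. same {75} R' R \<and> M' = M \<and> U' = U \<and> p \<le> R' 75 \<and> R' 75 \<le> n + 1 \<and>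
     (\<forall>j. p \<le> j \<and> j < R' 75 \<longrightarrow> B ! j \<noteq> A ! (i - 1)) \<and> (R' 75 = p \<or> R' 75 + 1 \<le> u) \<and>
     T' + 60 * p \<le> T + 60 * R' 75)"
  show "wp (Wh ((V 75 +! N 1 <! V 74) &! ((In (V 6 +! V 75) =! In (N 1 +! V 64)) =! N 0)) (75 :=! V 75 +! N 1)) Q R M U T"
  proof (rule wp_while[where I = I and f = "\<lambda>R' M'. u - R' 75"], goal_cases)
    case 1
    then show ?case
      using R by (simp add: I_def)
  next
    case (2 R' M' U' T')
    then have s: "same {75} R' R" and M: "M' = M" "U' = U" and b: "p \<le> R' 75" "R' 75 \<le> n + 1"
      and no: "\<forall>j. p \<le> j \<and> j < R' 75 \<longrightarrow> B ! j \<noteq> A ! (i - 1)" and pu: "R' 75 = p \<or> R' 75 + 1 \<le> u"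
      and T: "T' + 60 * p \<le> T + 60 * R' 75"
      unfolding I_def by blast+
    have R': "R' 6 = 2 + n" "R' 64 = i" "R' 74 = u"
      using s R by simp_all
    have bd: "R' 75 + 1 < 2 ^ w" "2 + n + R' 75 < 2 ^ w" "1 + i < 2 ^ w"
      using b R nw' by linarith+
    show ?case
    proof (cases "R' 75 + 1 < u")
      case False
      have "Q R' M U T''" if "T'' \<le> T' + 40" for T''
        by (rule K) (use s b no pu T that False in auto)
      then show ?thesis
        using False R' M bd w16 by simp
    next
      case True
      have i1: "1 \<le> i"
        using i b True by linarith
      have "inp ! (2 + (i - 1)) = A ! (i - 1) \<and> 2 + (i - 1) < length inp"
        using textatD(1)[OF textat_A, of "i - 1"] i1 R lenA by simp
      moreover have "2 + (i - 1) = 1 + i"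
        using i1 by simp
      ultimately have inA: "inp ! (1 + i) = A ! (i - 1)" "1 + i < length inp"
        by simp_all
      have inB: "inp ! (2 + n + R' 75) = B ! (R' 75)" "2 + n + R' 75 < length inp"
        using textatD(1)[OF textat_B, of "R' 75"] True R lenB by simp_all
      show ?thesis
      proof (cases "B ! (R' 75) = A ! (i - 1)")
        case eq: True
        have "Q R' M U T''" if "T'' \<le> T' + 40" for T''
          by (rule K) (use s b no pu T that eq in auto)
        then show ?thesis
          using eq R' M bd w16 inA inB by simp
      next
        case neq: False
        have "B ! j \<noteq> A ! (i - 1)" if "p \<le> j" "j < R' 75 + 1" for j
          using no neq that by (cases "j = R' 75") auto
        then have "I (R'(75 := R' 75 + 1)) M U T''" if "T'' \<le> T' + 50" for T''
          unfolding I_def using s b T that True R by simp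
        then show ?thesis
          using neq True R' M bd w16 inA inB by simp
      qed
    qed
  qed
qed

definition tidx :: "nat \<Rightarrow> nat \<Rightarrow> ex" where
  "tidx k i = V k *! V 61 +! (V i -! V k)"

text \<open>Only a finite value creates missing columns. An infinite one is left implicit if its
  column does not exist.\<close>

definition store_cell :: "nat \<Rightarrow> nat \<Rightarrow> com" where
  "store_cell ta km = If (V 73 <! V 71)
     (If (V 65 <! V km) (St ta (tidx 65 64) (V 0 +! N 1)) (76 :=! N 0))
     (add_columns ta km ;; St ta (tidx 65 64) (V 71))"

lemma wp_store_cell:
  assumes R: "R 0 = n" "R 61 = D + 1" "R 65 = k" "R 64 = i" "R 71 = v" "R 73 = lim'" "km \<notin> {0, 61, 64, 65, 71, 76}"
    and ta: "ta < 16" and ki: "k0 \<le> k" "k \<le> i" "i \<le> k + D" "i \<le> n" "lim' \<le> n"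
    and h: "h k i = (if v \<le> lim' then v else n + 1)" "h k i \<le> n \<Longrightarrow> k < KX"
    and KX: "KX * (D + 1) \<le> L" "KX \<le> L" "R km \<le> KX"
    and tb: "tab h k0 D (n + 1) (R km) (M ta) i k"
    and K: "\<And>R' M' T'. same {km, 76} R' R \<Longrightarrow> same2 {ta} M' M \<Longrightarrow> R km \<le> R' km \<Longrightarrow> R' km \<le> KX \<Longrightarrow>
      tab h k0 D (n + 1) (R' km) (M' ta) i (k + 1) \<Longrightarrow>
      T' + 100 * (D + 1) * R km \<le> T + 100 + 100 * (D + 1) * R' km \<Longrightarrow> Q R' M' U T'"
  shows "wp (store_cell ta km) Q R M U T"
proof -
  have D1: "0 < D + 1" "i - k < D + 1"
    using ki by auto
  have key: "tab h k0 D (n + 1) KM (m(k * (D + 1) + (i - k) := x)) i (k + 1)"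
    if m: "\<And>k' e. k0 \<le> k' \<Longrightarrow> e \<le> D \<Longrightarrow> k' + e < i \<or> (k' + e = i \<and> k' < k) \<Longrightarrow>
       (if k' < KM then m (k' * (D + 1) + e) = h k' (k' + e) else h k' (k' + e) = n + 1)"
    and x: "if k < KM then x = h k i else h k i = n + 1" for KM m x
    unfolding tab_def
  proof (intro allI impI)
    fix k' e assume a: "k0 \<le> k'" "e \<le> D" "k' + e < i \<or> (k' + e = i \<and> k' < k + 1)"
    have inj: "k' * (D + 1) + e = k * (D + 1) + (i - k) \<longleftrightarrow> k' = k \<and> e = i - k"
      by (rule index_inj) (use a ki in auto)
    show "if k' < KM then (m(k * (D + 1) + (i - k) := x)) (k' * (D + 1) + e) = h k' (k' + e)
        else h k' (k' + e) = n + 1"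
    proof (cases "k' = k \<and> k' + e = i")
      case True
      then show ?thesis
        using x by auto
    next
      case False
      then have "k' + e < i \<or> (k' + e = i \<and> k' < k)"
        using a by auto
      then show ?thesis
        using m[OF a(1,2)] inj False ki by auto
    qed
  qed
  have tbr: "if k' < R km then M ta (k' * (D + 1) + e) = h k' (k' + e) else h k' (k' + e) = n + 1"
    if "k0 \<le> k'" "e \<le> D" "k' + e < i \<or> (k' + e = i \<and> k' < k)" for k' e
    using tb that unfolding tab_def by blast
  show ?thesis
  proof (cases "lim' < v")
    case True
    then have hk: "h k i = n + 1"
      using h by simp
    show ?thesis
    proof (cases "k < R km")
      case False
      have "tab h k0 D (n + 1) (R km) ((M ta)(k * (D + 1) + (i - k) := M ta (k * (D + 1) + (i - k)))) i (k + 1)"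
        by (rule key[OF tbr]) (use False hk in auto)
      then have "tab h k0 D (n + 1) (R km) (M ta) i (k + 1)"
        by simp
      then have "Q (R(76 := 0)) M U T'" if "T' \<le> T + 50" for T'
        by (intro K) (use that R KX in auto)
      then show ?thesis
        unfolding store_cell_def tidx_def using True False R w16 by simp
    next
      case kl: True
      have idx: "k * (D + 1) + (i - k) < L"
        by (rule index_less[OF D1(2) _ KX(1)]) (use kl KX in simp)
      then have idx': "k * (D + 1) + (i - k) < 2 ^ w" "k * (D + 1) < 2 ^ w"
        using L16 by linarith+
      have "tab h k0 D (n + 1) (R km) ((M ta)(k * (D + 1) + (i - k) := n + 1)) i (k + 1)"
        by (rule key[OF tbr]) (use kl hk in auto)
      then have "Q R (M(ta := (M ta)(k * (D + 1) + (i - k) := n + 1))) U T'" if "T' \<le> T + 50" for T'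
        by (intro K) (use that R KX in auto)
      then show ?thesis
        unfolding store_cell_def tidx_def using True kl R w16 ta ki idx idx' nw' by simp
    qed
  next
    case False
    then have hk: "h k i = v" "v \<le> n"
      using h ki by simp_all
    then have kX: "k < KX"
      using h(2) by simp
    have idx: "k * (D + 1) + (i - k) < L"
      by (rule index_less[OF D1(2) kX KX(1)])
    then have idx': "k * (D + 1) + (i - k) < 2 ^ w" "k * (D + 1) < 2 ^ w"
      using L16 by linarith+
    have "wp (add_columns ta km) (wp (St ta (tidx 65 64) (V 71)) Q) R M U T1" if T1: "T1 \<le> T + 10" for T1
    proof (rule wp_add_columns[where D = D and k = k and KX = KX], goal_cases)
      case (9 R3 M3 T3)
      have R3: "R3 0 = n" "R3 61 = D + 1" "R3 65 = k" "R3 64 = i" "R3 71 = v"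
        using 9(1) R by simp_all
      have "tab h k0 D (n + 1) (R3 km) ((M3 ta)(k * (D + 1) + (i - k) := v)) i (k + 1)"
      proof (rule key)
        fix k' e assume a: "k0 \<le> k'" "e \<le> D" "k' + e < i \<or> (k' + e = i \<and> k' < k)"
        show "if k' < R3 km then M3 ta (k' * (D + 1) + e) = h k' (k' + e) else h k' (k' + e) = n + 1"
          using tbr[OF a] 9(3) 9(4)[OF a(2), of k'] by (auto split: if_splits)
      qed (use hk 9(3) in auto)
      then have "Q R3 (M3(ta := (M3 ta)(k * (D + 1) + (i - k) := v))) U T'" if "T' \<le> T3 + 30" for T'
        by (intro K) (use that 9 T1 kX KX in auto)
      then show ?case
        unfolding tidx_def using R3 w16 ta ki idx idx' nw' by simp
    qed (use R ta kX KX in auto)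
    then show ?thesis
      unfolding store_cell_def using False R w16 by simp
  qed
qed


text \<open>Registers \<open>71\<close>, \<open>74\<close> and \<open>75\<close> receive
  \<open>v0\<close>, \<open>u\<close> and \<open>p\<close> of \<open>H_eq\<close>, and
  \<open>73\<close> the limit \<open>min (k + D) lm\<close>. Entries in missing columns are taken as
  infinite.\<close>

definition prep_cell :: "nat \<Rightarrow> nat \<Rightarrow> ex \<Rightarrow> nat \<Rightarrow> com" where
  "prep_cell ta km k0e lr = (71 :=! V 70 ;;
     If ((V 65 <! V km) &! (V 65 <! V 64))
       (72 :=! Ld ta (V 65 *! V 61 +! (V 64 -! N 1 -! V 65)) ;; If (V 72 <! V 71) (71 :=! V 72) (72 :=! N 0))
       (72 :=! N 0) ;;
     73 :=! V 65 +! V 60 ;; If (V lr <! V 73) (73 :=! V lr) (72 :=! N 0) ;;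
     74 :=! V 73 +! N 1 ;; If (V 71 <! V 74) (74 :=! V 71) (72 :=! N 0) ;;
     75 :=! V 0 +! N 1 ;;
     If ((k0e <! V 65) &! (V 65 <! V km +! N 1)) (75 :=! Ld ta ((V 65 -! N 1) *! V 61 +! (V 64 -! V 65))) (72 :=! N 0))"

lemma wp_prep_cell:
  assumes R: "R 0 = n" "R 60 = D" "R 61 = D + 1" "R 65 = k" "R 64 = i" "R 70 = J'" "R lr = lm"
    and reg: "km \<notin> {71..75}" "lr \<notin> {71..75}" and ta: "ta < 16"
    and ki: "k0 \<le> k" "k \<le> i" "i \<le> k + D" "i \<le> n" "lm \<le> n" "J' \<le> n + 1" "D \<le> 2 * n"
    and k0e: "k0e = N k0 \<and> k0 = 0 \<or> k0e = V 1 \<and> R 1 = k0"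
    and KX: "KX * (D + 1) \<le> L" "KX \<le> L" "R km \<le> KX"
    and tb: "tab h k0 D (n + 1) (R km) (M ta) i k"
    and K: "\<And>R' T'. same {71..75} R' R \<Longrightarrow>
      R' 71 = (if k < i then min J' (h k (i - 1)) else J') \<Longrightarrow> R' 73 = min (k + D) lm \<Longrightarrow>
      R' 74 = min (R' 71) (Suc (min (k + D) lm)) \<Longrightarrow>
      R' 75 = (if 0 < i \<and> k0 < k then h (k - 1) (i - 1) else Suc n) \<Longrightarrow> T' \<le> T + 200 \<Longrightarrow> Q R' M U T'"
  shows "wp (prep_cell ta km k0e lr) Q R M U T"
proof -
  have g1: "k < R km \<Longrightarrow> M ta (k * (D + 1) + (i - 1 - k)) = h k (i - 1)"
    "R km \<le> k \<Longrightarrow> h k (i - 1) = n + 1" if "k < i"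
    using tab_get[OF tb ki(1), of "i - 1"] that ki by auto
  have g2: "k - 1 < R km \<Longrightarrow> M ta ((k - 1) * (D + 1) + (i - k)) = h (k - 1) (i - 1)"
    "R km \<le> k - 1 \<Longrightarrow> h (k - 1) (i - 1) = n + 1" if "k0 < k"
    using tab_get[OF tb, of "k - 1" "i - 1"] that ki by auto
  have i1: "k < i \<Longrightarrow> k * (D + 1) + (i - 1 - k) < L" if "k < R km"
    by (rule index_less[OF _ _ KX(1)]) (use that ki KX in auto)
  have i2: "(k - 1) * (D + 1) + (i - k) < L" if "k - 1 < R km"
    by (rule index_less[OF _ _ KX(1)]) (use that ki KX in auto)
  have bd: "L < 2 ^ w" "k + D < 2 ^ w" "i < 2 ^ w" "R km + 1 < 2 ^ w" "k < 2 ^ w" "n + 1 < 2 ^ w"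
    using L16 w16 KX ki nw' by linarith+
  define v0 where "v0 = (if k < i then min J' (h k (i - 1)) else J')"
  define p where "p = (if 0 < i \<and> k0 < k then h (k - 1) (i - 1) else n + 1)"
  have v0: "v0 = (if k < R km \<and> k < i then min J' (M ta (k * (D + 1) + (i - 1 - k))) else J')"
    using g1 ki by (auto simp: v0_def)
  have p: "p = (if k0 < k \<and> k < R km + 1 then M ta ((k - 1) * (D + 1) + (i - k)) else n + 1)"
    using g2 ki by (auto simp: p_def)
  have m1: "k * (D + 1) < 2 ^ w \<and> k * (D + 1) + (i - 1 - k) < 2 ^ w" if "k < R km" "k < i"
    using i1[OF that] bd by linarith
  have m2: "(k - 1) * (D + 1) < 2 ^ w \<and> (k - 1) * (D + 1) + (i - k) < 2 ^ w" if "k0 < k" "k < R km + 1"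
    using i2 that bd by linarith
  have ek0: "ev R' M k0e = k0" "ok R' M k0e" "sz k0e = 1" if "R' 1 = R 1" for R'
    using k0e that w16 by auto
  have fin: "Q R' M U T'" if "same {71..75} R' R" "R' 71 = v0" "R' 73 = min (k + D) lm"
      "R' 74 = min v0 (min (k + D) lm + 1)" "R' 75 = p" "T' \<le> T + 200" for R' T'
    by (rule K) (use that in \<open>auto simp: v0_def p_def Suc_eq_plus1\<close>)
  have last: "wp (75 :=! V 0 +! N 1 ;;
     If ((k0e <! V 65) &! (V 65 <! V km +! N 1)) (75 :=! Ld ta ((V 65 -! N 1) *! V 61 +! (V 64 -! V 65))) (72 :=! N 0)) Q R1 M U T1"
    if R1: "same {71..74} R1 R" "R1 71 = v0" "R1 73 = min (k + D) lm"
      "R1 74 = min v0 (min (k + D) lm + 1)" and T1: "T1 \<le> T + 120" for R1 T1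
  proof -
    have R1': "R1 0 = n" "R1 61 = D + 1" "R1 65 = k" "R1 64 = i" "R1 km = R km" "R1 1 = R 1"
      using R1 R reg by auto
    note e = ek0[of "R1(75 := n + 1)"]
    show ?thesis
    proof (cases "k0 < k \<and> k < R km + 1")
      case True
      have "Q (R1(75 := p)) M U T'" if "T' \<le> T1 + 60" for T'
        by (rule fin) (use R1 that T1 in auto)
      moreover have "k - 1 < R km"
        using True by linarith
      then have "(k - 1) * (D + 1) + (i - k) < L"
        by (rule i2)
      ultimately show ?thesis
        using True p R1' e m2 bd w16 ta ki reg by auto
    next
      case False
      have "Q (R1(75 := n + 1, 72 := 0)) M U T'" if "T' \<le> T1 + 60" for T'
        by (rule fin) (use R1 that T1 p False in auto)
      then show ?thesis
        using False R1' e bd w16 reg by auto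
    qed
  qed
  have mid: "wp (73 :=! V 65 +! V 60 ;; If (V lr <! V 73) (73 :=! V lr) (72 :=! N 0) ;;
     74 :=! V 73 +! N 1 ;; If (V 71 <! V 74) (74 :=! V 71) (72 :=! N 0) ;; 75 :=! V 0 +! N 1 ;;
     If ((k0e <! V 65) &! (V 65 <! V km +! N 1)) (75 :=! Ld ta ((V 65 -! N 1) *! V 61 +! (V 64 -! V 65))) (72 :=! N 0)) Q R1 M U T1"
    if R1: "same {71, 72} R1 R" "R1 71 = v0" and T1: "T1 \<le> T + 60" for R1 T1
  proof -
    have R1': "R1 0 = n" "R1 60 = D" "R1 65 = k" "R1 64 = i" "R1 lr = lm"
      using R1 R reg by auto
    define R5 where "R5 a b = R1(73 := min (k + D) lm, 72 := a, 74 := min v0 (min (k + D) lm + 1), 72 := b)" for a b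
    have l: "wp (75 :=! V 0 +! N 1 ;;
     If ((k0e <! V 65) &! (V 65 <! V km +! N 1)) (75 :=! Ld ta ((V 65 -! N 1) *! V 61 +! (V 64 -! V 65))) (72 :=! N 0)) Q R' M U T'"
      if "same {71..74} R' R1" "R' 71 = v0" "R' 73 = min (k + D) lm" "R' 74 = min v0 (min (k + D) lm + 1)"
        "T' \<le> T1 + 60" for R' T'
      by (rule last) (use that R1 T1 in auto)
    have "min (k + D) lm + 1 < 2 ^ w"
      using bd ki by auto
    then show ?thesis
      unfolding wp.simps(4)[of "73 :=! V 65 +! V 60"] wp.simps(4)[of "If (V lr <! V 73) (73 :=! V lr) (72 :=! N 0)"]
        wp.simps(4)[of "74 :=! V 73 +! N 1"] wp.simps(4)[of "If (V 71 <! V 74) (74 :=! V 71) (72 :=! N 0)"]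
      using R1' R1(2) bd w16 reg
      by (cases "lm < k + D"; cases "v0 < min (k + D) lm + 1")
        (auto simp del: wp.simps(4) simp: min_def intro!: l)
  qed
  show ?thesis
  proof (cases "k < R km \<and> k < i")
    case False
    have "wp (73 :=! V 65 +! V 60 ;; If (V lr <! V 73) (73 :=! V lr) (72 :=! N 0) ;;
     74 :=! V 73 +! N 1 ;; If (V 71 <! V 74) (74 :=! V 71) (72 :=! N 0) ;; 75 :=! V 0 +! N 1 ;;
     If ((k0e <! V 65) &! (V 65 <! V km +! N 1)) (75 :=! Ld ta ((V 65 -! N 1) *! V 61 +! (V 64 -! V 65))) (72 :=! N 0)) Q
     (R(71 := J', 72 := 0)) M U T1" if "T1 \<le> T + 60" for T1
      by (rule mid) (use v0 False that in auto)
    then show ?thesis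
      unfolding prep_cell_def wp.simps(4)[of "71 :=! V 70"] wp.simps(4)[of "If ((V 65 <! V km) &! (V 65 <! V 64))
       (72 :=! Ld ta (V 65 *! V 61 +! (V 64 -! N 1 -! V 65)) ;; If (V 72 <! V 71) (71 :=! V 72) (72 :=! N 0)) (72 :=! N 0)"]
      using False R bd w16 reg by (auto simp del: wp.simps(4))
  next
    case True
    define x where "x = M ta (k * (D + 1) + (i - 1 - k))"
    have x: "v0 = min J' x"
      using v0 True by (simp add: x_def)
    have m: "wp (73 :=! V 65 +! V 60 ;; If (V lr <! V 73) (73 :=! V lr) (72 :=! N 0) ;;
     74 :=! V 73 +! N 1 ;; If (V 71 <! V 74) (74 :=! V 71) (72 :=! N 0) ;; 75 :=! V 0 +! N 1 ;;
     If ((k0e <! V 65) &! (V 65 <! V km +! N 1)) (75 :=! Ld ta ((V 65 -! N 1) *! V 61 +! (V 64 -! V 65))) (72 :=! N 0)) Q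
     R' M U T1" if "same {71, 72} R' R" "R' 71 = v0" "T1 \<le> T + 60" for R' T1
      by (rule mid) (use that in auto)
    have xe: "M ta (k * (D + 1) + i - (1 + k)) = x" "k * (D + 1) + i - (1 + k) < L"
      "k * (D + 1) + i - (1 + k) < 2 ^ w" "k * (D + 1) < 2 ^ w"
      using True x_def i1 m1 by simp_all
    have km: "km \<noteq> 71" "km \<noteq> 72" "k \<le> i - 1"
      using reg True by auto
    show ?thesis
      unfolding prep_cell_def wp.simps(4)[of "71 :=! V 70"] wp.simps(4)[of "If ((V 65 <! V km) &! (V 65 <! V 64))
       (72 :=! Ld ta (V 65 *! V 61 +! (V 64 -! N 1 -! V 65)) ;; If (V 72 <! V 71) (71 :=! V 72) (72 :=! N 0)) (72 :=! N 0)"]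
    proof (cases "x < J'")
      case xJ: True
      have "wp (73 :=! V 65 +! V 60 ;; If (V lr <! V 73) (73 :=! V lr) (72 :=! N 0) ;;
       74 :=! V 73 +! N 1 ;; If (V 71 <! V 74) (74 :=! V 71) (72 :=! N 0) ;; 75 :=! V 0 +! N 1 ;;
       If ((k0e <! V 65) &! (V 65 <! V km +! N 1)) (75 :=! Ld ta ((V 65 -! N 1) *! V 61 +! (V 64 -! V 65))) (72 :=! N 0)) Q
       (R(72 := x, 71 := x)) M U T1" if "T1 \<le> T + 60" for T1
        by (rule m) (use xJ x that in auto)
      then show "wp (71 :=! V 70) (wp (If ((V 65 <! V km) &! (V 65 <! V 64))
       (72 :=! Ld ta (V 65 *! V 61 +! (V 64 -! N 1 -! V 65)) ;; If (V 72 <! V 71) (71 :=! V 72) (72 :=! N 0)) (72 :=! N 0))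
       (wp (73 :=! V 65 +! V 60 ;; If (V lr <! V 73) (73 :=! V lr) (72 :=! N 0) ;;
       74 :=! V 73 +! N 1 ;; If (V 71 <! V 74) (74 :=! V 71) (72 :=! N 0) ;; 75 :=! V 0 +! N 1 ;;
       If ((k0e <! V 65) &! (V 65 <! V km +! N 1)) (75 :=! Ld ta ((V 65 -! N 1) *! V 61 +! (V 64 -! V 65))) (72 :=! N 0)) Q)) R M U T"
        using xJ True R bd w16 xe km ta
        by (simp del: wp.simps(4) add: wp.simps(4)[of "72 :=! Ld _ _"] fun_upd_twist[of 71 72])
    next
      case xJ: False
      have "wp (73 :=! V 65 +! V 60 ;; If (V lr <! V 73) (73 :=! V lr) (72 :=! N 0) ;;
       74 :=! V 73 +! N 1 ;; If (V 71 <! V 74) (74 :=! V 71) (72 :=! N 0) ;; 75 :=! V 0 +! N 1 ;;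
       If ((k0e <! V 65) &! (V 65 <! V km +! N 1)) (75 :=! Ld ta ((V 65 -! N 1) *! V 61 +! (V 64 -! V 65))) (72 :=! N 0)) Q
       (R(71 := J', 72 := 0)) M U T1" if "T1 \<le> T + 60" for T1
        by (rule m) (use xJ x that in auto)
      then show "wp (71 :=! V 70) (wp (If ((V 65 <! V km) &! (V 65 <! V 64))
       (72 :=! Ld ta (V 65 *! V 61 +! (V 64 -! N 1 -! V 65)) ;; If (V 72 <! V 71) (71 :=! V 72) (72 :=! N 0)) (72 :=! N 0))
       (wp (73 :=! V 65 +! V 60 ;; If (V lr <! V 73) (73 :=! V lr) (72 :=! N 0) ;;
       74 :=! V 73 +! N 1 ;; If (V 71 <! V 74) (74 :=! V 71) (72 :=! N 0) ;; 75 :=! V 0 +! N 1 ;;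
       If ((k0e <! V 65) &! (V 65 <! V km +! N 1)) (75 :=! Ld ta ((V 65 -! N 1) *! V 61 +! (V 64 -! V 65))) (72 :=! N 0)) Q)) R M U T"
        using xJ True R bd w16 xe km ta
        by (simp del: wp.simps(4) add: wp.simps(4)[of "72 :=! Ld _ _"])
    qed
  qed
qed

end

section \<open>One row of a table in time proportional to its width\<close>

context lcs
begin

definition cell :: "nat \<Rightarrow> nat \<Rightarrow> ex \<Rightarrow> nat \<Rightarrow> com \<Rightarrow> com" where
  "cell ta km k0e lr jc = (jc ;; prep_cell ta km k0e lr ;; scan_match ;;
     If (V 75 +! N 1 <! V 74) (71 :=! V 75 +! N 1) (72 :=! N 0) ;; store_cell ta km)"

definition row :: "nat \<Rightarrow> nat \<Rightarrow> ex \<Rightarrow> nat \<Rightarrow> com \<Rightarrow> com" where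
  "row ta km k0e lr jc = (65 :=! k0e ;; If (V 65 +! V 60 <! V 64) (65 :=! V 64 -! V 60) (72 :=! N 0) ;;
     Wh (V 65 <! V 64 +! N 1) (cell ta km k0e lr jc ;; 65 :=! V 65 +! N 1))"

text \<open>The base value comes from an arbitrary program \<open>jc\<close>, so both tables share
  this row. Apart from the creation of columns, accounted for by the potential \<open>R km\<close>,
  the row takes \<open>O(D + 1)\<close> steps although a single scan may be long.\<close>

lemma wp_row:
  assumes ch: "chain A B n k0 c J" and h: "h = chain.H n c D lm" and J: "\<And>k i. J k i \<le> n + 1"
    and R: "R 0 = n" "R 6 = 2 + n" "R 60 = D" "R 61 = D + 1" "R 64 = i" "R lr = lm"
    and reg: "km \<notin> {0, 1, 6, 60, 61, 64} \<union> {65..79}" "lr \<notin> {65..79}" "lr \<noteq> km" and ta: "ta < 16"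
    and ki: "i \<le> n" "lm \<le> n" "D \<le> 2 * n" "k0 \<le> n"
    and k0e: "k0e = N k0 \<and> k0 = 0 \<or> k0e = V 1 \<and> R 1 = k0"
    and hX: "\<And>k. h k i \<le> n \<Longrightarrow> k < KX" and KX: "KX * (D + 1) \<le> L" "KX \<le> L" "R km \<le> KX"
    and tb: "tab h k0 D (n + 1) (R km) (M ta) i 0"
    and jc: "\<And>R1 M1 U1 T1 Q1. same (insert km {65..79}) R1 R \<Longrightarrow> same2 {ta} M1 M \<Longrightarrow> k0 \<le> R1 65 \<Longrightarrow>
      R1 65 \<le> i \<Longrightarrow> i \<le> R1 65 + D \<Longrightarrow>
      (\<And>R2 T2. same {70, 77, 78, 79} R2 R1 \<Longrightarrow> R2 70 = J (R1 65) i \<or>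
        (R2 70 = Suc n \<and> (R1 65 + D < J (R1 65) i \<or> lm < J (R1 65) i)) \<Longrightarrow> T2 \<le> T1 + 150 \<Longrightarrow> Q1 R2 M1 U1 T2) \<Longrightarrow>
      wp jc Q1 R1 M1 U1 T1"
    and K: "\<And>R' M' T'. same (insert km {65..79}) R' R \<Longrightarrow> same2 {ta} M' M \<Longrightarrow> R km \<le> R' km \<Longrightarrow> R' km \<le> KX \<Longrightarrow>
      tab h k0 D (n + 1) (R' km) (M' ta) (i + 1) 0 \<Longrightarrow>
      T' + 100 * (D + 1) * R km \<le> T + 2000 * (D + 1) + 100 * (D + 1) * R' km \<Longrightarrow> Q R' M' U T'"
  shows "wp (row ta km k0e lr jc) Q R M U T"
proof -
  interpret c: chain A B n k0 c J
    by (rule ch)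
  define klo where "klo = max k0 (i - D)"
  \<comment> \<open>A scan of column \<open>k\<close> that moves at all starts at or behind
    \<open>Z k\<close> and ends at or before \<open>Z (k + 1)\<close>, because it gives up at the
    entry of column \<open>k\<close> in the previous row, where the scan of column
    \<open>k + 1\<close> starts. The lengths of the scans therefore telescope, and the cap
    \<open>k + D\<close> keeps their sum below \<open>2 * D + 3\<close>.\<close>
  define Z where "Z k = (if k = k0 then k0 else min (c.G (k - 1) (i - 1)) (k + D))" for k
  have Z_mono: "Z k \<le> Z (k + 1)" if "k0 \<le> k" for k
  proof (cases "k = k0")
    case True
    then show ?thesis
      using c.G_ge[of k0 "i - 1"] ki by (simp add: Z_def)
  next
    case False
    then show ?thesis
      using c.G_pred[of k "i - 1"] that by (auto simp: Z_def)
  qed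
  have Zlo: "klo \<le> Z klo + 1"
  proof (cases "klo = k0")
    case False
    have "klo - 1 \<le> c.G (klo - 1) (i - 1)"
      by (rule c.G_ge) (use ki in \<open>simp add: klo_def\<close>)
    then have "klo \<le> c.G (klo - 1) (i - 1) + 1"
      by linarith
    then show ?thesis
      using False by (simp add: Z_def)
  qed (simp add: Z_def)
  have klo: "k0 \<le> klo" "i \<le> klo + D" "klo \<le> n"
    using ki by (auto simp: klo_def)
  have Zhi: "Z k \<le> klo + 2 * D + 1" if "k \<le> i + 1" "klo \<le> k" for k
    using that klo by (auto simp: Z_def)
  have hle: "h k j \<le> n + 1" for k j
    unfolding h c.H_def using c.G_le_Suc[of k j] by simp
  define I where "I = (\<lambda>R' M' U' T'. same (insert km {65..79}) R' R \<and> same2 {ta} M' M \<and> U' = U \<and>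
    R km \<le> R' km \<and> R' km \<le> KX \<and> klo \<le> R' 65 \<and> (R' 65 \<le> i + 1 \<or> R' 65 = klo) \<and>
    tab h k0 D (n + 1) (R' km) (M' ta) i (R' 65) \<and>
    T' + 60 * Z klo + 100 * (D + 1) * R km + 700 * klo \<le> T + 50 + 60 * Z (R' 65) + 100 * (D + 1) * R' km + 700 * R' 65)"
  have loop: "wp (Wh (V 65 <! V 64 +! N 1) (cell ta km k0e lr jc ;; 65 :=! V 65 +! N 1)) Q R0 M U T0"
    if R0: "same {65, 72} R0 R" "R0 65 = klo" and T0: "T0 \<le> T + 40" for R0 T0
  proof (rule wp_while[where I = I and f = "\<lambda>R' M'. i + 1 - R' 65"], goal_cases)
    case 1
    have "tab h k0 D (n + 1) (R km) (M ta) i klo"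
      using tb unfolding tab_def klo_def by auto
    moreover have "R0 km = R km"
      using R0 reg by auto
    ultimately show ?case
      unfolding I_def using R0 T0 KX by auto
  next
    case (2 R' M' U' T')
    then have s: "same (insert km {65..79}) R' R" and s2: "same2 {ta} M' M" and U: "U' = U"
      and km: "R km \<le> R' km" "R' km \<le> KX" and k: "klo \<le> R' 65" "R' 65 \<le> i + 1 \<or> R' 65 = klo"
      and tb': "tab h k0 D (n + 1) (R' km) (M' ta) i (R' 65)"
      and T: "T' + 60 * Z klo + 100 * (D + 1) * R km + 700 * klo \<le> T + 50 + 60 * Z (R' 65) + 100 * (D + 1) * R' km + 700 * R' 65"
      unfolding I_def by blast+
    have R': "R' 0 = n" "R' 6 = 2 + n" "R' 60 = D" "R' 61 = D + 1" "R' 64 = i" "R' lr = lm" "R' 1 = R 1"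
      using s R reg by auto
    have iw: "i + 1 < 2 ^ w"
      using ki nw' by linarith
    show ?case
    proof (cases "R' 65 < i + 1")
      case False
      have tb2: "tab h k0 D (n + 1) (R' km) (M' ta) (i + 1) 0"
        using tb' False unfolding tab_def by (auto simp: less_Suc_eq Suc_eq_plus1[symmetric])
      have "Z (R' 65) \<le> klo + 2 * D + 1 \<and> R' 65 \<le> klo + D + 1"
      proof (cases "R' 65 \<le> i + 1")
        case True
        then show ?thesis
          using Zhi[OF True k(1)] klo by auto
      next
        case False
        then have "R' 65 = klo"
          using k by auto
        then show ?thesis
          using ki by (auto simp: Z_def)
      qed
      moreover have "t + X + 10 \<le> T + (2000 * D + 2000) + Y"
        if "t + 60 * z + X + 700 * l \<le> T + 50 + 60 * z' + Y + 700 * k" "l \<le> z + 1"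
          "z' \<le> l + 2 * D + 1" "k \<le> l + D + 1" for t z z' X Y l k :: nat
        using that by linarith
      note this[OF T Zlo]
      ultimately have "T' + 100 * (D + 1) * R km + 10 \<le> T + (2000 * D + 2000) + 100 * (D + 1) * R' km"
        by blast
      also have "2000 * D + 2000 = 2000 * (D + 1)"
        by simp
      finally have "T' + 100 * (D + 1) * R km + 10 \<le> T + 2000 * (D + 1) + 100 * (D + 1) * R' km" .
      then have "Q R' M' U T''" if "T'' \<le> T' + 10" for T''
        by (intro K[OF s s2 km tb2]) (use that in linarith)
      then show ?thesis
        using False R' U iw w16 by simp
    next
      case True
      define k where "k = R' 65"
      have kk: "k0 \<le> k" "k \<le> i" "i \<le> k + D" "klo \<le> k"
        using True k klo by (auto simp: k_def)
      have kd: "R' 65 = k"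
        by (simp add: k_def)
      have "wp (cell ta km k0e lr jc) (wp (65 :=! V 65 +! N 1) (\<lambda>R'' M'' U'' T''. I R'' M'' U'' (T'' + 2) \<and>
          i + 1 - R'' 65 < i + 1 - R' 65)) R' M' U T1" if T1: "T1 \<le> T' + 10" for T1
        unfolding cell_def wp.simps(4)
      proof (rule jc, goal_cases)
        case (6 R2 T2)
        note a = 6
        have R2: "R2 0 = n" "R2 6 = 2 + n" "R2 60 = D" "R2 61 = D + 1" "R2 64 = i" "R2 lr = lm" "R2 1 = R 1"
          "R2 65 = k" "R2 km = R' km"
          using a(1) R' reg by (auto simp: k_def)
        have J': "R2 70 = J k i \<or> (R2 70 = Suc n \<and> (k + D < J k i \<or> lm < J k i))"
          using a(2) by (simp add: k_def)
        have J1: "R2 70 \<le> n + 1"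
          using J' J[of k i] by auto
        show ?case
        proof (rule wp_prep_cell[where D = D and k = k and i = i and J' = "R2 70" and lm = lm and ?k0.0 = k0 and h = h and KX = KX], goal_cases)
          case (23 R3 T3)
          note b = 23
          have R3: "R3 0 = n" "R3 6 = 2 + n" "R3 60 = D" "R3 61 = D + 1" "R3 64 = i" "R3 65 = k" "R3 km = R' km"
            using b(1) R2 reg by auto
          define p where "p = R3 75"
          define u where "u = R3 74"
          define v0 where "v0 = R3 71"
          have pn: "p \<le> n + 1"
            using b(5) hle by (simp add: p_def)
          have un: "u \<le> n + 1"
            using b(4) ki(2) by (auto simp: u_def)
          \<comment> \<open>Row \<open>0\<close> has no character of \<open>A\<close> to look for.
            There \<open>p\<close> is infinite, and the scan stops at once.\<close>
          have i1: "1 \<le> i \<or> u \<le> p + 1"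
            using b(5) un by (auto simp: p_def)
          show ?case
          proof (rule wp_scan_match[where i = i and p = p and u = u], goal_cases)
            case (9 R4 T4)
            note d = 9
            have R4: "R4 0 = n" "R4 6 = 2 + n" "R4 60 = D" "R4 61 = D + 1" "R4 64 = i" "R4 65 = k"
              "R4 km = R' km" "R4 71 = v0" "R4 73 = min (k + D) lm" "R4 74 = u"
              using d(1) R3 b(3) reg by (auto simp: v0_def u_def)
            define v where "v = (if R4 75 + 1 < u then R4 75 + 1 else v0)"
            have heq: "h k i = (if v \<le> k + D \<and> v \<le> lm then v else Suc n)"
              unfolding h
            proof (rule c.H_eq[of i lm "R2 70" k D v0 p u "R4 75" v])
              show "v0 = (if k < i then min (R2 70) (c.H D lm k (i - 1)) else R2 70)"
                using b(2) by (simp add: v0_def h)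
              show "p = (if 0 < i \<and> k0 < k then c.H D lm (k - 1) (i - 1) else Suc n)"
                using b(5) by (simp add: p_def h)
              show "u = min v0 (Suc (min (k + D) lm))"
                using b(4) by (simp add: u_def v0_def)
            qed (use ki J' d(2,4,5) in \<open>auto simp: v_def\<close>)
            \<comment> \<open>If the scan moves, then \<open>p\<close> is a genuine value of
              \<open>G\<close> and not below \<open>Z k\<close>, while \<open>u - 1\<close> is at
              most \<open>Z (k + 1)\<close>.\<close>
            have steps: "60 * R4 75 + 60 * Z k \<le> 60 * p + 60 * Z (k + 1)"
            proof (cases "R4 75 = p")
              case True
              then show ?thesis
                using Z_mono[OF kk(1)] by simp
            next
              case False
              then have qu: "p + 1 < u" "R4 75 + 1 \<le> u"
                using d(2,6) by auto
              then have k0k: "0 < i" "k0 < k" "p = h (k - 1) (i - 1)"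
                using b(5) un by (auto simp: p_def split: if_splits)
              have "p \<le> n"
                using qu un by simp
              then have "p = c.G (k - 1) (i - 1)"
                using k0k(3) by (auto simp: h c.H_def split: if_splits)
              then have "Z k \<le> p"
                using k0k by (simp add: Z_def)
              moreover have "u \<le> Z (k + 1) + 1"
              proof -
                have "u \<le> k + D + 1"
                  using b(4) by (simp add: u_def)
                moreover have "u \<le> c.G k (i - 1)"
                proof (cases "k < i")
                  case True
                  have "u \<le> h k (i - 1)" "u \<le> lm + 1"
                    using b(2,4) True by (simp_all add: u_def min_le_iff_disj)
                  then show ?thesis
                    using \<open>u \<le> k + D + 1\<close> by (auto simp: h c.H_def split: if_splits)
                next
                  case False
                  then have "c.G k (i - 1) = Suc n"
                    using c.G_triv[of k "i - 1"] kk k0k by simp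
                  then show ?thesis
                    using un by simp
                qed
                ultimately show ?thesis
                  using kk by (simp add: Z_def)
              qed
              ultimately show ?thesis
                using qu by linarith
            qed
            have T4: "T4 + 60 * Z k \<le> T' + 410 + 60 * Z (k + 1)"
              using d(7) steps b(6) a(3) T1 by linarith
            have store: "wp (store_cell ta km) (wp (65 :=! V 65 +! N 1) (\<lambda>R'' M'' U'' T''. I R'' M'' U'' (T'' + 2) \<and>
                i + 1 - R'' 65 < i + 1 - R' 65)) R5 M' U T5"
              if R5: "same {71, 72} R5 R4" "R5 71 = v" and R5': "R5 km = R' km" "R5 65 = k"
                and T5: "T5 \<le> T4 + 40" for R5 T5
            proof (rule wp_store_cell[where D = D and k = k and i = i and v = v and lim' = "min (k + D) lm"
                  and h = h and ?k0.0 = k0 and KX = KX], goal_cases)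
              case (20 R6 M6 T6)
              note e = 20
              have R6: "R6 65 = k"
                using e(1) R5' reg by auto
              have sm: "same (insert km {65..79}) (R6(65 := k + 1)) R"
                using e(1) R5(1) d(1) b(1) a(1) s by auto
              have sm2: "same2 {ta} M6 M"
                using e(2) s2 by simp
              have km6: "R km \<le> R6 km" "R6 km \<le> KX"
                using e(3,4) R5' km by auto
              have T6: "T6 + 30 + 60 * Z klo + 100 * (D + 1) * R km + 700 * klo \<le>
                 T + 50 + 60 * Z (k + 1) + 100 * (D + 1) * R6 km + 700 * (k + 1)"
                using e(6) T5 T4 T R5' by (simp add: k_def)
              have "I (R6(65 := k + 1)) M6 U T''" if "T'' \<le> T6 + 30" for T''
                unfolding I_def using sm sm2 km6 e(5) T6 that kk reg by auto
              moreover have "i + 1 - (k + 1) < i + 1 - R' 65"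
                using kk kd by simp
              ultimately show ?case
                using R6 kk iw by simp
            next
              case 14
              show ?case
                using heq by simp
            next
              case 15
              then show ?case
                by (rule hX)
            next
              case 19
              show ?case
                using tb' R5' by (simp add: kd)
            next
              case 7
              show ?case
                using reg by auto
            next
              case 18
              show ?case
                using R5' km by simp
            next
              case 13
              show ?case
                using ki by simp
            qed (use R5 R5' R4 ta kk ki KX in simp_all)
            have "R4 75 + 1 < 2 ^ w"
              using d(3) nw' by linarith
            moreover have km: "km \<noteq> 71" "km \<noteq> 72"
              using reg by auto
            have "wp (store_cell ta km) (wp (65 :=! V 65 +! N 1) (\<lambda>R'' M'' U'' T''. I R'' M'' U'' (T'' + 2) \<and>
                i + 1 - R'' 65 < i + 1 - R' 65)) (R4(71 := R4 75 + 1)) M' U T5"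
              if "R4 75 + 1 < u" "T5 \<le> T4 + 40" for T5
              by (rule store) (use that R4 km in \<open>auto simp: v_def\<close>)
            moreover have "wp (store_cell ta km) (wp (65 :=! V 65 +! N 1) (\<lambda>R'' M'' U'' T''. I R'' M'' U'' (T'' + 2) \<and>
                i + 1 - R'' 65 < i + 1 - R' 65)) (R4(72 := 0)) M' U T5"
              if "\<not> R4 75 + 1 < u" "T5 \<le> T4 + 40" for T5
              by (rule store) (use that R4 km in \<open>auto simp: v_def\<close>)
            ultimately show ?case
              using R4(10) w16 by (cases "R4 75 + 1 < u") simp_all
          qed (use R3 pn un ki i1 in \<open>auto simp: p_def u_def\<close>)
        next
          case 8
          show ?case
            using reg by auto
        next
          case 9
          show ?case
            using reg by auto
        next
          case 18
          show ?case
            using k0e R2(7) by simp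
        next
          case 21
          show ?case
            using R2 km by simp
        next
          case 22
          show ?case
            using tb' R2 by (simp add: kd)
        qed (use R2 ta kk ki J1 KX in simp_all)
      qed (use s s2 kk kd in simp_all)
      then show ?thesis
        using True R' U iw w16 by simp
    qed
  qed
  have ek0: "ev R M k0e = k0" "ok R M k0e" "sz k0e = 1"
    using k0e w16 by auto
  have bw: "k0 + D < 2 ^ w"
    using ki nw' by linarith
  show ?thesis
    unfolding row_def wp.simps(4)[of "65 :=! k0e"] wp.simps(4)[of "If (V 65 +! V 60 <! V 64) (65 :=! V 64 -! V 60) (72 :=! N 0)"]
  proof (cases "k0 + D < i")
    case True
    have "wp (Wh (V 65 <! V 64 +! N 1) (cell ta km k0e lr jc ;; 65 :=! V 65 +! N 1)) Q (R(65 := i - D)) M U T0"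
      if "T0 \<le> T + 40" for T0
      by (rule loop) (use that True in \<open>auto simp: klo_def\<close>)
    then show "wp (65 :=! k0e) (wp (If (V 65 +! V 60 <! V 64) (65 :=! V 64 -! V 60) (72 :=! N 0))
      (wp (Wh (V 65 <! V 64 +! N 1) (cell ta km k0e lr jc ;; 65 :=! V 65 +! N 1)) Q)) R M U T"
      using True ek0 bw R ki nw' w16 by (simp del: wp.simps(4))
  next
    case False
    have "wp (Wh (V 65 <! V 64 +! N 1) (cell ta km k0e lr jc ;; 65 :=! V 65 +! N 1)) Q (R(65 := k0, 72 := 0)) M U T0"
      if "T0 \<le> T + 40" for T0
      by (rule loop) (use that False in \<open>auto simp: klo_def\<close>)
    then show "wp (65 :=! k0e) (wp (If (V 65 +! V 60 <! V 64) (65 :=! V 64 -! V 60) (72 :=! N 0))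
      (wp (Wh (V 65 <! V 64 +! N 1) (cell ta km k0e lr jc ;; 65 :=! V 65 +! N 1)) Q)) R M U T"
      using False ek0 bw R ki nw' w16 by (simp del: wp.simps(4))
  qed
qed

end

section \<open>The search for the number of deletions\<close>

text \<open>The number \<open>l\<close> occurs only in the analysis. Behind \<open>la\<close> and
  \<open>lb\<close> the pattern no longer fits into \<open>A\<close> and \<open>B\<close>. The last
  assumption provides room for \<open>l + 1\<close> columns of the largest \<open>D\<close> that the
  search can reach, \<open>2 * (n - l)\<close>.\<close>

locale solvable = lcs +
  fixes l la lb :: nat
  assumes sub: "subseq P A" "subseq P B"
    and l_max: "\<And>Z. str_ic_cs A B P Z \<Longrightarrow> length Z \<le> l" and l_ex: "\<exists>Z. str_ic_cs A B P Z \<and> length Z = l"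
    and la: "la \<le> n" "\<And>s. s \<le> n \<Longrightarrow> s \<le> la \<longleftrightarrow> EE P A s \<le> n"
    and lb: "lb \<le> n" "\<And>s. s \<le> n \<Longrightarrow> s \<le> lb \<longleftrightarrow> EE P B s \<le> n"
    and Ln: "2 * n + 8 \<le> L" and Ll: "(l + 1) * (2 * (n - l) + 1) \<le> L"
begin

abbreviation "Jf \<equiv> \<lambda>k i :: nat. if k = 0 then 0 else Suc n"
abbreviation "JF \<equiv> JJ A B P"

sublocale f: chain A B n 0 "cxx A B" Jf
  by (rule chain_cxx[OF lenA lenB])

sublocale F: chain A B n r "czz A B P" JF
  using chain_czz[OF lenA lenB, of P] by (simp add: lenP)

abbreviation "hf D \<equiv> f.H D lb"
abbreviation "hF D \<equiv> F.H D n"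

lemma ln: "l \<le> n" and rl: "r \<le> l"
proof -
  obtain Z where Z: "sublist P Z" "subseq Z A" "length Z = l"
    using l_ex by (auto simp: str_ic_cs_def)
  show "l \<le> n"
    using Z lenA list_emb_length by metis
  show "r \<le> l"
    using Z lenP sublist_length_le by metis
qed

lemma czz_cs: "czz A B P k n n \<longleftrightarrow> (\<exists>Z. str_ic_cs A B P Z \<and> length Z = k)"
proof
  assume "czz A B P k n n"
  then obtain X Y where "length (X @ P @ Y) = k" "subseq (X @ P @ Y) A" "subseq (X @ P @ Y) B"
    unfolding czz_def using lenA lenB by auto
  then show "\<exists>Z. str_ic_cs A B P Z \<and> length Z = k"
    by (intro exI[of _ "X @ P @ Y"]) (simp add: str_ic_cs_def)
next
  assume "\<exists>Z. str_ic_cs A B P Z \<and> length Z = k"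
  then obtain X Y where "length (X @ P @ Y) = k" "subseq (X @ P @ Y) A" "subseq (X @ P @ Y) B"
    by (auto simp: str_ic_cs_def sublist_def)
  then show "czz A B P k n n"
    using lenA lenB by (intro czzI[of X P Y]) simp_all
qed

lemma subseq_takeD: "subseq Z (take i X) \<Longrightarrow> subseq Z X"
  by (rule subseq_order.trans) (auto intro: take_is_prefix)

lemma czz_le:
  assumes "czz A B P k i j"
  shows "k \<le> l"
proof -
  obtain X Y where "length (X @ P @ Y) = k" "subseq (X @ P @ Y) (take i A)" "subseq (X @ P @ Y) (take j B)"
    using assms unfolding czz_def by blast
  moreover from this have "str_ic_cs A B P (X @ P @ Y)"
    unfolding str_ic_cs_def by (intro conjI subseq_takeD[of _ i A] subseq_takeD[of _ j B]) simp_all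
  ultimately show ?thesis
    using l_max by blast
qed

lemma hF_le: "hF D k i \<le> n \<Longrightarrow> k < l + 1"
proof -
  assume "hF D k i \<le> n"
  then have "F.G k i \<le> n"
    by (auto simp: F.H_def split: if_splits)
  then have "czz A B P k i (F.G k i)"
    using F.G_le_iff[of "F.G k i" k i] by simp
  then show ?thesis
    using czz_le by fastforce
qed

lemma hf_le:
  assumes "hf D k i \<le> n" "i \<le> la"
  shows "k < l + 1"
proof -
  define j where "j = f.G k i"
  have j: "j \<le> n" "j \<le> lb"
    using assms(1) by (auto simp: f.H_def j_def split: if_splits)
  then have "cxx A B k i j"
    using f.G_le_iff[of j k i] by (simp add: j_def)
  then obtain X where X: "length X = k" "subseq X (take i A)" "subseq X (take j B)"
    by (auto simp: cxx_def)
  have i: "i \<le> n"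
    using assms(2) la(1) by simp
  have "win P A i n"
    using la(2)[OF i] assms(2) EE_le_iff[of n A P i] lenA by simp
  then have 1: "subseq (X @ P) (take n A)"
    by (rule subseq_win[OF X(2)])
  have "win P B j n"
    using lb(2)[OF j(1)] j(2) EE_le_iff[of n B P j] lenB by simp
  then have 2: "subseq (X @ P) (take n B)"
    by (rule subseq_win[OF X(3)])
  have "str_ic_cs A B P (X @ P)"
    using 1 2 lenA lenB by (simp add: str_ic_cs_def sublist_append_rightI)
  then have "length (X @ P) \<le> l"
    by (rule l_max)
  then show ?thesis
    using X(1) by simp
qed

lemma hF_found:
  assumes "e \<le> D" "e \<le> n"
  shows "hF D (n - e) n \<le> n \<longleftrightarrow> (\<exists>Z. str_ic_cs A B P Z \<and> length Z = n - e)"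
proof -
  have "hF D (n - e) n \<le> n \<longleftrightarrow> F.G (n - e) n \<le> n"
    using assms by (auto simp: F.H_def)
  then show ?thesis
    using F.G_le_iff[of n "n - e" n] czz_cs by simp
qed

definition jumpf :: com where
  "jumpf = If (V 65) (70 :=! V 0 +! N 1) (70 :=! N 0)"

text \<open>Besides the base value, the latest start in \<open>A\<close>, the column
  \<open>k - r\<close> and the entry of \<open>f\<close> stay in registers \<open>77\<close> to
  \<open>79\<close>. Tracing back continues from them in the table of \<open>f\<close>.\<close>

definition jumpF :: com where
  "jumpF = (70 :=! V 0 +! N 1 ;; If (Ld 6 (V 64)) (77 :=! Ld 9 (V 64) ;; 78 :=! V 65 -! V 1 ;;
     If ((V 78 <! V 62) &! (V 78 <! V 77 +! N 1))
       (79 :=! Ld 14 (V 78 *! V 61 +! (V 77 -! V 78)) ;; 70 :=! Ld 12 (V 79)) (79 :=! N 0)) (79 :=! N 0))"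

lemma wp_jumpf:
  assumes "R 0 = n" and K: "\<And>R' T'. same {70, 77, 78, 79} R' R \<Longrightarrow> R' 70 = Jf (R 65) i \<Longrightarrow> T' \<le> T + 150 \<Longrightarrow> Q R' M U T'"
  shows "wp jumpf Q R M U T"
proof -
  have "Q (R(70 := n + 1)) M U T'" if "R 65 \<noteq> 0" "T' \<le> T + 150" for T'
    by (rule K) (use that in auto)
  moreover have "Q (R(70 := 0)) M U T'" if "R 65 = 0" "T' \<le> T + 150" for T'
    by (rule K) (use that in auto)
  ultimately show ?thesis
    unfolding jumpf_def using assms(1) nw' w16 by simp
qed

definition windows_ok :: "(nat \<Rightarrow> nat \<Rightarrow> nat) \<Rightarrow> bool" where
  "windows_ok M \<longleftrightarrow> (\<forall>j\<le>n. M 6 j = of_bool (\<exists>s. EE P A s = j)) \<and>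
     (\<forall>s. EE P A s \<le> n \<longrightarrow> M 9 (EE P A s) = (GREATEST s'. EE P A s' = EE P A s)) \<and>
     (\<forall>s\<le>n + 1. M 12 s = EE P B s)"

lemma wp_jumpF:
  assumes R: "R 0 = n" "R 1 = r" "R 61 = D + 1" "R 64 = i" "R 65 = k" and ki: "r \<le> k" "i \<le> n" "i \<le> k + D" "k \<le> n"
    and KM: "R 62 \<le> l + 1" and D: "(l + 1) * (D + 1) \<le> L"
    and wo: "windows_ok M" and tb: "tab (hf D) 0 D (n + 1) (R 62) (M 14) (min i la + 1) 0"
    and K: "\<And>R' T'. same {70, 77, 78, 79} R' R \<Longrightarrow>
      R' 70 = JF k i \<or> (R' 70 = Suc n \<and> (k + D < JF k i \<or> n < JF k i)) \<Longrightarrow>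
      (R' 70 \<le> n \<Longrightarrow> EE P A (R' 77) = i \<and> R' 78 = k - r \<and> R' 79 = hf D (k - r) (R' 77) \<and> R' 79 \<le> n \<and>
         EE P B (R' 79) = R' 70 \<and> R' 78 \<le> R' 77) \<Longrightarrow> T' \<le> T + 150 \<Longrightarrow> Q R' M U T'"
  shows "wp jumpF Q R M U T"
proof (cases "\<exists>s. EE P A s = i")
  case False
  then have M6: "M 6 i = 0"
    using wo ki by (simp add: windows_ok_def)
  have "JF k i = Suc n"
    using False lenA by (simp add: JJ_def)
  then have "Q (R(70 := n + 1, 79 := 0)) M U T'" if "T' \<le> T + 100" for T'
    by (intro K) (use that in auto)
  then show ?thesis
    unfolding jumpF_def using M6 R ki Ln nw' w16 by simp
next
  case True
  then obtain s0 where s0: "EE P A s0 = i"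
    by blast
  define s where "s = (GREATEST s. EE P A s = i)"
  have s: "EE P A s = i"
    unfolding s_def by (rule EE_Greatest(1)[OF s0]) (use ki lenA in simp)
  have M6: "M 6 i = 1"
    using wo ki True by (simp add: windows_ok_def)
  have "M 9 (EE P A s) = (GREATEST s'. EE P A s' = EE P A s)"
    using wo s ki unfolding windows_ok_def by blast
  then have M9: "M 9 i = s"
    by (simp only: s s_def[symmetric])
  have sr: "s + r \<le> i"
    using EE_ge[of P A s] s ki lenA lenP by simp
  \<comment> \<open>\<open>P\<close> fits behind \<open>s\<close>, so row \<open>s\<close> is among
    the rows of \<open>f\<close> that are computed.\<close>
  have sla: "s \<le> la"
    using la(2)[of s] s sr ki by simp
  define kk where "kk = k - r"
  define g where "g = f.G kk s"
  have JF: "JF k i = EE P B g"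
    using True ki lenA lenP by (simp add: JJ_def g_def kk_def s_def)
  have EBn: "EE P B (Suc n) = Suc n"
    using EE_Suc_length[of P B] lenB by simp
  \<comment> \<open>An entry of \<open>f\<close> may be missing for two reasons. If it exceeds
    \<open>lb\<close>, then \<open>P\<close> does not fit behind it in \<open>B\<close>. If it
    exceeds \<open>kk + D\<close>, then matching \<open>P\<close> adds at least
    \<open>r = k - kk\<close>, and the base value exceeds \<open>k + D\<close>. Either way the base
    value lies outside of the table of \<open>F\<close>.\<close>
  have big: "k + D < EE P B g \<or> n < EE P B g" if "hf D kk s \<noteq> g"
  proof (cases "EE P B g \<le> n")
    case True
    have "g \<le> n"
      using EE_ge[of P B g] True lenB by simp
    then have "g \<le> lb"
      using lb(2) True by simp
    then have "kk + D < g"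
      using that by (auto simp: f.H_def g_def split: if_splits)
    moreover have "g + r \<le> EE P B g"
      using EE_ge[of P B g] True lenB lenP by simp
    moreover have "kk + r = k"
      using ki by (simp add: kk_def)
    ultimately have "k + D < EE P B g"
      by linarith
    then show ?thesis ..
  qed simp
  have kkr: "kk + r = k"
    using ki by (simp add: kk_def)
  then have sD: "s \<le> kk + D" "s < min i la + 1"
    using sr sla ki by linarith+
  have hle: "hf D kk s \<le> n + 1"
    using f.G_le_Suc[of kk s] by (simp add: f.H_def)
  show ?thesis
  proof (cases "kk < R 62 \<and> kk < s + 1")
    case False
    \<comment> \<open>A missing column and a column \<open>kk > s\<close> both stand for an infinite
      entry.\<close>
    have "EE P B g = Suc n \<or> (k + D < EE P B g \<or> n < EE P B g)"
    proof (cases "hf D kk s = g")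
      case eq: True
      have "g = Suc n"
      proof (cases "kk \<le> s")
        case True
        then have "hf D kk s = n + 1"
          using tab_get(2)[OF tb _ True sD(1) disjI1[OF sD(2)]] False True by simp
        then show ?thesis
          using eq by simp
      next
        case False
        then show ?thesis
          using f.G_triv[of kk s] by (simp add: g_def)
      qed
      then show ?thesis
        using EBn by simp
    qed (use big in simp)
    then have "Q (R(70 := n + 1, 77 := s, 78 := kk, 79 := 0)) M U T'" if "T' \<le> T + 140" for T'
      by (intro K) (use that in \<open>auto simp: JF\<close>)
    then show ?thesis
      unfolding jumpF_def using False M6 M9 R ki Ln nw' w16 sr rn by (simp add: kk_def)
  next
    case ok: True
    define x where "x = M 14 (kk * (D + 1) + (s - kk))"
    have x: "x = hf D kk s"
      using tab_get(1)[OF tb _ _ sD(1) disjI1[OF sD(2)]] ok by (simp add: x_def)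
    have xn: "x \<le> n + 1"
      using hle x by simp
    have M12: "M 12 x = EE P B x"
      using wo xn unfolding windows_ok_def by blast
    have J': "EE P B x = JF k i \<or> (EE P B x = Suc n \<and> (k + D < JF k i \<or> n < JF k i))"
    proof (cases "hf D kk s = g")
      case False
      then have "x = Suc n"
        by (auto simp: x f.H_def g_def split: if_splits)
      then show ?thesis
        using big False EBn by (simp add: JF)
    qed (simp add: JF x)
    have idx: "kk * (D + 1) + (s - kk) < L"
      by (rule index_less[OF _ _ D]) (use ok KM sr ki in \<open>auto simp: kk_def\<close>)
    then have idx': "kk * (D + 1) + (s - kk) < 2 ^ w" "kk * (D + 1) < 2 ^ w"
      using L16 by linarith+
    have xE: "x \<le> n" if "EE P B x \<le> n"
      using EE_ge[of P B x] that lenB by simp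
    have "Q (R(70 := EE P B x, 77 := s, 78 := kk, 79 := x)) M U T'" if "T' \<le> T + 140" for T'
      by (rule K) (use that J' s xE x ok in \<open>auto simp: kk_def\<close>)
    then have fin: "Q (R(77 := s, 78 := kk, 79 := x, 70 := EE P B x)) M U T'" if "T' \<le> T + 140" for T'
      using that by (simp add: fun_upd_twist[of 70])
    have upd: "R(70 := a, 77 := s, 78 := kk, 79 := x, 70 := EE P B x) = R(77 := s, 78 := kk, 79 := x, 70 := EE P B x)" for a
      by (auto simp: fun_eq_iff)
    have xL: "x < L"
      using xn Ln by linarith
    have "wp (79 :=! Ld 14 (V 78 *! V 61 +! (V 77 -! V 78)) ;; 70 :=! Ld 12 (V 79)) (\<lambda>R M U T. Q R M U (4 + T))
      (R(70 := n + 1, 77 := s, 78 := kk)) M U T1" if "T1 \<le> T + 90" for T1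
    proof -
      have "s < 2 ^ w"
        using sr ki nw' by linarith
      then show ?thesis
        using R idx idx' ok xL x_def M12 fin that upd by simp
    qed
    then show ?thesis
      unfolding jumpF_def using ok M6 M9 R ki Ln nw' w16 sr rn by (simp add: kk_def del: wp.simps(4) add: wp.simps(4)[of "70 :=! _"] wp.simps(4)[of "77 :=! _"] wp.simps(4)[of "78 :=! _"])
  qed
qed


text \<open>Row \<open>i\<close> of \<open>F\<close> may use any row of \<open>f\<close> up to
  \<open>i\<close>; hence the tables are filled in turn, \<open>f\<close> first. Rows of
  \<open>f\<close> after \<open>la\<close> are omitted because \<open>P\<close> does not fit behind
  them.\<close>

definition rows :: com where
  "rows = (64 :=! N 0 ;; Wh (V 64 <! V 0 +! N 1)
     (If (V 64 <! V 8 +! N 1) (row 14 62 (N 0) 9 jumpf) (72 :=! N 0) ;; row 15 63 (V 1) 0 jumpF ;;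
      64 :=! V 64 +! N 1))"

definition base_regs :: "(nat \<Rightarrow> nat) \<Rightarrow> bool" where
  "base_regs R \<longleftrightarrow> R 0 = n \<and> R 1 = r \<and> R 5 = 2 + 2 * n \<and> R 6 = 2 + n \<and> R 8 = la \<and> R 9 = lb"

lemma wp_rows:
  assumes R: "base_regs R" "R 60 = D" "R 61 = D + 1" "R 62 = 0" "R 63 = 0" and D: "D \<le> 2 * (n - l)"
    and wo: "windows_ok M"
    and K: "\<And>R' M' T'. same {62..79} R' R \<Longrightarrow> same2 {14, 15} M' M \<Longrightarrow> R' 62 \<le> l + 1 \<Longrightarrow> R' 63 \<le> l + 1 \<Longrightarrow>
      tab (hf D) 0 D (n + 1) (R' 62) (M' 14) (la + 1) 0 \<Longrightarrow> tab (hF D) r D (n + 1) (R' 63) (M' 15) (n + 1) 0 \<Longrightarrow>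
      T' \<le> T + 5000 * (n + 1) * (D + 1) \<Longrightarrow> Q R' M' U T'"
  shows "wp rows Q R M U T"
proof -
  have Dl: "(l + 1) * (D + 1) \<le> L"
  proof -
    have "(l + 1) * (D + 1) \<le> (l + 1) * (2 * (n - l) + 1)"
      using D by (intro mult_le_mono2) simp
    then show ?thesis
      using Ll by linarith
  qed
  have l1: "l + 1 \<le> L" and D2: "D \<le> 2 * n"
    using ln Ln D by linarith+
  define I where "I = (\<lambda>R' M' U' T'. same {62..79} R' R \<and> same2 {14, 15} M' M \<and> U' = U \<and>
    R' 62 \<le> l + 1 \<and> R' 63 \<le> l + 1 \<and> R' 64 \<le> n + 1 \<and>
    tab (hf D) 0 D (n + 1) (R' 62) (M' 14) (min (R' 64) (la + 1)) 0 \<and>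
    tab (hF D) r D (n + 1) (R' 63) (M' 15) (R' 64) 0 \<and>
    T' \<le> T + 10 + 4100 * (D + 1) * R' 64 + 100 * (D + 1) * R' 62 + 100 * (D + 1) * R' 63)"
  have "wp (Wh (V 64 <! V 0 +! N 1)
     (If (V 64 <! V 8 +! N 1) (row 14 62 (N 0) 9 jumpf) (72 :=! N 0) ;; row 15 63 (V 1) 0 jumpF ;;
      64 :=! V 64 +! N 1)) Q (R(64 := 0)) M U T1" if T1: "T1 \<le> T + 10" for T1
  proof (rule wp_while[where I = I and f = "\<lambda>R' M'. n + 1 - R' 64"], goal_cases)
    case 1
    have "tab h k0 D (n + 1) 0 m 0 0" for h k0 m
      by (simp add: tab_def)
    then show ?case
      using T1 R by (simp add: I_def)
  next
    case (2 R' M' U' T')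
    then have s: "same {62..79} R' R" and s2: "same2 {14, 15} M' M" and U: "U' = U"
      and km: "R' 62 \<le> l + 1" "R' 63 \<le> l + 1" and i: "R' 64 \<le> n + 1"
      and tf: "tab (hf D) 0 D (n + 1) (R' 62) (M' 14) (min (R' 64) (la + 1)) 0"
      and tF: "tab (hF D) r D (n + 1) (R' 63) (M' 15) (R' 64) 0"
      and T: "T' \<le> T + 10 + 4100 * (D + 1) * R' 64 + 100 * (D + 1) * R' 62 + 100 * (D + 1) * R' 63"
      unfolding I_def by blast+
    have R': "R' 0 = n" "R' 1 = r" "R' 6 = 2 + n" "R' 8 = la" "R' 9 = lb" "R' 60 = D" "R' 61 = D + 1"
      using s R by (simp_all add: base_regs_def)
    show ?case
    proof (cases "R' 64 < n + 1")
      case False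
      then have e: "R' 64 = n + 1" "min (R' 64) (la + 1) = la + 1"
        using i la(1) by auto
      have "100 * (D + 1) * R' 62 \<le> 100 * (D + 1) * (n + 1)" "100 * (D + 1) * R' 63 \<le> 100 * (D + 1) * (n + 1)"
        using km ln by (intro mult_le_mono2; linarith)+
      moreover have "4300 * (D + 1) * (n + 1) =
          4100 * (D + 1) * (n + 1) + 100 * (D + 1) * (n + 1) + 100 * (D + 1) * (n + 1)"
        by (simp add: algebra_simps)
      ultimately have "T' \<le> T + 10 + 4300 * (D + 1) * (n + 1)"
        using T unfolding e by linarith
      moreover have "4300 * (D + 1) * (n + 1) + 600 \<le> 5000 * (n + 1) * (D + 1)"
        by (simp add: algebra_simps)
      ultimately have T2: "T' + 50 \<le> T + 5000 * (n + 1) * (D + 1)"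
        by linarith
      have "Q R' M' U T''" if "T'' \<le> T' + 10" for T''
        by (rule K[OF s s2 km]) (use tf tF e T2 that in auto)
      then show ?thesis
        using False R' U nw' by simp
    next
      case True
      define i where "i = R' 64"
      have ii: "i \<le> n" "R' 64 = i"
        using True by (auto simp: i_def)
      have woR: "windows_ok M1" if "same2 {14, 15} M1 M" for M1
        using wo that by (simp add: windows_ok_def)
      have rowF: "wp (row 15 63 (V 1) 0 jumpF) (wp (64 :=! V 64 +! N 1) (\<lambda>R'' M'' U'' T''. I R'' M'' U'' (T'' + 2) \<and>
          n + 1 - R'' 64 < n + 1 - R' 64)) R2 M2 U T2"
        if R2: "same (insert 62 {65..79}) R2 R'" "R2 62 \<le> l + 1" and M2: "same2 {14} M2 M'"
          and tf2: "tab (hf D) 0 D (n + 1) (R2 62) (M2 14) (min i la + 1) 0"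
          and T2: "T2 \<le> T + 60 + 4100 * (D + 1) * i + 2000 * (D + 1) + 100 * (D + 1) * R2 62 + 100 * (D + 1) * R' 63"
        for R2 M2 T2
      proof (rule wp_row[where ?k0.0 = r and c = "czz A B P" and J = JF and h = "hF D" and D = D and lm = n and i = i and KX = "l + 1"], goal_cases)
        case 3
        show ?case
          using EE_le_Suc[of P B] lenA lenB by (simp add: JJ_def Suc_eq_plus1)
      next
        case (19 k)
        then show ?case
          using hF_le by blast
      next
        case (24 R1 M1 U1 T1 Q1)
        have M1: "M1 14 = M2 14" "same2 {14, 15} M1 M"
          using 24(2) M2 s2 by simp_all
        have R1: "R1 0 = n" "R1 1 = r" "R1 61 = D + 1" "R1 64 = i" "R1 62 = R2 62"
          using 24(1) R2 R' ii by simp_all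
        show ?case
        proof (rule wp_jumpF[where D = D and i = i and k = "R1 65"], goal_cases)
          case (14 R3 T3)
          then show ?case
            using 24(6) by blast
        qed (use R1 24 ii R2 Dl woR[OF M1(2)] tf2 M1 in simp_all)
      next
        case (25 R3 M3 T3)
        have R3: "R3 64 = i" "R3 62 = R2 62" "R3 63 \<le> l + 1"
          using 25(1,4) R2 ii by simp_all
        have sm: "same {62..79} (R3(64 := i + 1)) R"
          using 25(1) R2(1) s by auto
        have sm2: "same2 {14, 15} M3 M"
          using 25(2) M2 s2 by simp
        have "M3 14 = M2 14" "min (i + 1) (la + 1) = min i la + 1"
          using 25(2) by auto
        then have tf3: "tab (hf D) 0 D (n + 1) (R3 62) (M3 14) (min (i + 1) (la + 1)) 0"
          using tf2 R3 by simp
        have "R2 63 = R' 63"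
          using R2 by simp
        then have "T3 + 40 \<le> T + 10 + 4100 * (D + 1) * (i + 1) + 100 * (D + 1) * R3 62 + 100 * (D + 1) * R3 63"
          using 25(6) T2 R3(2) by (simp add: algebra_simps)
        then have "I (R3(64 := i + 1)) M3 U T''" if "T'' \<le> T3 + 20" for T''
          unfolding I_def using sm sm2 R3 R2(2) tf3 25(5) that ii by simp
        then show ?case
          using R3 ii nw' by simp
      qed (use R2 R' ii M2 s2 tF km Dl l1 D2 rn F.chain_axioms in simp_all)
      have iw: "i < 2 ^ w" "la + 1 < 2 ^ w"
        using ii la nw' by linarith+
      show ?thesis
      proof (cases "i < la + 1")
        case False
        have tf2: "tab (hf D) 0 D (n + 1) (R' 62) (M' 14) (min i la + 1) 0"
          using tf False ii by (simp add: min_def split: if_splits)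
        have "wp (row 15 63 (V 1) 0 jumpF) (wp (64 :=! V 64 +! N 1) (\<lambda>R'' M'' U'' T''. I R'' M'' U'' (T'' + 2) \<and>
          n + 1 - R'' 64 < n + 1 - R' 64)) (R'(72 := 0)) M' U T2" if "T2 \<le> T' + 30" for T2
          by (rule rowF) (use that T tf2 km ii in auto)
        then show ?thesis
          using True False R' U nw' iw w16 ii by simp
      next
        case la1: True
        have "wp (row 14 62 (N 0) 9 jumpf) (\<lambda>R M U T. wp (row 15 63 (V 1) 0 jumpF) (wp (64 :=! V 64 +! N 1) (\<lambda>R'' M'' U'' T''. I R'' M'' U'' (T'' + 2) \<and>
          n + 1 - R'' 64 < n + 1 - R' 64)) R M U (T + 2)) R' M' U T1" if T1: "T1 \<le> T' + 20" for T1
        proof (rule wp_row[where ?k0.0 = 0 and c = "cxx A B" and J = Jf and h = "hf D" and D = D and lm = lb and i = i and KX = "l + 1"], goal_cases)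
          case (19 k)
          then show ?case
            using hf_le[of D k i] la1 by simp
        next
          case (24 R1 M1 U1 T1 Q1)
          have "R1 0 = n"
            using 24(1) R' by simp
          then show ?case
          proof (rule wp_jumpf, goal_cases)
            case (1 R3 T3)
            then show ?case
              using 24(6) by blast
          qed
        next
          case (25 R3 M3 T3)
          have "min i la + 1 = i + 1"
            using la1 by simp
          then have tf3: "tab (hf D) 0 D (n + 1) (R3 62) (M3 14) (min i la + 1) 0"
            using 25(5) by simp
          show ?case
            by (rule rowF) (use 25 tf3 T T1 ii in \<open>simp_all add: algebra_simps\<close>)
        next
          case 22
          then show ?case
            using km by simp
        next
          case 23
          then show ?case
            using tf la1 ii by (simp add: min_def split: if_splits)
        qed (use R' ii Dl l1 D2 lb f.chain_axioms in simp_all)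
        then show ?thesis
          using True la1 R' U nw' iw w16 ii by simp
      qed
    qed
  qed
  then show ?thesis
    unfolding rows_def using w16 by simp
qed

definition find_solution :: com where
  "find_solution = (82 :=! N 0 ;; 80 :=! N 0 ;;
     Wh ((V 82 =! N 0) &! ((V 80 <! V 61) &! (V 80 <! V 0 +! N 1)))
       (81 :=! V 0 -! V 80 ;;
        If ((V 81 <! V 63) &! (V 1 <! V 81 +! N 1))
          (If (Ld 15 (V 81 *! V 61 +! V 80) <! V 0 +! N 1) (82 :=! N 1) (80 :=! V 80 +! N 1))
          (80 :=! V 80 +! N 1)))"

text \<open>Column \<open>n - e\<close> of the last row lies inside the band if and only if
  \<open>e \<le> D\<close>. Since \<open>e\<close> increases, the first finite entry belongs to a
  longest solution.\<close>

lemma wp_find_solution: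
  assumes R: "R 0 = n" "R 1 = r" "R 61 = D + 1" and D: "D \<le> 2 * (n - l)" and km: "R 63 \<le> l + 1"
    and tF: "tab (hF D) r D (n + 1) (R 63) (M 15) (n + 1) 0"
    and K: "\<And>R' T'. same {80, 81, 82} R' R \<Longrightarrow>
      (R' 82 = 0 \<and> D < n - l) \<or> (R' 82 = 1 \<and> R' 81 = l \<and> n - l \<le> D) \<Longrightarrow> T' \<le> T + 200 * (D + 1) \<Longrightarrow> Q R' M U T'"
  shows "wp find_solution Q R M U T"
proof -
  have Dl: "(l + 1) * (D + 1) \<le> L"
  proof -
    have "(l + 1) * (D + 1) \<le> (l + 1) * (2 * (n - l) + 1)"
      using D by (intro mult_le_mono2) simp
    then show ?thesis
      using Ll by linarith
  qed
  define I where "I = (\<lambda>R' M' U' T'. same {80, 81, 82} R' R \<and> M' = M \<and> U' = U \<and>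
    (if R' 82 = 0 then (\<forall>e. e < R' 80 \<and> e \<le> n \<longrightarrow> \<not> hF D (n - e) n \<le> n) \<and> R' 80 \<le> D + 1
     else R' 82 = 1 \<and> R' 81 = l \<and> n - l \<le> D) \<and> (R' 80 \<le> D + 1) \<and>
    T' \<le> T + 10 + 70 * R' 80 + 70 * R' 82)"
  have fnd: "hF D (n - e) n \<le> n \<Longrightarrow> n - e \<le> l" "e = n - l \<Longrightarrow> hF D (n - e) n \<le> n" if "e \<le> D" "e \<le> n" for e
  proof -
    show "n - e \<le> l" if "hF D (n - e) n \<le> n"
      using hF_found[OF \<open>e \<le> D\<close> \<open>e \<le> n\<close>] that l_max by metis
    show "hF D (n - e) n \<le> n" if "e = n - l"
      using hF_found[OF \<open>e \<le> D\<close> \<open>e \<le> n\<close>] that l_ex ln by simp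
  qed
  have "wp (Wh ((V 82 =! N 0) &! ((V 80 <! V 61) &! (V 80 <! V 0 +! N 1)))
       (81 :=! V 0 -! V 80 ;;
        If ((V 81 <! V 63) &! (V 1 <! V 81 +! N 1))
          (If (Ld 15 (V 81 *! V 61 +! V 80) <! V 0 +! N 1) (82 :=! N 1) (80 :=! V 80 +! N 1))
          (80 :=! V 80 +! N 1))) Q (R(82 := 0, 80 := 0)) M U T1" if T1: "T1 \<le> T + 10" for T1
  proof (rule wp_while[where I = I and f = "\<lambda>R' M'. (D + 1 - R' 80) + (1 - R' 82)"], goal_cases)
    case 1
    then show ?case
      using T1 by (simp add: I_def)
  next
    case (2 R' M' U' T')
    then have s: "same {80, 81, 82} R' R" and M: "M' = M" "U' = U"
      and f: "if R' 82 = 0 then (\<forall>e. e < R' 80 \<and> e \<le> n \<longrightarrow> \<not> hF D (n - e) n \<le> n) \<and> R' 80 \<le> D + 1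
        else R' 82 = 1 \<and> R' 81 = l \<and> n - l \<le> D"
      and e: "R' 80 \<le> D + 1" and T: "T' \<le> T + 10 + 70 * R' 80 + 70 * R' 82"
      unfolding I_def by blast+
    have R': "R' 0 = n" "R' 1 = r" "R' 61 = D + 1" "R' 63 = R 63"
      using s R by simp_all
    show ?case
    proof (cases "R' 82 = 0 \<and> R' 80 < D + 1 \<and> R' 80 < n + 1")
      case False
      have r82: "R' 82 \<le> 1"
        using f by (auto split: if_splits)
      have "(R' 82 = 0 \<and> D < n - l) \<or> (R' 82 = 1 \<and> R' 81 = l \<and> n - l \<le> D)"
      proof (cases "R' 82 = 0")
        case True
        have "\<not> n - l \<le> D"
        proof
          assume "n - l \<le> D"
          then have "hF D (n - (n - l)) n \<le> n"
            using fnd(2)[of "n - l"] by simp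
          moreover have "n - l < R' 80"
            using False True e \<open>n - l \<le> D\<close> by auto
          ultimately show False
            using f True by simp
        qed
        then show ?thesis
          using True by simp
      qed (use f in auto)
      then have "Q R' M U T''" if "T'' \<le> T' + 20" for T''
        by (intro K[OF s]) (use that T e r82 in auto)
      then show ?thesis
        using False R' M nw' w16 by auto
    next
      case True
      define e where "e = R' 80"
      have ee: "R' 80 = e" "e \<le> D" "e \<le> n" "R' 82 = 0"
        using True by (auto simp: e_def)
      have prev: "\<not> hF D (n - e') n \<le> n" if "e' < e" "e' \<le> n" for e'
        using f that ee by simp
      have ew: "e + 1 < 2 ^ w" "n - e + 1 < 2 ^ w" "n < 2 ^ w" "n + 1 < 2 ^ w"
        using ee nw' by linarith+
      have next_e: "I (R'(81 := n - e, 80 := e + 1)) M U T'' \<and> D + 1 - (e + 1) < D + 1 - e"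
        if "\<not> hF D (n - e) n \<le> n" "T'' \<le> T' + 70" for T''
      proof -
        have "\<not> hF D (n - e') n \<le> n" if "e' < e + 1" "e' \<le> n" for e'
          using prev that \<open>\<not> hF D (n - e) n \<le> n\<close> by (cases "e' = e") auto
        then show ?thesis
          unfolding I_def using s T that ee by simp
      qed
      show ?thesis
      proof (cases "n - e < R 63 \<and> r < n - e + 1")
        case False
        have "\<not> hF D (n - e) n \<le> n"
        proof (cases "n - e < r")
          case True
          then show ?thesis
            using F.G_triv[of "n - e" n] by (simp add: F.H_def)
        next
          case False
          then have "R 63 \<le> n - e" "r \<le> n - e" "n \<le> n - e + D"
            using ee \<open>\<not> (n - e < R 63 \<and> r < n - e + 1)\<close> by linarith+
          then have "hF D (n - e) n = n + 1"
            using tab_get(2)[OF tF, of "n - e" n] by simp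
          then show ?thesis
            by simp
        qed
        note next_e[OF this]
        then show ?thesis
          using True False R' M ew w16 ee by auto
      next
        case ok: True
        have val: "M 15 ((n - e) * (D + 1) + e) = hF D (n - e) n"
          using tab_get(1)[OF tF, of "n - e" n] ee ok by simp
        have idx: "(n - e) * (D + 1) + e < L"
          by (rule index_less[OF _ _ Dl]) (use ok km ee in auto)
        then have idx': "(n - e) * (D + 1) + e < 2 ^ w" "(n - e) * (D + 1) < 2 ^ w"
          using L16 by linarith+
        show ?thesis
        proof (cases "hF D (n - e) n < n + 1")
          case False
          then have "\<not> hF D (n - e) n \<le> n"
            by simp
          note next_e[OF this]
          then show ?thesis
            using True False ok R' M ew w16 ee val idx idx' by simp
        next
          case fin: True
          then have "n - e \<le> l"
            using fnd(1)[of e] ee by simp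
          moreover have "\<not> n - l < e"
          proof
            assume "n - l < e"
            then have "\<not> hF D (n - (n - l)) n \<le> n"
              by (intro prev) auto
            then show False
              using fnd(2)[of "n - l"] \<open>n - l < e\<close> ee by simp
          qed
          ultimately have "e = n - l"
            by linarith
          then have "n - e = l" "n - l \<le> D"
            using ln ee by simp_all
          then have "I (R'(81 := n - e, 82 := 1)) M U T''" if "T'' \<le> T' + 70" for T''
            unfolding I_def using s T that ee by simp
          then show ?thesis
            using True fin ok R' M ew w16 ee val idx idx' by simp
        qed
      qed
    qed
  qed
  then show ?thesis
    unfolding find_solution_def using w16 by simp
qed

end

text \<open>Tracing back never leaves the table. A step up keeps column and value, and a diagonal
  step lowers the value at least as much as the column, so the limit \<open>k + D\<close> is
  respected.\<close>

lemma (in chain) H_step: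
  assumes "i \<le> n" "lm \<le> n" "H D lm k i = v" "v \<le> n"
  shows "(k < i \<and> H D lm k (i - 1) = v) \<or> J k i = v \<or>
    (k0 < k \<and> 0 < i \<and> H D lm (k - 1) (i - 1) < v \<and> B ! (v - 1) = A ! (i - 1))"
proof -
  have v: "v = G k i" "v \<le> k + D" "v \<le> lm"
    using assms by (auto simp: H_def split: if_splits)
  from G_step[OF assms(1) v(1) assms(4)] show ?thesis
  proof (elim disjE conjE)
    assume a: "0 < i" "G k (i - 1) = v"
    then have "c k (i - 1) v"
      using G_le_iff[of v k "i - 1"] assms by simp
    then have "k < i"
      using c_ge a by fastforce
    then show ?thesis
      using a v by (simp add: H_def)
  next
    assume a: "0 < i" "0 < k" "G (k - 1) (i - 1) < v" "B ! (v - 1) = A ! (i - 1)"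
    then have "c (k - 1) (i - 1) (G (k - 1) (i - 1))"
      using G_le_iff[of "G (k - 1) (i - 1)" "k - 1" "i - 1"] assms by simp
    then have "k0 < k"
      using c_ge a by fastforce
    moreover have "G (k - 1) (i - 1) \<le> k - 1 + D" "G (k - 1) (i - 1) \<le> lm"
      using a v by linarith+
    then have "H D lm (k - 1) (i - 1) = G (k - 1) (i - 1)"
      by (simp add: H_def)
    ultimately show ?thesis
      using a by simp
  qed simp
qed

lemma drop_split: "j \<le> i \<Longrightarrow> drop j X = take (i - j) (drop j X) @ drop i X"
  by (metis append_take_drop_id drop_drop le_add_diff_inverse2)

lemma subseq_drop_mono: "subseq W (drop i X) \<Longrightarrow> j \<le> i \<Longrightarrow> subseq W (drop j X)"
  by (subst drop_split[of j i X]) (simp_all only: list_emb_append2)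

lemma subseq_Cons_drop:
  assumes "subseq W (drop i X)" "0 < i" "i \<le> length X" "X ! (i - 1) = a" "j < i"
  shows "subseq (a # W) (drop j X)"
proof -
  have "drop (i - 1) X = X ! (i - 1) # drop i X"
    using assms Cons_nth_drop_Suc[of "i - 1" X] by simp
  then have "subseq (a # W) (drop (i - 1) X)"
    using assms by simp
  then show ?thesis
    by (rule subseq_drop_mono) (use assms in simp)
qed

lemma subseq_win_drop:
  assumes "win P X i0 i" "subseq W (drop i X)"
  shows "subseq (P @ W) (drop i0 X)"
proof -
  have "drop i0 X = take (i - i0) (drop i0 X) @ drop i X"
    using assms(1) by (intro drop_split) (simp add: win_def)
  moreover have "subseq P (take (i - i0) (drop i0 X))"
    using assms(1) by (simp add: win_def)
  ultimately show ?thesis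
    using list_emb_append_mono[OF _ assms(2)] by metis
qed

context solvable
begin

text \<open>\<open>D := 2 * D + 1\<close> doubles the width \<open>D + 1\<close>. The start with
  \<open>D = 0\<close> keeps the search linear when nothing has to be deleted. A round fails only
  for \<open>D < n - l\<close>, so the next \<open>D\<close> is below
  \<open>2 * (n - l)\<close>.\<close>

definition search :: com where
  "search = (60 :=! N 0 ;; 82 :=! N 0 ;; Wh (V 82 =! N 0)
     (61 :=! V 60 +! N 1 ;; 62 :=! N 0 ;; 63 :=! N 0 ;; rows ;; find_solution ;;
      If (V 82) (72 :=! N 0) (60 :=! V 60 +! V 60 +! N 1)))"

definition solved :: "nat \<Rightarrow> (nat \<Rightarrow> nat) \<Rightarrow> (nat \<Rightarrow> nat \<Rightarrow> nat) \<Rightarrow> bool" where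
  "solved D R M \<longleftrightarrow> n - l \<le> D \<and> D \<le> 2 * (n - l) \<and> R 61 = D + 1 \<and> R 81 = l \<and> R 62 \<le> l + 1 \<and> R 63 \<le> l + 1 \<and>
     tab (hf D) 0 D (n + 1) (R 62) (M 14) (la + 1) 0 \<and> tab (hF D) r D (n + 1) (R 63) (M 15) (n + 1) 0"

lemma wp_search:
  assumes R: "base_regs R" and wo: "windows_ok M"
    and K: "\<And>D R' M' T'. same {60..82} R' R \<Longrightarrow> same2 {14, 15} M' M \<Longrightarrow> solved D R' M' \<Longrightarrow>
      T' \<le> T + 6000 * (n + 1) * (4 * (n - l) + 1) + 50 \<Longrightarrow> Q R' M' U T'"
  shows "wp search Q R M U T"
proof -
  \<comment> \<open>The widths \<open>D + 1\<close> of all failed rounds add up to exactly the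
    current \<open>D\<close>. The time spent so far is therefore proportional to register
    \<open>60\<close>.\<close>
  define I where "I = (\<lambda>R' M' U' T'. same {60..82} R' R \<and> same2 {14, 15} M' M \<and> U' = U \<and>
    (if R' 82 = 0 then R' 60 \<le> 2 * (n - l) \<and> T' \<le> T + 10 + 6000 * (n + 1) * R' 60
     else \<exists>D. solved D R' M' \<and> T' \<le> T + 10 + 6000 * (n + 1) * (2 * D + 1)))"
  have "wp (Wh (V 82 =! N 0)
     (61 :=! V 60 +! N 1 ;; 62 :=! N 0 ;; 63 :=! N 0 ;; rows ;; find_solution ;;
      If (V 82) (72 :=! N 0) (60 :=! V 60 +! V 60 +! N 1))) Q (R(60 := 0, 82 := 0)) M U T1"
    if T1: "T1 \<le> T + 10" for T1
  proof (rule wp_while[where I = I and f = "\<lambda>R' M'. if R' 82 = 0 then 2 * n + 2 - R' 60 else 0"], goal_cases)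
    case 1
    then show ?case
      using T1 by (simp add: I_def)
  next
    case (2 R' M' U' T')
    then have s: "same {60..82} R' R" and s2: "same2 {14, 15} M' M" and U: "U' = U"
      and c: "if R' 82 = 0 then R' 60 \<le> 2 * (n - l) \<and> T' \<le> T + 10 + 6000 * (n + 1) * R' 60
        else \<exists>D. solved D R' M' \<and> T' \<le> T + 10 + 6000 * (n + 1) * (2 * D + 1)"
      unfolding I_def by blast+
    have R': "base_regs R'"
      using s R by (simp add: base_regs_def)
    have wo': "windows_ok M'"
      using wo s2 by (simp add: windows_ok_def)
    show ?case
    proof (cases "R' 82 = 0")
      case False
      then obtain D where D: "solved D R' M'" "T' \<le> T + 10 + 6000 * (n + 1) * (2 * D + 1)"
        using c by auto
      have "6000 * (n + 1) * (2 * D + 1) \<le> 6000 * (n + 1) * (4 * (n - l) + 1)"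
        using D(1) by (intro mult_le_mono2) (simp add: solved_def)
      then have "Q R' M' U T''" if "T'' \<le> T' + 20" for T''
        by (intro K[OF s s2 D(1)]) (use D(2) that in linarith)
      then show ?thesis
        using False U w16 by simp
    next
      case True
      define D where "D = R' 60"
      have D: "D \<le> 2 * (n - l)" "T' \<le> T + 10 + 6000 * (n + 1) * D"
        using c True by (simp_all add: D_def)
      have Dn: "D \<le> 2 * n"
        using D by linarith
      have "wp rows (wp find_solution (wp (If (V 82) (72 :=! N 0) (60 :=! V 60 +! V 60 +! N 1))
         (\<lambda>R'' M'' U'' T''. I R'' M'' U'' (T'' + 2) \<and>
          (if R'' 82 = 0 then 2 * n + 2 - R'' 60 else 0) < 2 * n + 2 - D)))
         (R'(61 := D + 1, 62 := 0, 63 := 0)) M' U T1" if T1: "T1 \<le> T' + 30" for T1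
      proof (rule wp_rows[where D = D], goal_cases)
        case (8 R2 M2 T2)
        note a = 8
        have R2: "R2 0 = n" "R2 1 = r" "R2 60 = D" "R2 61 = D + 1"
          using a(1) R' D_def by (simp_all add: base_regs_def)
        show ?case
        proof (rule wp_find_solution[where D = D], goal_cases)
          case (7 R3 T3)
          note b = 7
          have R3: "R3 60 = D" "R3 61 = D + 1" "R3 62 = R2 62" "R3 63 = R2 63"
            using b(1) R2 by simp_all
          have sm: "same {60..82} R3 R"
            using b(1) a(1) s by auto
          have sm2: "same2 {14, 15} M2 M"
            using a(2) s2 by simp
          have "5000 * (n + 1) * (D + 1) + 200 * (D + 1) + 100 \<le> 6000 * (n + 1) * (D + 1)"
            by (simp add: algebra_simps)
          then have "T3 + 70 \<le> T' + 6000 * (n + 1) * (D + 1)"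
            using b(3) a(7) T1 by linarith
          moreover have "6000 * (n + 1) * D + 6000 * (n + 1) * (D + 1) = 6000 * (n + 1) * (2 * D + 1)"
            by (simp add: algebra_simps)
          ultimately have T3: "T3 + 70 \<le> T + 10 + 6000 * (n + 1) * (2 * D + 1)"
            using D(2) by linarith
          from b(2) show ?case
          proof (elim disjE conjE)
            assume c: "R3 82 = 0" "D < n - l"
            then have "2 * D + 1 \<le> 2 * (n - l)" "D + D + 1 = 2 * D + 1"
              by auto
            then have "I (R3(60 := D + D + 1)) M2 U T''" if "T'' \<le> T3 + 40" for T''
              unfolding I_def using sm sm2 c T3[unfolded mult_2] that by auto
            moreover have "D + D + 1 < 2 ^ w"
              using Dn nw' by linarith
            ultimately show ?case
              using c R3 Dn by auto
          next
            assume c: "R3 82 = 1" "R3 81 = l" "n - l \<le> D"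
            have "solved D (R3(72 := 0)) M2"
              unfolding solved_def using c R3 D(1) a(3-6) by simp
            then have "I (R3(72 := 0)) M2 U T''" if "T'' \<le> T3 + 40" for T''
              unfolding I_def using sm sm2 c T3 that by auto
            then show ?case
              using c Dn w16 by auto
          qed
        qed (use R2 D a in simp_all)
      qed (use R' D wo' D_def in \<open>simp_all add: base_regs_def\<close>)
      moreover have "D + 1 < 2 ^ w"
        using Dn nw' by linarith
      ultimately show ?thesis
        using True U w16 by (simp add: D_def)
    qed
  qed
  then show ?thesis
    unfolding search_def using w16 by simp
qed

section \<open>Recovering a solution\<close>

definition bt_test :: "nat \<Rightarrow> com" where
  "bt_test ta = If (V 65 <! V 64)
     (If (Ld ta (V 65 *! V 61 +! (V 64 -! N 1 -! V 65)) =! V 83) (86 :=! N 1) (86 :=! N 0)) (86 :=! N 0)"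

definition bt_match :: "nat \<Rightarrow> com" where
  "bt_match ta = (St 0 (V 65 -! N 1) (In (N 1 +! V 64)) ;; 65 :=! V 65 -! N 1 ;; 64 :=! V 64 -! N 1 ;;
     83 :=! Ld ta (V 65 *! V 61 +! (V 64 -! V 65)))"

definition copy_pattern :: com where
  "copy_pattern = (87 :=! N 0 ;; Wh (V 87 <! V 1) (St 0 (V 78 +! V 87) (In (V 5 +! V 87)) ;; 87 :=! V 87 +! N 1))"

lemma wp_bt_test:
  assumes R: "R 61 = D + 1" "R 64 = i" "R 65 = k" "R 83 = v" and i: "i \<le> n" and ta: "ta < 16"
    and idx: "k < i \<Longrightarrow> k * (D + 1) + (i - 1 - k) < L \<and> M ta (k * (D + 1) + (i - 1 - k)) = y"
    and K: "\<And>R' T'. same {86} R' R \<Longrightarrow> R' 86 = of_bool (k < i \<and> y = v) \<Longrightarrow> T' \<le> T + 60 \<Longrightarrow> Q R' M U T'"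
  shows "wp (bt_test ta) Q R M U T"
proof -
  have fin: "Q (R(86 := of_bool (k < i \<and> y = v))) M U T'" if "T' \<le> T + 60" for T'
    by (rule K) (use that in auto)
  show ?thesis
  proof (cases "k < i")
    case False
    then show ?thesis
      unfolding bt_test_def using fin R w16 by simp
  next
    case True
    define z where "z = k * (D + 1) + (i - 1 - k)"
    have z: "z < L" "M ta z = y"
      using idx[OF True] by (simp_all add: z_def)
    have zz: "k * (D + 1) + i - (1 + k) = z"
      using True by (simp add: z_def)
    have "z < 2 ^ w" "k * (D + 1) < 2 ^ w" "i < 2 ^ w" "i - 1 < 2 ^ w" "k \<le> i - 1"
      using z(1) L16 i nw' True by (auto simp: z_def)
    then show ?thesis
      unfolding bt_test_def using fin R w16 ta True z zz by (cases "y = v") simp_all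
  qed
qed

lemma wp_bt_match:
  assumes R: "R 61 = D + 1" "R 64 = i" "R 65 = k" and i: "i \<le> n" "0 < k" "k \<le> i" and ta: "ta < 16" "ta \<noteq> 0"
    and idx: "(k - 1) * (D + 1) + (i - 1 - (k - 1)) < L" "M ta ((k - 1) * (D + 1) + (i - 1 - (k - 1))) = y"
    and K: "\<And>T'. T' \<le> T + 60 \<Longrightarrow>
      Q (R(65 := k - 1, 64 := i - 1, 83 := y)) (M(0 := (M 0)(k - 1 := A ! (i - 1)))) U T'"
  shows "wp (bt_match ta) Q R M U T"
proof -
  define z where "z = (k - 1) * (D + 1) + (i - 1 - (k - 1))"
  have z: "z < L" "M ta z = y"
    using idx by (simp_all add: z_def)
  have z': "(k - 1) * (D + 1) + (i - k) = z"
    using i by (simp add: z_def)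
  have zz: "(k - 1) * (D + 1) + i - k = z"
    using i by (simp add: z_def)
  have zw: "z < 2 ^ w" "(k - 1) * (D + 1) < 2 ^ w"
    using z(1) L16 by (auto simp: z_def)
  have bd: "1 + i < 2 ^ w" "k < 2 ^ w" "i < 2 ^ w" "k - 1 < L" "k - 1 \<le> i - 1"
    using i nw' Ln by linarith+
  have "inp ! (2 + (i - 1)) = A ! (i - 1) \<and> 2 + (i - 1) < length inp"
    using textatD(1)[OF textat_A, of "i - 1"] i lenA by simp
  moreover have "2 + (i - 1) = 1 + i"
    using i by simp
  ultimately have inA: "inp ! (1 + i) = A ! (i - 1)" "1 + i < length inp"
    by simp_all
  have dd: "i - 1 - (k - 1) = i - k"
    using i by simp
  show ?thesis
    unfolding bt_match_def using K R w16 ta i z z' zz zw bd inA dd by simp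
qed

lemma wp_copy_pattern:
  assumes R: "R 1 = r" "R 5 = 2 + 2 * n" "R 78 + r \<le> n"
    and K: "\<And>R' T'. same {87} R' R \<Longrightarrow> T' \<le> T + 60 * r + 50 \<Longrightarrow>
      Q R' (M(0 := (\<lambda>t. if R 78 \<le> t \<and> t < R 78 + r then P ! (t - R 78) else M 0 t))) U T'"
  shows "wp copy_pattern Q R M U T"
proof -
  define I where "I = (\<lambda>R' M' U' T'. same {87} R' R \<and> U' = U \<and> R' 87 \<le> r \<and>
    M' = M(0 := (\<lambda>t. if R 78 \<le> t \<and> t < R 78 + R' 87 then P ! (t - R 78) else M 0 t)) \<and> T' \<le> T + 10 + 60 * R' 87)"
  have "wp (Wh (V 87 <! V 1) (St 0 (V 78 +! V 87) (In (V 5 +! V 87)) ;; 87 :=! V 87 +! N 1)) Q (R(87 := 0)) M U T1"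
    if T1: "T1 \<le> T + 10" for T1
  proof (rule wp_while[where I = I and f = "\<lambda>R' M'. r - R' 87"], goal_cases)
    case 1
    then show ?case
      using T1 by (auto simp: I_def fun_eq_iff)
  next
    case (2 R' M' U' T')
    then have s: "same {87} R' R" and U: "U' = U" and j: "R' 87 \<le> r"
      and M: "M' = M(0 := (\<lambda>t. if R 78 \<le> t \<and> t < R 78 + R' 87 then P ! (t - R 78) else M 0 t))"
      and T: "T' \<le> T + 10 + 60 * R' 87"
      unfolding I_def by blast+
    have R': "R' 1 = r" "R' 5 = 2 + 2 * n" "R' 78 = R 78"
      using s R by simp_all
    show ?case
    proof (cases "R' 87 < r")
      case False
      then have j: "R' 87 = r"
        using j by simp
      have "Q R' M' U T''" if "T'' \<le> T' + 10" for T''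
        unfolding M j by (rule K[OF s]) (use T j that in simp)
      then show ?thesis
        using False R' U by simp
    next
      case True
      have pt: "inp ! (2 + 2 * n + R' 87) = P ! R' 87" "2 + 2 * n + R' 87 < length inp"
        using textatD(1)[OF textat_P, of "R' 87"] True lenP by simp_all
      have "M'(0 := (M' 0)(R 78 + R' 87 := P ! R' 87)) =
        M(0 := (\<lambda>t. if R 78 \<le> t \<and> t < R 78 + (R' 87 + 1) then P ! (t - R 78) else M 0 t))"
        unfolding M by (auto simp: fun_eq_iff less_Suc_eq Suc_eq_plus1[symmetric])
      then have "I (R'(87 := R' 87 + 1)) (M'(0 := (M' 0)(R 78 + R' 87 := P ! R' 87))) U T''" if "T'' \<le> T' + 50" for T''
        unfolding I_def using s T True that by simp
      moreover have "R 78 + R' 87 < L" "R 78 + R' 87 < 2 ^ w" "2 + 2 * n + R' 87 < 2 ^ w" "R' 87 + 1 < 2 ^ w"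
        using True R rn Ln nw' by linarith+
      ultimately show ?thesis
        using True R' U pt w16 by simp
    qed
  qed
  then show ?thesis
    unfolding copy_pattern_def using w16 by simp
qed

text \<open>The tests follow the alternatives of \<open>H_step\<close>: the same value one row
  higher, the base value, and otherwise a match. Register \<open>85\<close> is one until the pattern
  has been written and the rest is left to the table of \<open>f\<close>.\<close>

definition bt_F :: com where
  "bt_F = Wh (V 85) (bt_test 15 ;; If (V 86) (64 :=! V 64 -! N 1) (jumpF ;; If (V 70 =! V 83)
     (copy_pattern ;; 64 :=! V 77 ;; 65 :=! V 78 ;; 83 :=! V 79 ;; 85 :=! N 0) (bt_match 15)))"

definition bt_f :: com where
  "bt_f = Wh (V 65) (bt_test 14 ;; If (V 86) (64 :=! V 64 -! N 1) (bt_match 14))"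

abbreviation "seg m a \<equiv> map (m :: nat \<Rightarrow> nat) [a..<l]"

text \<open>The solution is written from right to left: its characters from \<open>k\<close> on are
  final, and they are embedded behind the prefixes of \<open>A\<close> and \<open>B\<close> that
  remain.\<close>

definition bt_inv :: "(nat \<Rightarrow> nat) \<Rightarrow> nat \<Rightarrow> nat \<Rightarrow> nat \<Rightarrow> nat \<Rightarrow> bool" where
  "bt_inv m D i k v \<longleftrightarrow> k \<le> i \<and> i \<le> k + D \<and> i \<le> n \<and> k \<le> l \<and> v \<le> n \<and>
     subseq (seg m k) (drop i A) \<and> subseq (seg m k) (drop v B)"

lemma seg_Cons: "0 < k \<Longrightarrow> k \<le> l \<Longrightarrow> seg (m(k - 1 := a)) (k - 1) = a # seg m k"
  by (simp add: upt_conv_Cons)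

lemma bt_inv_up: "bt_inv m D i k v \<Longrightarrow> k < i \<Longrightarrow> bt_inv m D (i - 1) k v"
  unfolding bt_inv_def using subseq_drop_mono[of "seg m k" i A "i - 1"] by auto

lemma bt_inv_match:
  assumes "bt_inv m D i k v" "0 < k" "v' < v" "B ! (v - 1) = A ! (i - 1)"
  shows "bt_inv (m(k - 1 := A ! (i - 1))) D (i - 1) (k - 1) v'"
proof -
  have b: "k \<le> i" "i \<le> n" "k \<le> l" "v \<le> n" "subseq (seg m k) (drop i A)" "subseq (seg m k) (drop v B)" "i \<le> k + D"
    using assms(1) by (auto simp: bt_inv_def)
  have "subseq (A ! (i - 1) # seg m k) (drop (i - 1) A)"
    by (rule subseq_Cons_drop[OF b(5)]) (use b assms lenA in auto)
  moreover have "subseq (A ! (i - 1) # seg m k) (drop v' B)"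
    by (rule subseq_Cons_drop[OF b(6)]) (use b assms lenB in auto)
  ultimately show ?thesis
    unfolding bt_inv_def using seg_Cons[OF assms(2) b(3)] b assms by auto
qed

lemma seg_pattern:
  assumes "kk + r \<le> l"
  shows "seg (\<lambda>t. if kk \<le> t \<and> t < kk + r then P ! (t - kk) else m t) kk = P @ seg m (kk + r)"
proof (rule nth_equalityI)
  show "length (seg (\<lambda>t. if kk \<le> t \<and> t < kk + r then P ! (t - kk) else m t) kk) = length (P @ seg m (kk + r))"
    using assms lenP by simp
qed (use assms lenP in \<open>auto simp: nth_append\<close>)

lemma bt_inv_jump:
  assumes "bt_inv m D i k v" "win P A i0 i" "win P B x v" "r \<le> k" "k - r \<le> i0"
  shows "bt_inv (\<lambda>t. if k - r \<le> t \<and> t < k - r + r then P ! (t - (k - r)) else m t) D i0 (k - r) x"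
    "prefix P (seg (\<lambda>t. if k - r \<le> t \<and> t < k - r + r then P ! (t - (k - r)) else m t) (k - r))"
proof -
  have b: "k \<le> i" "i \<le> n" "k \<le> l" "v \<le> n" "subseq (seg m k) (drop i A)" "subseq (seg m k) (drop v B)" "i \<le> k + D"
    using assms(1) by (auto simp: bt_inv_def)
  have kr: "k - r + r = k"
    using assms(4) by simp
  note sg = seg_pattern[of "k - r" m, unfolded kr, OF b(3)]
  have w: "i0 + r \<le> i" "x + r \<le> v"
    using win_length[OF assms(2)] win_length[OF assms(3)] lenP by simp_all
  have "subseq (P @ seg m k) (drop i0 A)" "subseq (P @ seg m k) (drop x B)"
    using subseq_win_drop[OF assms(2) b(5)] subseq_win_drop[OF assms(3) b(6)] by blast+
  moreover have "i0 \<le> k - r + D" "i0 \<le> n" "k - r \<le> l" "x \<le> n"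
    using w b assms(4) by linarith+
  ultimately show "bt_inv (\<lambda>t. if k - r \<le> t \<and> t < k - r + r then P ! (t - (k - r)) else m t) D i0 (k - r) x"
    unfolding bt_inv_def kr sg using assms(5) by simp
  show "prefix P (seg (\<lambda>t. if k - r \<le> t \<and> t < k - r + r then P ! (t - (k - r)) else m t) (k - r))"
    unfolding kr sg by simp
qed


lemma wp_bt_F:
  assumes R: "base_regs R" "R 64 = n" "R 65 = l" "R 83 = hF D l n" "R 85 = 1" and sv: "solved D R M"
    and wo: "windows_ok M" and v: "hF D l n \<le> n"
    and K: "\<And>R' M' T'. same {64, 65, 70, 77, 78, 79, 83, 85, 86, 87} R' R \<Longrightarrow> same2 {0} M' M \<Longrightarrow>
      bt_inv (M' 0) D (R' 64) (R' 65) (R' 83) \<Longrightarrow> R' 83 = hf D (R' 65) (R' 64) \<Longrightarrow> R' 64 \<le> la \<Longrightarrow>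
      sublist P (seg (M' 0) (R' 65)) \<Longrightarrow> T' \<le> T + 600 * n + 800 \<Longrightarrow> Q R' M' U T'"
  shows "wp bt_F Q R M U T"
  unfolding bt_F_def
proof -
  have sv': "D \<le> 2 * (n - l)" "R 61 = D + 1" "R 62 \<le> l + 1" "R 63 \<le> l + 1" "n - l \<le> D"
    "tab (hf D) 0 D (n + 1) (R 62) (M 14) (la + 1) 0" "tab (hF D) r D (n + 1) (R 63) (M 15) (n + 1) 0"
    using sv by (simp_all add: solved_def)
  have Dl: "(l + 1) * (D + 1) \<le> L"
  proof -
    have "(l + 1) * (D + 1) \<le> (l + 1) * (2 * (n - l) + 1)"
      using sv'(1) by (intro mult_le_mono2) simp
    then show ?thesis
      using Ll by linarith
  qed
  have get: "k * (D + 1) + (i - k) < L \<and> M 15 (k * (D + 1) + (i - k)) = hF D k i \<and> k < R 63"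
    if "r \<le> k" "k \<le> i" "i \<le> k + D" "i \<le> n" "k \<le> l" "k < R 63" for k i
  proof (intro conjI)
    show "k * (D + 1) + (i - k) < L"
      by (rule index_less[OF _ _ Dl]) (use that in auto)
    show "M 15 (k * (D + 1) + (i - k)) = hF D k i"
      using tab_get(1)[OF sv'(7), of k i] that by simp
  qed fact
  have fink: "k < R 63" if "hF D k i \<le> n" "r \<le> k" "k \<le> i" "i \<le> k + D" "i \<le> n" for k i
  proof (rule ccontr)
    assume "\<not> k < R 63"
    then have "hF D k i = n + 1"
      using tab_get(2)[OF sv'(7), of k i] that by simp
    then show False
      using that by simp
  qed
  define S :: "nat set" where "S = {64, 65, 70, 77, 78, 79, 83, 85, 86, 87}"
  define I where "I = (\<lambda>R' M' U' T'. same S R' R \<and> same2 {0} M' M \<and> U' = U \<and>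
    bt_inv (M' 0) D (R' 64) (R' 65) (R' 83) \<and>
    (if R' 85 = 0 then R' 83 = hf D (R' 65) (R' 64) \<and> R' 64 \<le> la \<and> sublist P (seg (M' 0) (R' 65)) \<and>
       T' \<le> T + 600 * n + 750
     else R' 85 = 1 \<and> r \<le> R' 65 \<and> R' 83 = hF D (R' 65) (R' 64) \<and> T' + 500 * R' 64 \<le> T + 500 * n + 20))"
  show "wp (Wh (V 85) (bt_test 15 ;; If (V 86) (64 :=! V 64 -! N 1) (jumpF ;; If (V 70 =! V 83)
     (copy_pattern ;; 64 :=! V 77 ;; 65 :=! V 78 ;; 83 :=! V 79 ;; 85 :=! N 0) (bt_match 15)))) Q R M U T"
  \<comment> \<open>For an empty pattern the jump may leave register \<open>64\<close> unchanged.
    Adding the flag \<open>85\<close> makes the measure decrease nevertheless.\<close>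
  proof (rule wp_while[where I = I and f = "\<lambda>R' M'. R' 64 + R' 85"], goal_cases)
    case 1
    have "bt_inv (M 0) D n l (hF D l n)"
      unfolding bt_inv_def using ln sv'(5) v lenA by simp
    then show ?case
      using R rl by (simp add: I_def)
  next
    case (2 R' M' U' T')
    then have s: "same S R' R" and s2: "same2 {0} M' M" and U: "U' = U"
      and b: "bt_inv (M' 0) D (R' 64) (R' 65) (R' 83)"
      and c: "if R' 85 = 0 then R' 83 = hf D (R' 65) (R' 64) \<and> R' 64 \<le> la \<and> sublist P (seg (M' 0) (R' 65)) \<and>
         T' \<le> T + 600 * n + 750
       else R' 85 = 1 \<and> r \<le> R' 65 \<and> R' 83 = hF D (R' 65) (R' 64) \<and> T' + 500 * R' 64 \<le> T + 500 * n + 20"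
      unfolding I_def by blast+
    have R': "R' 0 = n" "R' 1 = r" "R' 5 = 2 + 2 * n" "R' 61 = D + 1" "R' 62 = R 62" "R' 63 = R 63"
      using s R(1) sv'(2) by (simp_all add: S_def base_regs_def)
    have M': "M' 14 = M 14" "M' 15 = M 15" "windows_ok M'"
      using s2 wo by (simp_all add: windows_ok_def)
    show ?case
    proof (cases "R' 85 = 0")
      case True
      then have "Q R' M' U T''" if "T'' \<le> T' + 10" for T''
        by (intro K[OF s[unfolded S_def] s2 b]) (use c that in auto)
      then show ?thesis
        using True U by simp
    next
      case False
      define k where "k = R' 65"
      define i where "i = R' 64"
      define v where "v = R' 83"
      have kiv: "R' 65 = k" "R' 64 = i" "R' 83 = v" "R' 85 = 1"
        using False c by (simp_all add: k_def i_def v_def)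
      have vH: "v = hF D k i" and rk: "r \<le> k" and T: "T' + 500 * i \<le> T + 500 * n + 20"
        using False c kiv by simp_all
      have b': "bt_inv (M' 0) D i k v" and ki: "k \<le> i" "i \<le> k + D" "i \<le> n" "k \<le> l" "v \<le> n"
        using b kiv by (simp_all add: bt_inv_def)
      have kKM: "k < R 63"
        using fink[of k i] vH rk ki by simp
      have after: "wp (If (V 86) (64 :=! V 64 -! N 1) (jumpF ;; If (V 70 =! V 83)
          (copy_pattern ;; 64 :=! V 77 ;; 65 :=! V 78 ;; 83 :=! V 79 ;; 85 :=! N 0) (bt_match 15)))
        (\<lambda>R'' M'' U'' T''. I R'' M'' U'' (T'' + 2) \<and> R'' 64 + R'' 85 < i + 1) R1 M' U T1"
        if R1: "same {86} R1 R'" "R1 86 = of_bool (k < i \<and> hF D k (i - 1) = v)" and T1: "T1 \<le> T' + 70" for R1 T1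
      proof (cases "k < i \<and> hF D k (i - 1) = v")
        case True
        have "I (R1(64 := i - 1)) M' U T''" if "T'' \<le> T' + 100" for T''
          unfolding I_def using R1(1) s s2 kiv bt_inv_up[OF b'] True rk T that by (auto simp: S_def)
        moreover have "i < 2 ^ w"
          using ki nw' by linarith
        ultimately show ?thesis
          using True R1 kiv T1 by simp
      next
        case no_up: False
        have "wp jumpF (wp (If (V 70 =! V 83)
          (copy_pattern ;; 64 :=! V 77 ;; 65 :=! V 78 ;; 83 :=! V 79 ;; 85 :=! N 0) (bt_match 15))
          (\<lambda>R'' M'' U'' T''. I R'' M'' U'' (T'' + 2) \<and> R'' 64 + R'' 85 < i + 1)) R1 M' U T2"
          if T2: "T2 \<le> T' + 90" for T2
        proof (rule wp_jumpF[where D = D and i = i and k = k], goal_cases)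
          case 13
          have "tab (hf D) 0 D (n + 1) (R 62) (M 14) (min i la + 1) 0"
            using sv'(6) unfolding tab_def by auto
          then show ?case
            using R1 R' M' by simp
        next
          case (14 R3 T3)
          note a = 14
          have sm: "same S R3 R"
            using a(1) R1(1) s by (auto simp: S_def)
          have R3: "R3 64 = i" "R3 65 = k" "R3 83 = v" "R3 85 = 1" "R3 61 = D + 1" "R3 1 = r" "R3 5 = 2 + 2 * n"
            using a(1) R1(1) kiv R' by simp_all
          show ?case
          proof (cases "R3 70 = v")
            case True
            have j: "EE P A (R3 77) = i" "R3 78 = k - r" "R3 79 = hf D (k - r) (R3 77)" "R3 79 \<le> n"
              "EE P B (R3 79) = v" "R3 78 \<le> R3 77"
              using a(3) True ki by auto
            define M3 where "M3 = M'(0 := (\<lambda>t. if R3 78 \<le> t \<and> t < R3 78 + r then P ! (t - R3 78) else M' 0 t))"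
            have wA: "win P A (R3 77) i"
              using EE_le_iff[of i A P "R3 77"] j(1) ki lenA by simp
            have wB: "win P B (R3 79) v"
              using EE_le_iff[of v B P "R3 79"] j(5) ki lenB by simp
            have i0: "R3 77 \<le> i" "R3 77 \<le> la"
              using win_length[OF wA] la(2)[of "R3 77"] j(1) ki by auto
            note jump = bt_inv_jump[OF b' wA wB rk j(6)[unfolded j(2)]]
            have fin: "I (R4(64 := R3 77, 65 := k - r, 83 := R3 79, 85 := 0)) M3 U T''"
              if R4: "same {87} R4 R3" "T'' \<le> T' + 60 * r + 500" for R4 T''
            proof -
              have "same S (R4(64 := R3 77, 65 := k - r, 83 := R3 79, 85 := 0)) R"
                using R4(1) sm by (auto simp: S_def)
              moreover have "same2 {0} M3 M"
                using s2 by (simp add: M3_def)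
              moreover have "bt_inv (M3 0) D (R3 77) (k - r) (R3 79)" "sublist P (seg (M3 0) (k - r))"
              proof -
                have "M3 0 = (\<lambda>t. if k - r \<le> t \<and> t < k - r + r then P ! (t - (k - r)) else M' 0 t)"
                  by (simp only: M3_def fun_upd_same j(2))
                then show "bt_inv (M3 0) D (R3 77) (k - r) (R3 79)" "sublist P (seg (M3 0) (k - r))"
                  using jump by (simp_all only: prefix_imp_sublist)
              qed
              moreover have "T'' \<le> T + 600 * n + 750"
                using R4(2) T rn by linarith
              ultimately show ?thesis
                unfolding I_def using j(3) i0 by simp
            qed
            have "wp copy_pattern (\<lambda>R M U T. wp (64 :=! V 77 ;; 65 :=! V 78 ;; 83 :=! V 79 ;; 85 :=! N 0)
              (\<lambda>R'' M'' U'' T''. I R'' M'' U'' (T'' + 4) \<and> R'' 64 + R'' 85 < i + 1) R M U T) R3 M' U T4"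
              if T4: "T4 \<le> T3 + 20" for T4
            proof (rule wp_copy_pattern, goal_cases)
              case (4 R4 T5)
              have R4: "R4 77 = R3 77" "R4 78 = k - r" "R4 79 = R3 79"
                using 4(1) j(2) by simp_all
              have "T5 + 30 \<le> T' + 60 * r + 500"
                using 4(2) T4 a(4) T2 by linarith
              then have "I (R4(64 := R3 77, 65 := k - r, 83 := R3 79, 85 := 0)) M3 U T''" if "T'' \<le> T5 + 30" for T''
                by (intro fin[OF 4(1)]) (use that in linarith)
              then show ?case
                using R4 i0 w16 by (simp add: M3_def)
            qed (use R3 j rk ki in auto)
            then show ?thesis
              using True R3 by (simp add: add.commute)
          next
            case no_jump: False
            \<comment> \<open>\<open>jumpF\<close> may report infinity instead of the true base
              value, but only if that lies beyond the limits, which \<open>v\<close>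
              respects.\<close>
            have "JF k i \<noteq> v"
            proof
              assume "JF k i = v"
              then have "k + D < v \<or> n < v"
                using a(2) no_jump by auto
              moreover have "v \<le> k + D"
                using vH ki by (auto simp: F.H_def split: if_splits)
              ultimately show False
                using ki by simp
            qed
            then have m: "r < k" "0 < i" "hF D (k - 1) (i - 1) < v" "B ! (v - 1) = A ! (i - 1)"
              using F.H_step[of i n D k v] no_up vH ki by auto
            have pre: "r \<le> k - 1" "k - 1 \<le> i - 1" "i - 1 \<le> k - 1 + D" "i - 1 \<le> n" "k - 1 \<le> l" "k - 1 < R 63"
              using m ki kKM by auto
            note g = get[OF pre]
            have "wp (bt_match 15) (\<lambda>R'' M'' U'' T''. I R'' M'' U'' (T'' + 2) \<and> R'' 64 + R'' 85 < i + 1) R3 M' U T4"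
              if T4: "T4 \<le> T3 + 20" for T4
            proof (rule wp_bt_match[where D = D and i = i and k = k and y = "hF D (k - 1) (i - 1)"], goal_cases)
              case (11 T5)
              have "same S (R3(65 := k - 1, 64 := i - 1, 83 := hF D (k - 1) (i - 1))) R"
                using sm by (auto simp: S_def)
              moreover have "T5 + 10 + 500 * (i - 1) \<le> T + 500 * n + 20"
                using 11 T4 a(4) T2 T m(2) by linarith
              ultimately show ?case
                unfolding I_def using bt_inv_match[OF b' _ m(3,4)] m s2 pre(1) R3 by auto
            qed (use R3 ki m g M' in auto)
            then show ?thesis
              using no_jump R3 by (simp add: add.commute)
          qed
        qed (use R1 R' kiv ki rk sv'(3) Dl M'(3) in simp_all)
        note this[folded wp.simps(4)[THEN fun_cong, of jumpF]]
        then show ?thesis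
          using no_up R1 T1 by (simp del: wp.simps(4,5) add: wp.simps(5)[of "V 86"])
      qed
      have "wp (bt_test 15) (wp (If (V 86) (64 :=! V 64 -! N 1) (jumpF ;; If (V 70 =! V 83)
          (copy_pattern ;; 64 :=! V 77 ;; 65 :=! V 78 ;; 83 :=! V 79 ;; 85 :=! N 0) (bt_match 15)))
        (\<lambda>R'' M'' U'' T''. I R'' M'' U'' (T'' + 2) \<and> R'' 64 + R'' 85 < i + 1)) R' M' U T1" if T1: "T1 \<le> T' + 10" for T1
      proof (rule wp_bt_test[where D = D and i = i and k = k and v = v and y = "hF D k (i - 1)"], goal_cases)
        case 7
        then show ?case
          using get[of k "i - 1"] rk ki kKM M' by auto
      next
        case (8 R1 T3)
        then show ?case
          by (intro after) (use T1 in auto)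
      qed (use R' kiv ki in auto)
      then show ?thesis
        using kiv U by simp
    qed
  qed
qed

lemma wp_bt_f:
  assumes R: "base_regs R" and sv: "solved D R M"
    and b: "bt_inv (M 0) D (R 64) (R 65) (R 83)" "R 83 = hf D (R 65) (R 64)" "R 64 \<le> la" "sublist P (seg (M 0) (R 65))"
    and K: "\<And>R' M' T'. same {64, 65, 83, 86} R' R \<Longrightarrow> same2 {0} M' M \<Longrightarrow>
      sublist P (seg (M' 0) 0) \<Longrightarrow> subseq (seg (M' 0) 0) A \<Longrightarrow> subseq (seg (M' 0) 0) B \<Longrightarrow>
      T' \<le> T + 500 * n + 50 \<Longrightarrow> Q R' M' U T'"
  shows "wp bt_f Q R M U T"
  unfolding bt_f_def
proof -
  have sv': "D \<le> 2 * (n - l)" "R 61 = D + 1" "R 62 \<le> l + 1"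
    "tab (hf D) 0 D (n + 1) (R 62) (M 14) (la + 1) 0"
    using sv by (simp_all add: solved_def)
  have Dl: "(l + 1) * (D + 1) \<le> L"
  proof -
    have "(l + 1) * (D + 1) \<le> (l + 1) * (2 * (n - l) + 1)"
      using sv'(1) by (intro mult_le_mono2) simp
    then show ?thesis
      using Ll by linarith
  qed
  have get: "k * (D + 1) + (i - k) < L \<and> M 14 (k * (D + 1) + (i - k)) = hf D k i"
    if "k \<le> i" "i \<le> k + D" "i \<le> la" "k \<le> l" "k < R 62" for k i
  proof (intro conjI)
    show "k * (D + 1) + (i - k) < L"
      by (rule index_less[OF _ _ Dl]) (use that in auto)
    show "M 14 (k * (D + 1) + (i - k)) = hf D k i"
      using tab_get(1)[OF sv'(4), of k i] that by simp
  qed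
  have fink: "k < R 62" if "hf D k i \<le> n" "k \<le> i" "i \<le> k + D" "i \<le> la" for k i
  proof (rule ccontr)
    assume "\<not> k < R 62"
    then have "hf D k i = n + 1"
      using tab_get(2)[OF sv'(4), of k i] that by simp
    then show False
      using that by simp
  qed
  define S :: "nat set" where "S = {64, 65, 83, 86}"
  define I where "I = (\<lambda>R' M' U' T'. same S R' R \<and> same2 {0} M' M \<and> U' = U \<and>
    bt_inv (M' 0) D (R' 64) (R' 65) (R' 83) \<and> R' 83 = hf D (R' 65) (R' 64) \<and> R' 64 \<le> la \<and>
    sublist P (seg (M' 0) (R' 65)) \<and> T' + 500 * R' 64 \<le> T + 500 * n)"
  show "wp (Wh (V 65) (bt_test 14 ;; If (V 86) (64 :=! V 64 -! N 1) (bt_match 14))) Q R M U T"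
  proof (rule wp_while[where I = I and f = "\<lambda>R' M'. R' 64"], goal_cases)
    case 1
    have "R 64 \<le> n"
      using b(1) by (simp add: bt_inv_def)
    then show ?case
      using b by (simp add: I_def)
  next
    case (2 R' M' U' T')
    then have s: "same S R' R" and s2: "same2 {0} M' M" and U: "U' = U"
      and b: "bt_inv (M' 0) D (R' 64) (R' 65) (R' 83)" and vH': "R' 83 = hf D (R' 65) (R' 64)" and la': "R' 64 \<le> la"
      and sl: "sublist P (seg (M' 0) (R' 65))" and T: "T' + 500 * R' 64 \<le> T + 500 * n"
      unfolding I_def by blast+
    have R': "R' 61 = D + 1" "R' 62 = R 62"
      using s sv'(2) by (simp_all add: S_def)
    have M': "M' 14 = M 14"
      using s2 by simp
    show ?case
    proof (cases "R' 65 = 0")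
      case True
      \<comment> \<open>The prefixes that remain at \<open>k = 0\<close> need not be empty; an
        embedding behind them is also one in the whole string.\<close>
      have "subseq (seg (M' 0) 0) A"
        using b True subseq_drop_mono[of "seg (M' 0) 0" "R' 64" A 0] by (simp add: bt_inv_def)
      moreover have "subseq (seg (M' 0) 0) B"
        using b True subseq_drop_mono[of "seg (M' 0) 0" "R' 83" B 0] by (simp add: bt_inv_def)
      ultimately have "Q R' M' U T''" if "T'' \<le> T' + 10" for T''
        by (intro K[OF s[unfolded S_def] s2]) (use sl True T that in auto)
      then show ?thesis
        using True U by simp
    next
      case False
      define k where "k = R' 65"
      define i where "i = R' 64"
      define v where "v = R' 83"
      have kiv: "R' 65 = k" "R' 64 = i" "R' 83 = v"
        by (simp_all add: k_def i_def v_def)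
      have vH: "v = hf D k i" and T: "T' + 500 * i \<le> T + 500 * n" and sl: "sublist P (seg (M' 0) k)"
        and k0: "0 < k" and ila: "i \<le> la"
        using vH' T sl la' False kiv by simp_all
      have b': "bt_inv (M' 0) D i k v" and ki: "k \<le> i" "i \<le> k + D" "i \<le> n" "k \<le> l" "v \<le> n"
        using b kiv by (simp_all add: bt_inv_def)
      have kKM: "k < R 62"
        using fink[of k i] vH ki ila by simp
      have after: "wp (If (V 86) (64 :=! V 64 -! N 1) (bt_match 14))
        (\<lambda>R'' M'' U'' T''. I R'' M'' U'' (T'' + 2) \<and> R'' 64 < i) R1 M' U T1"
        if R1: "same {86} R1 R'" "R1 86 = of_bool (k < i \<and> hf D k (i - 1) = v)" and T1: "T1 \<le> T' + 70" for R1 T1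
      proof (cases "k < i \<and> hf D k (i - 1) = v")
        case True
        have "I (R1(64 := i - 1)) M' U T''" if "T'' \<le> T' + 100" for T''
          unfolding I_def using R1(1) s s2 kiv bt_inv_up[OF b'] True T sl ila that by (auto simp: S_def)
        moreover have "i < 2 ^ w"
          using ki nw' by linarith
        ultimately show ?thesis
          using True R1 kiv T1 by auto
      next
        case no_up: False
        have m: "0 < i" "hf D (k - 1) (i - 1) < v" "B ! (v - 1) = A ! (i - 1)"
          using f.H_step[of i lb D k v] no_up vH ki k0 lb(1) by auto
        have pre: "k - 1 \<le> i - 1" "i - 1 \<le> k - 1 + D" "i - 1 \<le> la" "k - 1 \<le> l" "k - 1 < R 62"
          using m ki kKM ila k0 by auto
        note g = get[OF pre]
        have sl': "sublist P (seg ((M' 0)(k - 1 := A ! (i - 1))) (k - 1))"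
          using sl by (subst seg_Cons[OF k0 ki(4)]) (simp add: sublist_Cons_right)
        have "wp (bt_match 14) (\<lambda>R'' M'' U'' T''. I R'' M'' U'' (T'' + 2) \<and> R'' 64 < i) R1 M' U T4"
          if T4: "T4 \<le> T' + 90" for T4
        proof (rule wp_bt_match[where D = D and i = i and k = k and y = "hf D (k - 1) (i - 1)"], goal_cases)
          case (11 T5)
          have "same S (R1(65 := k - 1, 64 := i - 1, 83 := hf D (k - 1) (i - 1))) R"
            using R1(1) s by (auto simp: S_def)
          moreover have "T5 + 10 + 500 * (i - 1) \<le> T + 500 * n"
            using 11 T4 T m(1) by linarith
          ultimately show ?case
            unfolding I_def using bt_inv_match[OF b' k0 m(2,3)] m s2 pre(3) sl' by auto
        qed (use R1 R' kiv ki m k0 g M' in auto)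
        then show ?thesis
          using no_up R1 T1 by simp
      qed
      have "wp (bt_test 14) (wp (If (V 86) (64 :=! V 64 -! N 1) (bt_match 14))
        (\<lambda>R'' M'' U'' T''. I R'' M'' U'' (T'' + 2) \<and> R'' 64 < i)) R' M' U T1" if T1: "T1 \<le> T' + 10" for T1
      proof (rule wp_bt_test[where D = D and i = i and k = k and v = v and y = "hf D k (i - 1)"], goal_cases)
        case 7
        then show ?case
          using get[of k "i - 1"] ki kKM M' ila by auto
      next
        case (8 R1 T3)
        then show ?case
          by (intro after) (use T1 in auto)
      qed (use R' kiv ki in auto)
      then show ?thesis
        using False kiv U by simp
    qed
  qed
qed

definition emit :: com where
  "emit = (Out (N 1) ;; 87 :=! N 0 ;; Wh (V 87 <! V 81) (Out (Ld 0 (V 87)) ;; 87 :=! V 87 +! N 1))"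

lemma wp_emit:
  assumes R: "R 81 = l"
    and K: "\<And>R' T'. T' \<le> T + 50 * n + 50 \<Longrightarrow> Q R' M (U @ 1 # seg (M 0) 0) T'"
  shows "wp emit Q R M U T"
proof -
  define I where "I = (\<lambda>R' M' U' T'. same {87} R' R \<and> M' = M \<and> R' 87 \<le> l \<and>
    U' = U @ 1 # map (M 0) [0..<R' 87] \<and> T' \<le> T + 10 + 30 * R' 87)"
  have "wp (Wh (V 87 <! V 81) (Out (Ld 0 (V 87)) ;; 87 :=! V 87 +! N 1)) Q (R(87 := 0)) M (U @ [1]) T1"
    if T1: "T1 \<le> T + 10" for T1
  proof (rule wp_while[where I = I and f = "\<lambda>R' M'. l - R' 87"], goal_cases)
    case 1
    then show ?case
      using T1 by (simp add: I_def)
  next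
    case (2 R' M' U' T')
    then have s: "same {87} R' R" and M: "M' = M" and j: "R' 87 \<le> l"
      and U: "U' = U @ 1 # map (M 0) [0..<R' 87]" and T: "T' \<le> T + 10 + 30 * R' 87"
      unfolding I_def by blast+
    have R': "R' 81 = l"
      using s R by simp
    show ?case
    proof (cases "R' 87 < l")
      case False
      then have jl: "R' 87 = l"
        using j by simp
      have "Q R' M U' T''" if "T'' \<le> T' + 10" for T''
        unfolding U jl by (rule K) (use T jl ln that in simp)
      then show ?thesis
        using False R' M by simp
    next
      case True
      have "I (R'(87 := R' 87 + 1)) M (U' @ [M 0 (R' 87)]) T''" if "T'' \<le> T' + 30" for T''
        unfolding I_def using s T True U that by (simp add: Suc_eq_plus1[symmetric])
      moreover have "R' 87 < L" "R' 87 + 1 < 2 ^ w"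
        using True ln Ln nw' by linarith+
      ultimately show ?thesis
        using True R' M w16 by simp
    qed
  qed
  then show ?thesis
    unfolding emit_def using w16 by simp
qed

end

section \<open>The program\<close>

context lcs
begin

definition windows :: "nat \<Rightarrow> nat \<Rightarrow> nat \<Rightarrow> nat \<Rightarrow> nat \<Rightarrow> com" where
  "windows bs fe fs ea sa = (ids 4 5 0 bs ;; run 1 4 fe ;; run 2 5 fs ;; pair_windows fe fs ea sa)"

lemma wp_windows:
  assumes R: "R 0 = n" "R 1 = r" "R 2 = W" "R 3 = W * W" "1 \<le> W" "2 ^ W \<le> n + 2"
    and S: "S = (\<lambda>t. M 0 (t + 1))" "bsorted (W * W) r S" "S ` {..<r} = set P" and L: "2 * n + 8 \<le> L"
    and ar: "{fe, fs, ea, sa} \<inter> {0, 1, 2, 3, 4, 5} = {}" "fe < 16" "fs < 16" "ea < 16" "sa < 16"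
      "distinct [fe, fs, ea, sa]" "bs < 10"
    and X: "textat (R bs) X" "length X = n"
    and P: "\<And>k. k < r \<Longrightarrow> M 1 k = kap S (P ! k)" "\<And>k. k < r \<Longrightarrow> M 2 k = kap S (rev P ! k)"
    and MT: "\<And>x. x \<le> r \<Longrightarrow> M 3 x = 0"
    and K: "\<And>R' M' T'. same {20..52} R' R \<Longrightarrow> same2 {3, 4, 5, fe, fs, ea, sa} M' M \<Longrightarrow>
      (\<And>x. x \<le> r \<Longrightarrow> M' 3 x = 0) \<Longrightarrow> (\<And>j. j \<le> n \<Longrightarrow> M' fe j = of_bool (\<exists>i. EE P X i = j)) \<Longrightarrow>
      (\<And>s. s \<le> n + 1 \<Longrightarrow> M' ea s = EE P X s) \<Longrightarrow>
      (\<And>i. EE P X i \<le> n \<Longrightarrow> M' sa (EE P X i) = (GREATEST i'. EE P X i' = EE P X i)) \<Longrightarrow>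
      T' \<le> T + 3000 * ((n + 2) * (r div W + W + 2)) \<Longrightarrow> Q R' M' U T'"
  shows "wp (windows bs fe fs ea sa) Q R M U T"
  unfolding windows_def wp.simps(4)
proof (rule wp_ids[where W = W and S = S and X = X], goal_cases)
  case (19 R1 M1 T1)
  note a = 19
  have fr: "fe \<notin> {0, 1, 2, 3, 4, 5}" "fs \<notin> {0, 1, 2, 3, 4, 5}" "ea \<notin> {0, 1, 2, 3, 4, 5}" "sa \<notin> {0, 1, 2, 3, 4, 5}"
    using ar(1) by auto
  \<comment> \<open>Windows are computed on the numbers of the characters; \<open>EE_map\<close>
    transfers them to the strings.\<close>
  define f where "f = kap S"
  have f: "f p = f c \<longleftrightarrow> p = c" if "p \<in> set P" for p c
    using kap_iff(2)[OF S(3) that] by (simp add: f_def)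
  have fr_le: "f c \<le> r" for c
    by (simp add: f_def kap_le)
  have R1: "R1 0 = n" "R1 1 = r" "R1 2 = W"
    using a(1) R by simp_all
  show ?case
  proof (rule wp_run[where W = W and ps = "map f P" and xs = "map f X"], goal_cases)
    case (20 R2 M2 T2)
    note b = 20
    have R2: "R2 0 = n" "R2 1 = r" "R2 2 = W"
      using b(1) R1 by simp_all
    have M2: "M2 2 = M 2" "M2 5 = M1 5"
      using b(2) a(2) fr by auto
    have fe: "M2 fe j = of_bool (\<exists>i. EE P X i = j)" if "j \<le> n" for j
      using b(3)[OF that] arr_EE[of j "map f X" "map f P"] that lenP X(2) EE_map[of P X f] f by simp
    show ?case
    proof (rule wp_run[where W = W and ps = "map f (rev P)" and xs = "map f (rev X)"], goal_cases)
      case (20 R3 M3 T3)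
      note c = 20
      have R3: "R3 0 = n"
        using c(1) R2 by simp
      have "M3 fe = M2 fe"
        using c(2) ar fr by auto
      then have fe3: "M3 fe j = of_bool (\<exists>i. EE P X i = j)" if "j \<le> n" for j
        using fe[OF that] by simp
      have fs: "M3 fs j = of_bool (\<exists>i. EE (rev P) (rev X) i = j)" if "j \<le> n" for j
        using c(3)[OF that] arr_EE[of j "map f (rev X)" "map f (rev P)"] that lenP X(2)
          EE_map[of "rev P" "rev X" f] f by simp
      show ?case
      proof (rule wp_pair_windows[where X = X], goal_cases)
        case (11 R4 M4 T4)
        note d = 11
        have "same {20..52} R4 R"
          using d(1) c(1) b(1) a(1) by auto
        moreover have "same2 {3, 4, 5, fe, fs, ea, sa} M4 M"
          using d(2) c(2) b(2) a(2) by auto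
        moreover have "M4 3 x = 0" if "x \<le> r" for x
          using d(2) c(4)[OF that] fr by auto
        moreover have "M4 fe j = of_bool (\<exists>i. EE P X i = j)" if "j \<le> n" for j
          using d(2) fe3[OF that] ar by auto
        moreover have "T4 \<le> T + 3000 * ((n + 2) * (r div W + W + 2))"
        proof -
          define q where "q = r div W"
          have 1: "T1 \<le> T + 20 + n * (400 * (q + W + 1) + 100)"
            using a(5) X by (simp add: q_def)
          have 2: "T2 \<le> T1 + 600 * ((n + 2) * (q + 2))" "T3 \<le> T2 + 600 * ((n + 2) * (q + 2))"
            using b(5) c(5) by (simp_all add: q_def)
          define Y where "Y = (n + 2) * (q + W + 2)"
          have "n * (400 * (q + W + 1) + 100) \<le> (n + 2) * (400 * (q + W + 2))"
            by (intro mult_le_mono) auto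
          also have "\<dots> = 400 * Y"
            by (simp add: Y_def)
          finally have "T1 \<le> T + 20 + 400 * Y"
            by (intro order_trans[OF 1] add_left_mono)
          moreover have q: "(n + 2) * (q + 2) \<le> Y"
            unfolding Y_def by (intro mult_le_mono2) simp
          have "T2 \<le> T1 + 600 * Y"
            by (intro order_trans[OF 2(1)] add_left_mono mult_le_mono2 q)
          moreover have "T3 \<le> T2 + 600 * Y"
            by (intro order_trans[OF 2(2)] add_left_mono mult_le_mono2 q)
          moreover have "(n + 2) * 2 \<le> Y"
            unfolding Y_def by (intro mult_le_mono2) simp
          then have "2 * n + 4 \<le> Y"
            by simp
          ultimately have "T4 \<le> T + 3000 * Y"
            using d(5) by linarith
          then show ?thesis
            by (simp add: q_def Y_def)
        qed
        ultimately show ?case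
          using d(3,4) K by blast
      qed (use R3 L X ar fe3 fs in auto)
    qed (use R2 R L ar fr lenP X M2 P(2) fr_le b(4) a(4) in \<open>auto simp: f_def rev_nth\<close>)
  qed (use R1 R L ar fr lenP X a(2,3) P(1) fr_le MT in \<open>auto simp: f_def\<close>)
qed (use R S L ar X order_trans[OF less_imp_le[OF less_exp] R(6)] in auto)

definition solve :: com where
  "solve = (wordlen ;; 3 :=! V 2 *! V 2 ;; sort_blocks ;; ids 1 2 1 5 ;; windows 7 6 7 8 9 ;;
     windows 6 10 11 12 13 ;; last_start 8 8 ;; last_start 12 9 ;; solvable.search ;;
     64 :=! V 0 ;; 65 :=! V 81 ;; 83 :=! Ld 15 (V 65 *! V 61 +! (V 64 -! V 65)) ;; 85 :=! N 1 ;;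
     solvable.bt_F ;; solvable.bt_f ;; solvable.emit)"

text \<open>None of the programs mentions a parameter of its locale, so outside of it
  \<open>lcs.main\<close> is a single closed program that serves all inputs. Deciding first whether
  \<open>P\<close> is a subsequence of both strings uses no working memory.\<close>

definition main :: com where
  "main = (0 :=! In (N 0) ;; 1 :=! In (N 1) ;; 5 :=! N 2 +! (V 0 +! V 0) ;; 6 :=! N 2 +! V 0 ;; 7 :=! N 2 ;;
     greedy 7 ;; 14 :=! V 11 ;; greedy 6 ;; If ((V 14 =! V 1) &! (V 11 =! V 1)) solve (Out (N 0)))"

lemma gr_full: "length X = n \<Longrightarrow> gr P X 0 n = r \<longleftrightarrow> subseq P X"
  using win_gr[of P X 0 n] win_0[of P X] gr_le_length[of P X 0 n] lenP by auto

lemma wp_main: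
  assumes yes: "\<And>R T'. subseq P A \<Longrightarrow> subseq P B \<Longrightarrow> R 0 = n \<Longrightarrow> R 1 = r \<Longrightarrow> R 5 = 2 + 2 * n \<Longrightarrow>
      R 6 = 2 + n \<Longrightarrow> R 7 = 2 \<Longrightarrow> T' \<le> 100 * n + 250 \<Longrightarrow> wp solve (\<lambda>R M U T. Q R M U (T + 2)) R M U T'"
    and no: "\<And>R T'. \<not> (subseq P A \<and> subseq P B) \<Longrightarrow> T' \<le> 100 * n + 250 \<Longrightarrow> Q R M (U @ [0]) T'"
  shows "wp main Q R M U 0"
proof -
  have "wp (greedy 7) (wp (14 :=! V 11 ;; greedy 6 ;; If ((V 14 =! V 1) &! (V 11 =! V 1)) solve (Out (N 0))) Q) R1 M U T1"
    if R1: "R1 0 = n" "R1 1 = r" "R1 5 = 2 + 2 * n" "R1 6 = 2 + n" "R1 7 = 2" and T1: "T1 \<le> 60" for R1 T1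
  proof (rule wp_greedy[where X = A], goal_cases)
    case (7 R2 T2)
    have R2: "R2 0 = n" "R2 1 = r" "R2 5 = 2 + 2 * n" "R2 6 = 2 + n" "R2 7 = 2" "R2 11 = gr P A 0 n"
      using 7 R1 by simp_all
    have "wp (greedy 6) (wp (If ((V 14 =! V 1) &! (V 11 =! V 1)) solve (Out (N 0))) Q) (R2(14 := gr P A 0 n)) M U T3"
      if T3: "T3 \<le> T2 + 10" for T3
    proof (rule wp_greedy[where X = B], goal_cases)
      case (7 R3 T4)
      have R3: "R3 0 = n" "R3 1 = r" "R3 5 = 2 + 2 * n" "R3 6 = 2 + n" "R3 7 = 2" "R3 14 = gr P A 0 n"
        "R3 11 = gr P B 0 n"
        using 7 R2 by simp_all
      have T4: "T4 \<le> 100 * n + 200"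
        using 7(3) T3 \<open>T2 \<le> T1 + 50 * n + 50\<close> T1 by linarith
      show ?case
      proof (cases "subseq P A \<and> subseq P B")
        case True
        have "wp solve (\<lambda>R M U T. Q R M U (T + 2)) R3 M U T'" if "T' \<le> T4 + 20" for T'
          by (rule yes) (use True R3 T4 that in auto)
        then show ?thesis
          using True R3 gr_full[OF lenA] gr_full[OF lenB] by simp
      next
        case False
        have "Q R3 M (U @ [0]) T'" if "T' \<le> T4 + 20" for T'
          by (rule no) (use False T4 that in auto)
        then show ?thesis
          using False R3 gr_full[OF lenA] gr_full[OF lenB] w16 by auto
      qed
    qed (use R2 textat_B lenB in auto)
    then show ?case
      using R2 by simp
  qed (use R1 textat_A lenA in auto)
  then show ?thesis
    unfolding main_def using length_inp inp_0 inp_1 w16 nw' by simp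
qed

end

context solvable
begin

lemma wp_solve:
  assumes R: "R 0 = n" "R 1 = r" "R 5 = 2 + 2 * n" "R 6 = 2 + n" "R 7 = 2" and M: "M = (\<lambda>_ _. 0)"
    and K: "\<And>R' M' T' Z W. str_ic_cs A B P Z \<Longrightarrow> length Z = l \<Longrightarrow>
      T' \<le> T + 300000 * ((n + 2) * (r div W + 1 + (n - l))) \<Longrightarrow> 1 \<le> W \<Longrightarrow> 2 ^ W \<le> max r 2 \<Longrightarrow>
      r < 2 ^ (W + 1) \<Longrightarrow> Q R' M' (U @ 1 # Z) T'"
  shows "wp solve Q R M U T"
  unfolding solve_def wp.simps(4)
proof (rule wp_wordlen, goal_cases)
  case (2 R1 T1)
  define W where "W = R1 2"
  have W: "1 \<le> W" "2 ^ W \<le> max r 2" "r < 2 ^ (W + 1)"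
    using 2 by (simp_all add: W_def)
  have T1: "T1 \<le> T + 50 * n + 150"
    using 2 by simp
  have W2: "2 ^ W \<le> n + 2"
    using W(2) rn by linarith
  have cube: "W ^ 3 \<le> 7 * (r + 2)"
  proof -
    have "2 ^ W \<le> r + 2"
      using W(2) by (rule order_trans) simp
    then show ?thesis
      by (intro order_trans[OF wordlen_cube] mult_le_mono2)
  qed
  define q where "q = r div W"
  have rq: "r \<le> W * q + W"
  proof -
    have "r = W * q + r mod W"
      by (simp add: q_def)
    moreover have "r mod W < W"
      using W(1) by simp
    ultimately show ?thesis
      by linarith
  qed
  \<comment> \<open>\<open>W ^ 3 \<le> 7 * (r + 2)\<close> is divided by \<open>W\<close>, using
    that \<open>r\<close> is at most \<open>W * q + W\<close>.\<close>
  have WW: "W * W \<le> 7 * q + 21"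
  proof -
    have "W * (W * W) \<le> 7 * (r + 2)"
      using cube by (simp add: power3_eq_cube mult.assoc)
    also have "\<dots> \<le> 7 * (W * q + W + 2 * W)"
      using rq W(1) by simp
    also have "\<dots> = W * (7 * q + 21)"
      by (simp add: algebra_simps)
    finally show ?thesis
      using W(1) by simp
  qed
  have qn: "q \<le> n"
    unfolding q_def using div_le_dividend rn by (rule order_trans)
  have Wle: "W \<le> 7 * q + 21"
    using W(1) by (intro order_trans[OF _ WW]) simp
  have WWn: "W * W \<le> 64 * n + 64" "n + W * W < 2 ^ w"
    using WW qn nw' by linarith+
  have total: "T13 \<le> T + 300000 * ((n + 2) * (q + 1 + (n - l)))"
    if "T1 \<le> T + 50 * n + 150" "T2 \<le> T1 + 10" "T3 \<le> T2 + 100 * (r * (W * W)) + 100 * r + 20"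
      "T4 \<le> T3 + 20 + r * (400 * (q + W + 1) + 100)" "T5 \<le> T4 + 3000 * ((n + 2) * (q + W + 2))"
      "T6 \<le> T5 + 3000 * ((n + 2) * (q + W + 2))" "T7 \<le> T6 + 50 * n + 50" "T8 \<le> T7 + 50 * n + 50"
      "T9 \<le> T8 + 6000 * (n + 1) * (4 * (n - l) + 1) + 50" "T10 \<le> T9 + 50" "T11 \<le> T10 + 600 * n + 800"
      "T12 \<le> T11 + 500 * n + 50" "T13 \<le> T12 + 50 * n + 50"
    for T1 T2 T3 T4 T5 T6 T7 T8 T9 T10 T11 T12 T13
  proof -
    \<comment> \<open>Every phase costs at most a constant multiple of \<open>Y\<close>; the bounds
      on \<open>W\<close> and \<open>W * W\<close> in terms of \<open>q\<close> eliminate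
      \<open>W\<close> from their costs.\<close>
    define Y where "Y = (n + 2) * (q + 1 + (n - l))"
    have Y: "a * b \<le> m * Y" if "a \<le> n + 2" "b \<le> m * q + m + m * (n - l)" for a b m
    proof -
      have "a * b \<le> (n + 2) * (m * q + m + m * (n - l))"
        using that by (rule mult_le_mono)
      also have "m * q + m + m * (n - l) = m * (q + 1 + (n - l))"
        by (simp only: add_mult_distrib2 mult_1_right)
      also have "(n + 2) * (m * (q + 1 + (n - l))) = m * Y"
        unfolding Y_def by (rule mult.left_commute)
      finally show ?thesis .
    qed
    define p1 p2 p3 p4 where "p1 = r * (W * W)" and "p2 = r * (400 * (q + W + 1) + 100)"
      and "p3 = (n + 2) * (q + W + 2)" and "p4 = 6000 * (n + 1) * (4 * (n - l) + 1)"
    note p = p1_def p2_def p3_def p4_def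
    have "p1 \<le> 21 * Y"
      unfolding p by (rule Y) (use rn WW in simp_all)
    moreover have "p2 \<le> 8900 * Y"
      unfolding p by (rule Y) (use rn Wle in simp)+
    moreover have "p3 \<le> 23 * Y"
      unfolding p by (rule Y) (use Wle in simp)+
    moreover have "(n + 1) * (4 * (n - l) + 1) \<le> 4 * Y"
      by (rule Y) simp_all
    then have "p4 \<le> 24000 * Y"
      unfolding p by (simp only: mult.assoc)
    moreover have "(n + 2) * 1 \<le> 1 * Y"
      by (rule Y) simp_all
    then have "n + 2 \<le> Y"
      by simp
    ultimately show ?thesis
      unfolding Y_def[symmetric] using that[folded p] rn by linarith
  qed
  have R1: "R1 0 = n" "R1 1 = r" "R1 2 = W" "R1 5 = 2 + 2 * n" "R1 6 = 2 + n" "R1 7 = 2"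
    using 2(1) R W_def by simp_all
  have "wp sort_blocks (wp (ids 1 2 1 5) (wp (windows 7 6 7 8 9) (wp (windows 6 10 11 12 13)
      (wp (last_start 8 8) (wp (last_start 12 9) (wp search (wp (64 :=! V 0) (wp (65 :=! V 81)
      (wp (83 :=! Ld 15 (V 65 *! V 61 +! (V 64 -! V 65))) (wp (85 :=! N 1) (wp bt_F (wp bt_f (wp emit Q)))))))))))))
      (R1(3 := W * W)) M U T2" if T2: "T2 \<le> T1 + 10" for T2
  proof (rule wp_sort_blocks[where ?Q0.0 = "W * W"], goal_cases)
    case (9 R3 M3 T3)
    note a = 9
    have R3: "R3 0 = n" "R3 1 = r" "R3 2 = W" "R3 3 = W * W" "R3 5 = 2 + 2 * n" "R3 6 = 2 + n" "R3 7 = 2"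
      using a(1) R1 by simp_all
    define S where "S = (\<lambda>t. M3 0 (t + 1))"
    have S: "bsorted (W * W) r S" "S ` {..<r} = set P"
      using a(3,4) by (simp_all add: S_def)
    show ?case
    proof (rule wp_ids[where W = W and S = S and X = P], goal_cases)
      case (19 R4 M4 T4)
      note b = 19
      have R4: "R4 0 = n" "R4 1 = r" "R4 2 = W" "R4 3 = W * W" "R4 5 = 2 + 2 * n" "R4 6 = 2 + n" "R4 7 = 2"
        using b(1) R3 by simp_all
      have M4: "S = (\<lambda>t. M4 0 (t + 1))" "M4 3 x = 0" for x
        using b(2) a(2) M by (simp_all add: S_def)
      have kp: "M4 1 k = kap S (P ! k)" "M4 2 k = kap S (rev P ! k)" if "k < r" for k
        using b(3,4) that lenP by simp_all
      show ?case
      proof (rule wp_windows[where W = W and S = S and X = A], goal_cases)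
        case (23 R5 M5 T5)
        note c = 23
        have R5: "R5 0 = n" "R5 1 = r" "R5 2 = W" "R5 3 = W * W" "R5 5 = 2 + 2 * n" "R5 6 = 2 + n"
          using c(1) R4 by simp_all
        have M5: "S = (\<lambda>t. M5 0 (t + 1))" "M5 1 = M4 1" "M5 2 = M4 2"
          using c(2) M4 by simp_all
        show ?case
        proof (rule wp_windows[where W = W and S = S and X = B], goal_cases)
          case (23 R6 M6 T6)
          note d = 23
          have R6: "R6 0 = n" "R6 1 = r" "R6 2 = W" "R6 5 = 2 + 2 * n" "R6 6 = 2 + n"
            using d(1) R5 by simp_all
          have M6: "M6 6 = M5 6" "M6 8 = M5 8" "M6 9 = M5 9"
            using d(2) by simp_all
          have wo: "windows_ok M6"
            unfolding windows_ok_def M6 using c(4,6) d(5) by blast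
          show ?case
          proof (rule wp_last_start[where X = A], goal_cases)
            case (8 R7 T7)
            note e = 8
            have R7: "R7 0 = n" "R7 1 = r" "R7 2 = W" "R7 5 = 2 + 2 * n" "R7 6 = 2 + n"
              using e(1) R6 by simp_all
            have la': "R7 8 = la"
              using e(2) e(3)[of "R7 8"] e(3)[of la] la by (meson order_antisym order_refl)
            show ?case
            proof (rule wp_last_start[where X = B], goal_cases)
              case (8 R8 T8)
              note f = 8
              have R8: "R8 0 = n" "R8 1 = r" "R8 2 = W" "R8 5 = 2 + 2 * n" "R8 6 = 2 + n" "R8 8 = la"
                using f(1) R7 la' by simp_all
              have lb': "R8 9 = lb"
                using f(2) f(3)[of "R8 9"] f(3)[of lb] lb by (meson order_antisym order_refl)
              have br: "base_regs R8"
                using R8 lb' by (simp add: base_regs_def)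
              show ?case
              proof (rule wp_search[OF br wo], goal_cases)
                case (1 D R9 M9 T9)
                note g = 1
                have br9: "base_regs R9"
                  using br g(1) by (simp add: base_regs_def)
                have wo9: "windows_ok M9"
                  using wo g(2) by (simp add: windows_ok_def)
                have sv: "n - l \<le> D" "D \<le> 2 * (n - l)" "R9 61 = D + 1" "R9 81 = l" "R9 63 \<le> l + 1"
                  "tab (hF D) r D (n + 1) (R9 63) (M9 15) (n + 1) 0"
                  using g(3) by (simp_all add: solved_def)
                have R9: "R9 0 = n" "R9 2 = W"
                  using br9 R8 g(1) by (simp_all add: base_regs_def)
                define v where "v = hF D l n"
                have v: "v \<le> n"
                  using hF_found[of "n - l" D] sv(1) ln l_ex by (simp add: v_def)
                have lKM: "l < R9 63"
                proof (rule ccontr)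
                  assume "\<not> l < R9 63"
                  then have "hF D l n = n + 1"
                    using tab_get(2)[OF sv(6) rl, of n] sv(1) ln by simp
                  then show False
                    using v by (simp add: v_def)
                qed
                have val: "M9 15 (l * (D + 1) + (n - l)) = v"
                  using tab_get(1)[OF sv(6) rl, of n] sv(1) ln lKM by (simp add: v_def)
                have idx: "l * (D + 1) + (n - l) < L"
                proof (rule index_less)
                  have "(l + 1) * (D + 1) \<le> (l + 1) * (2 * (n - l) + 1)"
                    using sv(2) by (intro mult_le_mono2) simp
                  then show "(l + 1) * (D + 1) \<le> L"
                    using Ll by linarith
                qed (use sv in auto)
                then have idx': "l * (D + 1) + (n - l) < 2 ^ w" "l * (D + 1) < 2 ^ w"
                  using L16 by linarith+
                define Rb where "Rb = R9(64 := n, 65 := l, 83 := v, 85 := 1)"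
                have bt: "wp bt_F (wp bt_f (wp emit Q)) Rb M9 U T10" if T10: "T10 \<le> T9 + 50" for T10
                proof (rule wp_bt_F[where D = D], goal_cases)
                  case (9 R11 M11 T11)
                  note h = 9
                  have R11: "base_regs R11" "R11 81 = l" "R11 2 = W"
                    using h(1) br9 sv R9 by (simp_all add: base_regs_def Rb_def)
                  have sv11: "solved D R11 M11"
                    using g(3) h(1,2) by (simp add: solved_def Rb_def)
                  show ?case
                  proof (rule wp_bt_f[where D = D], goal_cases)
                    case (7 R12 M12 T12)
                    note j = 7
                    have R12: "R12 81 = l" "R12 2 = W"
                      using j(1) R11 by simp_all
                    show ?case
                    proof (rule wp_emit, goal_cases)
                      case (2 R13 T13)
                      show ?case
                      proof (rule K)
                        show "str_ic_cs A B P (seg (M12 0) 0)"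
                          using j by (simp add: str_ic_cs_def)
                        show "length (seg (M12 0) 0) = l"
                          by simp
                        show "1 \<le> W" "2 ^ W \<le> max r 2" "r < 2 ^ (W + 1)"
                          using W by simp_all
                        have "T3 \<le> T2 + 100 * (r * (W * W)) + 100 * r + 20"
                          using a by simp
                        moreover have "T4 \<le> T3 + 20 + r * (400 * (q + W + 1) + 100)"
                          using b lenP by (simp add: q_def)
                        moreover have "T5 \<le> T4 + 3000 * ((n + 2) * (q + W + 2))"
                          "T6 \<le> T5 + 3000 * ((n + 2) * (q + W + 2))"
                          using c d by (simp_all add: q_def)
                        moreover have "T9 \<le> T8 + 6000 * (n + 1) * (4 * (n - l) + 1) + 50"
                          using g by simp
                        ultimately show "T13 \<le> T + 300000 * ((n + 2) * (r div W + 1 + (n - l)))"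
                          using total[of T1 T2 T3 T4 T5 T6 T7 T8 T9 T10 T11 T12 T13] T1 T2 T10 e f h j \<open>T13 \<le> T12 + 50 * n + 50\<close>
                          by (simp add: q_def)
                      qed
                    qed (use R12 in auto)
                  qed (use R11 sv11 h in auto)
                qed (use br9 g(3) wo9 v sv in \<open>auto simp: Rb_def base_regs_def solved_def v_def\<close>)
                then show ?case
                  using R9 sv val idx idx' w16 ln nw' by (simp add: Rb_def)
              qed
            qed (use R7 Ln lenB sub d(5) in auto)
          qed (use R6 Ln lenA sub c(5) M6 in auto)
        qed (use R5 W W2 M5 S kp c(3) Ln textat_B lenB in simp_all)
      qed (use R4 W W2 M4 S kp Ln textat_A lenA in simp_all)
    qed (use R3 W(1) order_trans[OF less_imp_le[OF less_exp] W2] S Ln textat_P lenP rn S_def in simp_all)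
  qed (use R1 W WWn Ln in auto)
  then show ?case
    using R1 WWn by simp
qed (use R in simp)

end

section \<open>Resource bounds\<close>

lemma ex_str_ic_cs: "(\<exists>Z. str_ic_cs A B P Z) \<longleftrightarrow> subseq P A \<and> subseq P B"
proof
  assume "\<exists>Z. str_ic_cs A B P Z"
  then show "subseq P A \<and> subseq P B"
    unfolding str_ic_cs_def by (meson sublist_imp_subseq subseq_order.order_trans)
next
  assume "subseq P A \<and> subseq P B"
  then have "str_ic_cs A B P P"
    by (simp add: str_ic_cs_def)
  then show "\<exists>Z. str_ic_cs A B P Z"
    by blast
qed

text \<open>Seven of the nine factors \<open>n + 2\<close> are at least 2 each and provide the
  constant \<open>2 ^ 7\<close>; the other two provide the square.\<close>

lemma word_bound:
  assumes "9 * log 2 (real (n + 2)) \<le> real w"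
  shows "64 * ((n + 2) * (n + 2)) < 2 ^ w"
proof -
  have "real (n + 2) ^ 9 = 2 powr (9 * log 2 (real (n + 2)))"
    by (simp add: powr_powr[symmetric] powr_realpow mult.commute[of 9])
  also have "\<dots> \<le> 2 powr real w"
    using assms by simp
  also have "\<dots> = 2 ^ w"
    by (simp add: powr_realpow)
  finally have "real ((n + 2) ^ 9) \<le> real (2 ^ w)"
    by (simp add: add.commute)
  then have "(n + 2) ^ 9 \<le> 2 ^ w"
    by (simp only: of_nat_le_iff)
  moreover have "(2::nat) ^ 7 \<le> (n + 2) ^ 7"
    by (rule power_mono) auto
  then have "128 * ((n + 2) * (n + 2)) \<le> (n + 2) ^ 7 * ((n + 2) * (n + 2))"
    by (intro mult_le_mono1) simp
  moreover have "(n + 2) ^ 7 * ((n + 2) * (n + 2)) = (n + 2) ^ 9"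
    by (simp add: power_numeral_reduce power2_eq_square mult_ac)
  moreover have "0 < (n + 2) * (n + 2)"
    by simp
  ultimately show ?thesis
    by linarith
qed

text \<open>Since \<open>log r\<close> is at most \<open>W + 1 \<le> 2 * W\<close>, a quotient by
  \<open>W\<close> costs a factor of at most 2 compared with one by \<open>log r\<close>. For
  positive \<open>n\<close> another factor 3 turns \<open>n + 2\<close> into
  \<open>n\<close>.\<close>

lemma time_le:
  assumes W: "1 \<le> W" "r < 2 ^ (W + 1)" and "l \<le> n" "r \<le> n"
  shows "real ((n + 2) * (r div W + 1 + (n - l))) \<le> 6 * (time_bound n r (int l) + 1)"
proof -
  define lg where "lg = log 2 (real (max r 2))"
  define y where "y = real r / lg"
  define d where "d = real n - real l"
  have d: "0 \<le> d" "real (n - l) = d"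
    using assms by (auto simp: d_def)
  have lg: "0 < lg"
    by (simp add: lg_def)
  have "(2::nat) ^ 1 \<le> 2 ^ (W + 1)"
    by (rule power_increasing) simp_all
  then have "real (max r 2) \<le> 2 ^ (W + 1)"
    using W(2) by (metis less_imp_le max.bounded_iff of_nat_le_iff of_nat_numeral of_nat_power power_one_right)
  then have "lg \<le> log 2 (2 ^ (W + 1))"
    unfolding lg_def by (subst log_le_cancel_iff) auto
  also have "\<dots> = real (W + 1)"
    by (rule log_pow_cancel) auto
  finally have lgW: "lg \<le> 2 * real W"
    using W(1) by simp
  have "real (r div W) \<le> real r / real W"
    by (rule of_nat_div_le_of_nat)
  also have "\<dots> \<le> 2 * y"
  proof -
    have "real r * lg \<le> real r * (2 * real W)"
      using lgW by (rule mult_left_mono) simp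
    then show ?thesis
      using lg W(1) by (simp add: y_def field_simps)
  qed
  finally have "real ((n + 2) * (r div W + 1 + (n - l))) \<le> (real n + 2) * (2 * y + 1 + d)"
    using d by (simp add: mult_left_mono)
  moreover have tb: "time_bound n r (int l) = real n * y + real n * (d + 1)"
    by (simp add: time_bound_def y_def lg_def d_def)
  moreover have "(real n + 2) * (2 * y + 1 + d) \<le> 6 * (real n * y + real n * (d + 1) + 1)"
  \<comment> \<open>For \<open>n = 0\<close> the bound is zero, and the left side is absorbed by the
    additive constant.\<close>
  proof (cases "n = 0")
    case True
    then show ?thesis
      using assms by (simp add: y_def d_def)
  next
    case False
    have y: "0 \<le> y"
      using lg by (simp add: y_def)
    have "1 * y \<le> real n * y"
      using False y by (intro mult_right_mono) auto
    moreover have "1 * (d + 1) \<le> real n * (d + 1)"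
      using False d by (intro mult_right_mono) auto
    moreover have "0 \<le> real n * y"
      using y by simp
    ultimately show ?thesis
      using d(1) by (simp add: algebra_simps)
  qed
  ultimately show ?thesis
    by (simp only: order_trans)
qed

lemma last_start_ex:
  assumes "subseq P X" "length X = n"
  obtains s0 where "s0 \<le> n" "\<And>s. s \<le> n \<Longrightarrow> s \<le> s0 \<longleftrightarrow> EE P X s \<le> n"
proof -
  let ?S = "{s. s \<le> n \<and> EE P X s \<le> n}"
  have fin: "finite ?S"
    by (rule finite_subset[of _ "{..n}"]) auto
  have "0 \<in> ?S"
    using assms win_0[of P X] EE_le_iff[of n X P 0] by simp
  then have "Max ?S \<in> ?S"
    using fin by (intro Max_in) auto
  moreover have "s \<le> Max ?S" if "s \<le> n" "EE P X s \<le> n" for s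
    using fin that by (intro Max_ge) auto
  moreover have "EE P X s \<le> n" if "s \<le> Max ?S" for s
    using EE_mono[OF that, of P X] \<open>Max ?S \<in> ?S\<close> by simp
  ultimately show ?thesis
    using that[of "Max ?S"] by blast
qed

lemma (in solvable) main_correct:
  "wp main (\<lambda>R M U T. (\<exists>Z. U = encode_sol (Some Z) \<and> is_str_ic_lcs A B P (Some Z) \<and> length Z = l) \<and>
     T \<le> nat \<lfloor>2000000 * (time_bound n r (int l) + 1)\<rfloor>) (\<lambda>_. 0) (\<lambda>_ _. 0) [] 0"
proof (rule wp_main)
  fix R :: "nat \<Rightarrow> nat" and T0
  assume T0: "T0 \<le> 100 * n + 250" and R: "R 0 = n" "R 1 = r" "R 5 = 2 + 2 * n" "R 6 = 2 + n" "R 7 = 2"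
  show "wp solve (\<lambda>R M U T. (\<exists>Z. U = encode_sol (Some Z) \<and> is_str_ic_lcs A B P (Some Z) \<and> length Z = l) \<and>
     T + 2 \<le> nat \<lfloor>2000000 * (time_bound n r (int l) + 1)\<rfloor>) R (\<lambda>_ _. 0) [] T0"
  proof (rule wp_solve, use R in \<open>simp_all only:\<close>)
    fix T Z W
    assume Z: "str_ic_cs A B P Z" "length Z = l" and W: "1 \<le> W" "r < 2 ^ (W + 1)"
      and T: "T \<le> T0 + 300000 * ((n + 2) * (r div W + 1 + (n - l)))"
    have "is_str_ic_lcs A B P (Some Z)"
      using Z l_max by (auto simp: is_arg_max_def not_less)
    moreover have "T + 2 \<le> nat \<lfloor>2000000 * (time_bound n r (int l) + 1)\<rfloor>"
    proof -
      have "n + 2 \<le> (n + 2) * (r div W + 1 + (n - l))"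
        by simp
      \<comment> \<open>Everything before \<open>solve\<close> costs at most \<open>200 * Y\<close>.
        Multiplied by the factor 6 of \<open>time_le\<close> this stays below the constant
        2000000.\<close>
      moreover have "T + 2 \<le> 300200 * Y" if "T \<le> T0 + 300000 * Y" "n + 2 \<le> Y" for Y
        using that T0 by linarith
      ultimately have "T + 2 \<le> 300200 * ((n + 2) * (r div W + 1 + (n - l)))"
        using T by blast
      then have "real (T + 2) \<le> 300200 * real ((n + 2) * (r div W + 1 + (n - l)))"
        by (metis of_nat_le_iff of_nat_mult of_nat_numeral)
      also have "\<dots> \<le> 300200 * (6 * (time_bound n r (int l) + 1))"
        using time_le[OF W ln rn] by simp
      finally have "real (T + 2) \<le> 2000000 * (time_bound n r (int l) + 1)"
        using time_le[OF W ln rn] by linarith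
      then show ?thesis
        by (rule le_nat_floor)
    qed
    ultimately show "(\<exists>Z'. [] @ 1 # Z = encode_sol (Some Z') \<and> is_str_ic_lcs A B P (Some Z') \<and> length Z' = l) \<and>
        T + 2 \<le> nat \<lfloor>2000000 * (time_bound n r (int l) + 1)\<rfloor>"
      using Z(2) by (intro conjI exI[of _ Z]) simp_all
  qed
qed (use sub in simp)

lemma (in solvable) main_runs:
  "\<exists>Z t m. runs_to w (cc 0 main) inp (encode_sol (Some Z)) t m \<and> is_str_ic_lcs A B P (Some Z) \<and>
     length Z = l \<and> t \<le> nat \<lfloor>2000000 * (time_bound n r (int l) + 1)\<rfloor> \<and> m \<le> 16 * L"
  using wp_runs_to[OF main_correct] by blast

lemma (in lcs) main_runs_None:
  assumes "\<not> (subseq P A \<and> subseq P B)"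
  shows "\<exists>t m. runs_to w (cc 0 main) inp (encode_sol None) t m \<and> t \<le> 100 * n + 250 \<and> m \<le> 16 * L"
proof -
  have "wp main (\<lambda>R M U T. U = encode_sol None \<and> T \<le> 100 * n + 250) (\<lambda>_. 0) (\<lambda>_ _. 0) [] 0"
    by (rule wp_main) (use assms in auto)
  then show ?thesis
    using wp_runs_to[where Q = "\<lambda>U. U = encode_sol None"] by blast
qed

theorem theorem3:
  "\<exists>(prog :: program) (k :: nat) (c :: real).
     \<forall>(w :: nat) (n :: nat) (r :: nat) (A :: nat list) (B :: nat list) (P :: nat list).
       length A = n \<and> length B = n \<and> length P = r \<and> r \<le> n \<and>
       real k * log 2 (real (n + 2)) \<le> real w \<and>
       (\<forall>x \<in> set A \<union> set B \<union> set P. x < 2 ^ w) \<longrightarrow>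
       (\<exists>Z t m.
          runs_to w prog (encode_input A B P) (encode_sol Z) t m \<and>
          is_str_ic_lcs A B P Z \<and>
          real t \<le> c * (time_bound n r (sol_length Z) + 1) \<and>
          real m \<le> c * (space_bound n (sol_length Z) + 1))"
proof (rule exI[of _ "cc 0 lcs.main"], rule exI[of _ 9], rule exI[of _ 2000000], intro allI impI, elim conjE)
  fix w n r :: nat and A B P :: "nat list"
  assume len: "length A = n" "length B = n" "length P = r" "r \<le> n"
    and w: "real 9 * log 2 (real (n + 2)) \<le> real w"
  have nw: "64 * ((n + 2) * (n + 2)) < 2 ^ w"
    using word_bound w by simp
  have "16 \<le> 64 * ((n + 2) * (n + 2))"
    by simp
  then have w16: "16 < (2::nat) ^ w"
    using nw by (rule le_less_trans)
  show "\<exists>Z t m. runs_to w (cc 0 lcs.main) (encode_input A B P) (encode_sol Z) t m \<and>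
      is_str_ic_lcs A B P Z \<and> real t \<le> 2000000 * (time_bound n r (sol_length Z) + 1) \<and>
      real m \<le> 2000000 * (space_bound n (sol_length Z) + 1)"
  proof (cases "subseq P A \<and> subseq P B")
    case False
    \<comment> \<open>With \<open>L = 0\<close> no memory access satisfies \<open>wp\<close>, so
      this instance proves that no working memory is touched when there is no solution.\<close>
    have "lcs w (encode_input A B P) 0 A B P n r"
      using len nw w16 by unfold_locales auto
    then obtain t m where "runs_to w (cc 0 lcs.main) (encode_input A B P) (encode_sol None) t m"
      "t \<le> 100 * n + 250" "m \<le> 16 * 0"
      using lcs.main_runs_None[OF _ False] by blast
    moreover have "real (100 * n + 250) \<le> 2000000 * (time_bound n r (-1) + 1)"
    proof -
      have "real n * 1 \<le> real n * (real n + 2)"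
        by (intro mult_left_mono) auto
      moreover have "time_bound n r (-1) = real n * real r / log 2 (real (max r 2)) + real n * (real n + 2)"
        by (simp add: time_bound_def)
      moreover have "0 \<le> real n * real r / log 2 (real (max r 2))"
        by simp
      ultimately have "real n \<le> time_bound n r (-1)"
        by linarith
      then show ?thesis
        by simp
    qed
    moreover have "is_str_ic_lcs A B P None"
      using False ex_str_ic_cs by auto
    ultimately show ?thesis
      by (intro exI[of _ None] exI[of _ t] exI[of _ m]) (simp add: space_bound_def)
  next
    case True
    have bnd: "length Z \<le> n" if "str_ic_cs A B P Z" for Z
      using that len(1) by (auto simp: str_ic_cs_def dest: list_emb_length)
    obtain Z0 where Z0: "str_ic_cs A B P Z0" "\<And>Z. str_ic_cs A B P Z \<Longrightarrow> length Z \<le> length Z0"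
      using True ex_str_ic_cs ex_has_greatest_nat[of "str_ic_cs A B P" _ length "n + 1"] bnd
      by (metis less_Suc_eq_le Suc_eq_plus1)
    define l where "l = length Z0"
    have ln: "l \<le> n"
      using Z0 bnd by (simp add: l_def)
    obtain la where la: "la \<le> n" "\<And>s. s \<le> n \<Longrightarrow> s \<le> la \<longleftrightarrow> EE P A s \<le> n"
      using last_start_ex True len by blast
    obtain lb where lb: "lb \<le> n" "\<And>s. s \<le> n \<Longrightarrow> s \<le> lb \<longleftrightarrow> EE P B s \<le> n"
      using last_start_ex True len by blast
    \<comment> \<open>A sum takes the place of a maximum, so that \<open>L\<close> satisfies both
      size conditions of \<open>solvable\<close>.\<close>
    define L where "L = 2 * n + 8 + (l + 1) * (2 * (n - l) + 1)"
    define p where "p = l * (n - l)"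
    have L: "L \<le> 4 * n + 10 + 2 * p"
    proof -
      have "(l + 1) * (2 * d + 1) = 2 * (l * d) + l + 2 * d + 1" for d
        by (simp add: algebra_simps)
      then show ?thesis
        using ln by (simp add: L_def p_def)
    qed
    have "p \<le> n * n"
      unfolding p_def using ln by (intro mult_le_mono) auto
    moreover have "(n + 2) * (n + 2) = n * n + 4 * n + 4"
      by (simp add: algebra_simps)
    ultimately have L16: "16 * L \<le> 2 ^ w"
      using L nw by linarith
    have space: "real (16 * L) \<le> 2000000 * (space_bound n (int l) + 1)"
    proof -
      have "real p = real l * (real n - real l)"
        using ln by (simp add: p_def)
      \<comment> \<open>The summand \<open>n + 1\<close> in the expanded product pays for the arrays
        of linear size.\<close>
      then have "space_bound n (int l) = real (p + n + 1)"
        by (simp add: space_bound_def algebra_simps)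
      moreover have "16 * L \<le> 160 * (p + n + 1)"
        using L by simp
      then have "real (16 * L) \<le> 160 * real (p + n + 1)"
        by (metis of_nat_le_iff of_nat_mult of_nat_numeral)
      ultimately show ?thesis
        by simp
    qed
    have time0: "0 \<le> time_bound n r (int l)"
      unfolding time_bound_def using ln by (intro add_nonneg_nonneg mult_nonneg_nonneg divide_nonneg_pos) simp_all
    have "solvable w (encode_input A B P) L A B P n r l la lb"
      using len nw w16 L16 True Z0 la lb by unfold_locales (auto simp: L_def l_def)
    from solvable.main_runs[OF this] obtain Z t m
      where Z: "runs_to w (cc 0 lcs.main) (encode_input A B P) (encode_sol (Some Z)) t m"
        "is_str_ic_lcs A B P (Some Z)" "length Z = l"
      and t: "t \<le> nat \<lfloor>2000000 * (time_bound n r (int l) + 1)\<rfloor>" and m: "m \<le> 16 * L"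
      by (elim exE conjE)
    have "real t \<le> real (nat \<lfloor>2000000 * (time_bound n r (int l) + 1)\<rfloor>)"
      using t by (rule of_nat_mono)
    also have "\<dots> \<le> 2000000 * (time_bound n r (int l) + 1)"
      using time0 by (intro of_nat_floor mult_nonneg_nonneg) simp_all
    finally have T: "real t \<le> 2000000 * (time_bound n r (sol_length (Some Z)) + 1)"
      by (simp only: sol_length.simps Z(3))
    have M: "real m \<le> 2000000 * (space_bound n (sol_length (Some Z)) + 1)"
      unfolding sol_length.simps Z(3) using of_nat_mono[OF m] space by (rule order_trans)
    show ?thesis
      by (rule exI[of _ "Some Z"], rule exI[of _ t], rule exI[of _ m]) (intro conjI Z(1,2) T M)
  qed
qed

end
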